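(* Let $n\in\{2,3\}$ and let $(X,\|\cdot\|)$ be an $n$-dimensional real normed linear space such that the derivative of the norm $\|\cdot\|$ is Lipschitz on the unit sphere (e.g., $X=\ell^p_n$, $p\ge2$). Let $F\subset X$ be a nonempty closed set and denote $S_r(F):=\{x\in X:\ \mathrm{dist}_{\|\cdot\|}(x,F)=r\}$ and $F_{\ge r}:=\{x\in X:\ \mathrm{dist}_{\|\cdot\|}(x,F)\ge r\}$. Then there exists a set $N\subset(0,\infty)$ with $\mathcal{H}^{(n-1)/2}(N)=0$ such that, for every $r\in(0,\infty)\setminus N$: (i) The set $S_r(F)$ is either empty or an $(n-1)$-dimensional Lipschitz manifold in $(X,\|\cdot\|)$. (ii) If $\|\cdot\|_H$ is an arbitrary (equivalent) Hilbert norm on $X$, then $S_r(F)$ is either empty or an $(n-1)$-dimensional semiconcave surface in $(X,\|\cdot\|_H)$, and $F_{\ge r}$ has locally positive reach in $(X,\|\cdot\|_H)$. (iii) If $F$ is compact, then $N$ is closed in $(0,\infty)$ and $F_{\ge r}$ has positive reach in $(X,\|\cdot\|_H)$ (for an arbitrary Hilbert norm $\|\cdot\|_H$ on $X$).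
   Context: $\mathcal{H}^s$ denotes $s$-dimensional Hausdorff measure. $\mathrm{dist}_{\|\cdot\|}(x,F)=\inf_{y\in F}\|x-y\|$. $\ell^p_n$ is $\mathbb{R}^n$ with the $\ell^p$ norm. A Hilbert norm is one induced by an inner product. Lipschitz manifold: a metric space $Z$ is an $m$-dimensional Lipschitz manifold if every $a\in Z$ has an open neighbourhood $U$ and a bilipschitz homeomorphism of $U$ onto an open subset of $\mathbb{R}^m$. Semiconcavity: on an open convex subset $C$ of a real inner product space $H$, $u:C\to\mathbb{R}$ is semiconcave if for some constant $c$ the function $x\mapsto u(x)-(c/2)\|x\|^2$ is concave on $C$. A function on an open set $G\subset H$ is locally semiconcave if for each $x\in G$ there is $\delta>0$ such that it is semiconcave on $B(x,\delta)$. Semiconcave surface: let $H$ be an $n$-dimensional real inner product space, $n\ge2$. A nonempty set $M\subset H$ is an $(n-1)$-dimensional semiconcave surface in $H$ if for each $x\in M$ there exist an $(n-1)$-dimensional linear subspace $Q\subset H$, an open neighbourhood $W$ of $x$, a set $D\subset Q$ open in $Q$, a vector $0\ne v\in Q^\perp$ and a locally semiconcave function $s:D\to\mathbb{R}$ such that $M\cap W=\{u+s(u)v:u\in D\}$. Reach: for a nonempty subset $A$ of a metric space $X$ and $p\in A$, $\mathrm{reach}(A,p)$ is the supremum of all $\varepsilon>0$ such that every $q\in X$ with $\mathrm{dist}(p,q)<\varepsilon$ has a unique nearest point in $A$ (supremum of the empty set being $0$). $A$ has locally positive reach if $\mathrm{reach}(A,p)>0$ for all $p\in A$ (vacuously true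 for $A=\emptyset$), and positive reach if $\inf_{p\in A}\mathrm{reach}(A,p)>0$. *)

theory Defs
  imports "HOL-Analysis.Analysis"
begin

section \<open>Hausdorff measure\<close>

(* No normalizing constant.  The case distinction implements the usual conventions
   diam(empty)^s = 0 for every s and diam(U)^0 = 1 for nonempty U, since 0 powr 0 = 0. *)
definition hausdorff_weight :: "real \<Rightarrow> 'a::metric_space set \<Rightarrow> ennreal" where
  "hausdorff_weight s U =
     (if U = {} then 0 else if s = 0 then 1 else ennreal (diameter U powr s))"

(* Boundedness is required separately because diameter is an unspecified real
   for unbounded sets. *)
definition hausdorff_content :: "real \<Rightarrow> real \<Rightarrow> 'a::metric_space set \<Rightarrow> ennreal" where
  "hausdorff_content s \<delta> A =
     (INF U \<in> {U :: nat \<Rightarrow> 'a set. A \<subseteq> (\<Union>i. U i) \<and> (\<forall>i. bounded (U i) \<and> diameter (U i) \<le> \<delta>)}.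
        \<Sum>i. hausdorff_weight s (U i))"

definition hausdorff_measure :: "real \<Rightarrow> 'a::metric_space set \<Rightarrow> ennreal" where
  "hausdorff_measure s A = (SUP \<delta> \<in> {0<..}. hausdorff_content s \<delta> A)"

section \<open>Norms with Lipschitz derivative\<close>

(* The derivative is a map into the dual space with its operator norm. *)
definition norm_deriv_lipschitz_on_sphere :: "'a::real_normed_vector itself \<Rightarrow> bool" where
  "norm_deriv_lipschitz_on_sphere _ \<longleftrightarrow>
     (\<exists>(D :: 'a \<Rightarrow> 'a \<Rightarrow>\<^sub>L real) L.
        (\<forall>x \<in> sphere 0 1. (norm has_derivative blinfun_apply (D x)) (at x)) \<and>
        L-lipschitz_on (sphere 0 1) D)"

section \<open>Lipschitz manifolds\<close>

(* R^m is the space of sequences supported in {..<m}; L2_set is the Euclidean norm. *)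
definition lipschitz_manifold :: "nat \<Rightarrow> 'a::metric_space set \<Rightarrow> bool" where
  "lipschitz_manifold m Z \<longleftrightarrow>
     (\<forall>a\<in>Z. \<exists>U (f :: 'a \<Rightarrow> nat \<Rightarrow> real) L.
        openin (top_of_set Z) U \<and> a \<in> U \<and> openin (Euclidean_space m) (f ` U) \<and> 0 < L \<and>
        (\<forall>x\<in>U. \<forall>y\<in>U.
           dist x y / L \<le> L2_set (\<lambda>i. f x i - f y i) {..<m} \<and>
           L2_set (\<lambda>i. f x i - f y i) {..<m} \<le> L * dist x y))"

section \<open>Inner products on a real vector space\<close>

(* The inner products are objects rather than class instances, as one normed space is
   considered with many Hilbert norms.  The Hilbert norms are the functions ip_norm B
   for an inner product B, and B is determined by ip_norm B through polarization. *)
definition inner_product_on_space :: "('a::real_vector \<Rightarrow> 'a \<Rightarrow> real) \<Rightarrow> bool" where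
  "inner_product_on_space B \<longleftrightarrow>
     bilinear B \<and> (\<forall>x y. B x y = B y x) \<and> (\<forall>x. x \<noteq> 0 \<longrightarrow> 0 < B x x)"

definition ip_norm :: "('a::real_vector \<Rightarrow> 'a \<Rightarrow> real) \<Rightarrow> 'a \<Rightarrow> real" where
  "ip_norm B x = sqrt (B x x)"

definition ip_dist :: "('a::real_vector \<Rightarrow> 'a \<Rightarrow> real) \<Rightarrow> 'a \<Rightarrow> 'a \<Rightarrow> real" where
  "ip_dist B x y = ip_norm B (x - y)"

section \<open>Semiconcavity\<close>

definition semiconcave_on ::
    "('a::real_vector \<Rightarrow> 'a \<Rightarrow> real) \<Rightarrow> 'a set \<Rightarrow> ('a \<Rightarrow> real) \<Rightarrow> bool" where
  "semiconcave_on B C u \<longleftrightarrow> (\<exists>c. concave_on C (\<lambda>x. u x - c / 2 * (ip_norm B x)\<^sup>2))"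

(* The ambient inner product space is the linear subspace Q with the restriction of B;
   G is a subset of Q, open in Q. *)
definition locally_semiconcave_on ::
    "('a::real_vector \<Rightarrow> 'a \<Rightarrow> real) \<Rightarrow> 'a set \<Rightarrow> 'a set \<Rightarrow> ('a \<Rightarrow> real) \<Rightarrow> bool" where
  "locally_semiconcave_on B Q G u \<longleftrightarrow>
     (\<forall>x\<in>G. \<exists>\<delta>>0. Metric_space.mball Q (ip_dist B) x \<delta> \<subseteq> G \<and>
        semiconcave_on B (Metric_space.mball Q (ip_dist B) x \<delta>) u)"

definition semiconcave_surface ::
    "nat \<Rightarrow> ('a::real_vector \<Rightarrow> 'a \<Rightarrow> real) \<Rightarrow> 'a set \<Rightarrow> bool" where
  "semiconcave_surface m B M \<longleftrightarrow>
     dim (UNIV :: 'a set) = m + 1 \<and> M \<noteq> {} \<and>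
     (\<forall>x\<in>M. \<exists>Q W D v s.
        subspace Q \<and> dim Q = m \<and>
        openin (Metric_space.mtopology UNIV (ip_dist B)) W \<and> x \<in> W \<and>
        openin (Metric_space.mtopology Q (ip_dist B)) D \<and>
        v \<noteq> 0 \<and> (\<forall>q\<in>Q. B q v = 0) \<and>
        locally_semiconcave_on B Q D s \<and>
        M \<inter> W = {u + s u *\<^sub>R v |u. u \<in> D})"

section \<open>Reach\<close>

(* Reach in the metric space whose points are all elements of the type and whose
   distance is d.  With values in [0, infinity], Sup {} = 0. *)
definition reach :: "('a \<Rightarrow> 'a \<Rightarrow> real) \<Rightarrow> 'a set \<Rightarrow> 'a \<Rightarrow> ennreal" where
  "reach d A p =
     Sup {ennreal \<epsilon> |\<epsilon>. 0 < \<epsilon> \<and>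
       (\<forall>q. d p q < \<epsilon> \<longrightarrow> (\<exists>!a. a \<in> A \<and> (\<forall>b\<in>A. d q a \<le> d q b)))}"

definition locally_positive_reach :: "('a \<Rightarrow> 'a \<Rightarrow> real) \<Rightarrow> 'a set \<Rightarrow> bool" where
  "locally_positive_reach d A \<longleftrightarrow> (\<forall>p\<in>A. 0 < reach d A p)"

definition positive_reach :: "('a \<Rightarrow> 'a \<Rightarrow> real) \<Rightarrow> 'a set \<Rightarrow> bool" where
  "positive_reach d A \<longleftrightarrow> 0 < (INF p\<in>A. reach d A p)"

section \<open>Level and superlevel sets of the distance function\<close>

definition dist_sphere :: "real \<Rightarrow> 'a::metric_space set \<Rightarrow> 'a set" where
  "dist_sphere r F = {x. infdist x F = r}"

definition dist_ge :: "real \<Rightarrow> 'a::metric_space set \<Rightarrow> 'a set" where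
  "dist_ge r F = {x. r \<le> infdist x F}"

end

theory Submission
  imports Defs
begin

text \<open>
  Write \<open>f\<close> for the distance function of \<open>F\<close> and \<open>G z\<close> for the derivative of the norm at
  \<open>z \<noteq> 0\<close>.  Since \<open>G\<close> is Lipschitz on the sphere, the norm lies below a quadratic that touches it
  at \<open>z\<close>, with second order coefficient \<open>K / norm z\<close> (\<open>smooth_norm_exists\<close>).  Applied to
  \<open>x - y\<close>, where \<open>y\<close> is a nearest point of \<open>x\<close> in \<open>F\<close>, this gives a quadratic upper bound of \<open>f\<close> on
  the whole space that touches \<open>f\<close> at \<open>x\<close> and has slope \<open>G (x - y)\<close> there (\<open>f_upper\<close>): \<open>f\<close> is
  semiconcave away from \<open>F\<close>.  The linear maps \<open>G (x - y)\<close>, with \<open>y\<close> ranging over the nearest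
  points, are called the slopes of \<open>f\<close> at \<open>x\<close>.

  A point \<open>x\<close> outside \<open>F\<close> is critical if no direction is strictly ascending for all of its slopes.
  The exceptional set \<open>N\<close> is the set of values of \<open>f\<close> at critical points.

  \<^bold>\<open>The critical values form a null set.\<close>  If \<open>x\<close> is critical, then for every \<open>x'\<close> some slope at \<open>x\<close>
  is nonpositive on \<open>x' - x\<close>, so \<open>f x' \<le> f x + const * |x' - x|^2\<close>; hence between critical points
  \<open>f\<close> varies at most quadratically.  Moreover a critical point has two slopes that are far apart:
  \<open>G z\<close> with \<open>z = x - y\<close>, which is at least \<open>norm z\<close> on \<open>z\<close>, and another one which is nonpositive on
  \<open>z\<close>.  If \<open>p, q\<close> and \<open>p', q'\<close> are such slopes at neighbouring critical points \<open>x\<close> and \<open>x'\<close>, the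
  upper bound of \<open>f\<close> with slope \<open>q\<close> at \<open>x\<close> and that with slope \<open>p'\<close> at \<open>x'\<close> (and likewise \<open>p\<close> and
  \<open>q'\<close>) force \<open>p - q\<close> to be small on \<open>x' - x\<close> when \<open>p'\<close> is near \<open>p\<close> and \<open>q'\<close> is near \<open>q\<close>
  (\<open>slope_difference_small\<close>).  So the critical set is a countable union of pieces on which all but
  one of the \<open>n\<close> coordinates control the distance, that is, of Lipschitz graphs over subsets of an
  \<open>(n - 1)\<close>-dimensional space.  It remains to see that a function on a bounded subset of
  \<open>\<real>\<^sup>m\<close> that varies at most quadratically has an image of \<open>m/2\<close>-dimensional measure zero
  (\<open>hausdorff_null_square_holder_image\<close>).  The bound \<open>|g x - g y| \<le> c |x - y|^2\<close> alone gives finite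
  measure; the gain comes from chains.  In a dyadic cube all of whose subcubes \<open>j\<close> levels below
  meet the set, two points are joined by a chain of about \<open>2^j\<close> points of the set, and adding up
  the quadratic bounds along the chain saves a factor \<open>2^j\<close>.  The other cubes are rare, because the
  normalised number of dyadic cubes that meet the set decreases and hence converges.

  \<^bold>\<open>Regular levels.\<close>  At a regular point some direction \<open>v\<close> is ascending for all slopes, and by
  compactness it is so uniformly near the point (\<open>uniform_ascent_at_regular_point\<close>).  So near the
  point \<open>f\<close> increases along \<open>v\<close> at least linearly, and the level set is the graph, over the orthogonal
  complement of \<open>v\<close>, of a Lipschitz function.  The quadratic upper bounds of \<open>f\<close> become
  quadratic upper bounds of this function, in the direction \<open>- v\<close>, so it is semiconcave
  (\<open>level_set_graph\<close>).  For the reach, suppose that \<open>q\<close> has two nearest points \<open>a, b\<close> in \<open>{f \<ge> r}\<close> at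
  distance \<open>R\<close>.  Their midpoint is closer to \<open>q\<close> by at least \<open>|a - b|^2 / (8 R)\<close>, and it lies below the
  level \<open>r\<close> by at most \<open>const * |a - b|^2\<close>; pushing it along \<open>v\<close> by a distance of order \<open>|a - b|^2\<close>
  gives a point of \<open>{f \<ge> r}\<close>, which is too close to \<open>q\<close> if \<open>R\<close> is small
  (\<open>unique_projection_near_boundary\<close>).

  \<^bold>\<open>Compact sets.\<close>  If \<open>F\<close> is compact, then limits of critical points at a positive level
  are critical, so \<open>N\<close> is relatively closed, and the local bounds on the reach become uniform
  by the compactness of the level set.
\<close>

section \<open>Finite-dimensional normed spaces\<close>

text \<open>
  By induction on the basis: a new basis vector \<open>b\<close> has positive distance from the closed span of the
  others, so the coefficients of \<open>b\<close> along a Cauchy sequence form a Cauchy sequence.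
\<close>

lemma complete_span_finite_independent:
  fixes B :: "'a::real_normed_vector set"
  assumes "finite B" "independent B"
  shows "complete (span B)"
  using assms
proof (induction B rule: finite_induct)
  case empty
  show ?case by (simp add: compact_imp_complete)
next
  case (insert b B)
  have ind: "independent B" and b: "b \<notin> span B"
    using insert by (auto simp: independent_insert)
  have cB: "complete (span B)" using insert ind by blast
  have dpos: "infdist b (span B) > 0"
    using infdist_pos_not_in_closed[OF complete_imp_closed[OF cB]] b span_zero by blast
  show ?case
  proof (rule completeI)
    fix x assume x: "\<forall>k. x k \<in> span (insert b B)" and Cx: "Cauchy x"
    have "\<forall>k. \<exists>t. x k - t *\<^sub>R b \<in> span B" using x by (simp add: span_breakdown_eq)
    then obtain t where t: "\<And>k. x k - t k *\<^sub>R b \<in> span B" by metis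
    have bound: "\<bar>t k - t l\<bar> * infdist b (span B) \<le> dist (x k) (x l)" for k l
    proof (cases "t k = t l")
      case False
      define s where "s = t k - t l"
      have s: "s \<noteq> 0" using False s_def by simp
      define y where "y = (x k - t k *\<^sub>R b) - (x l - t l *\<^sub>R b)"
      have "y \<in> span B" using t span_diff y_def by blast
      then have "(- 1 / s) *\<^sub>R y \<in> span B" by (rule span_scale)
      then have "infdist b (span B) \<le> norm (b - (- 1 / s) *\<^sub>R y)"
        using infdist_le dist_norm by metis
      also have "b - (- 1 / s) *\<^sub>R y = (1 / s) *\<^sub>R (x k - x l)"
      proof -
        have "y = (x k - x l) - s *\<^sub>R b" by (simp add: y_def s_def algebra_simps)
        then show ?thesis using s by (simp add: scaleR_diff_right)
      qed
      finally have "infdist b (span B) \<le> dist (x k) (x l) / \<bar>s\<bar>"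
        by (simp add: dist_norm del: scaleR_diff_right)
      then show ?thesis using s by (simp add: s_def[symmetric] field_simps)
    qed simp
    have "Cauchy t"
    proof (rule metric_CauchyI)
      fix e :: real assume e: "e > 0"
      obtain M where M: "\<And>m n. m \<ge> M \<Longrightarrow> n \<ge> M \<Longrightarrow> dist (x m) (x n) < e * infdist b (span B)"
        using metric_CauchyD[OF Cx, of "e * infdist b (span B)"] e dpos by auto
      show "\<exists>M. \<forall>m\<ge>M. \<forall>n\<ge>M. dist (t m) (t n) < e"
      proof (intro exI allI impI)
        fix m n assume "m \<ge> M" "n \<ge> M"
        then have "\<bar>t m - t n\<bar> * infdist b (span B) < e * infdist b (span B)"
          using M bound le_less_trans by blast
        then show "dist (t m) (t n) < e" using dpos by (simp add: dist_real_def)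
      qed
    qed
    then obtain t0 where t0: "t \<longlonglongrightarrow> t0" using real_Cauchy_convergent convergent_def by blast
    have Cb: "Cauchy (\<lambda>k. t k *\<^sub>R b)"
      by (rule LIMSEQ_imp_Cauchy[where x = "t0 *\<^sub>R b"]) (intro tendsto_intros t0)
    have "Cauchy (\<lambda>k. x k - t k *\<^sub>R b)"
    proof (rule metric_CauchyI)
      fix e :: real assume "e > 0"
      then obtain M1 M2 where M1: "\<And>m n. m \<ge> M1 \<Longrightarrow> n \<ge> M1 \<Longrightarrow> dist (x m) (x n) < e / 2"
        and M2: "\<And>m n. m \<ge> M2 \<Longrightarrow> n \<ge> M2 \<Longrightarrow> dist (t m *\<^sub>R b) (t n *\<^sub>R b) < e / 2"
        using metric_CauchyD[OF Cx] metric_CauchyD[OF Cb] half_gt_zero by metis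
      show "\<exists>M. \<forall>m\<ge>M. \<forall>n\<ge>M. dist (x m - t m *\<^sub>R b) (x n - t n *\<^sub>R b) < e"
      proof (intro exI allI impI)
        fix m n assume "m \<ge> max M1 M2" "n \<ge> max M1 M2"
        then have "dist (x m) (x n) + dist (t m *\<^sub>R b) (t n *\<^sub>R b) < e"
          using M1[of m n] M2[of m n] by simp
        then show "dist (x m - t m *\<^sub>R b) (x n - t n *\<^sub>R b) < e"
          using norm_triangle_ineq4[of "x m - x n" "t m *\<^sub>R b - t n *\<^sub>R b"]
          by (simp add: dist_norm algebra_simps)
      qed
    qed
    then obtain l where l: "l \<in> span B" "(\<lambda>k. x k - t k *\<^sub>R b) \<longlonglongrightarrow> l"
      using cB t by (meson completeE)
    have "(\<lambda>k. (x k - t k *\<^sub>R b) + t k *\<^sub>R b) \<longlonglongrightarrow> l + t0 *\<^sub>R b"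
      by (intro tendsto_intros l t0)
    moreover have "l + t0 *\<^sub>R b \<in> span (insert b B)"
      using l(1) span_breakdown_eq[of "l + t0 *\<^sub>R b" b B] by (metis add_diff_cancel_right')
    ultimately show "\<exists>l\<in>span (insert b B). x \<longlonglongrightarrow> l" by auto
  qed
qed

text \<open>
  The coefficient of \<open>b\<close> is at most \<open>norm x\<close> divided by the distance of \<open>b\<close> from the span of
  the other basis vectors, which is closed by completeness.
\<close>

lemma representation_bound:
  fixes B :: "'a::real_normed_vector set"
  assumes "finite B" "independent B"
  shows "\<exists>C>0. \<forall>x\<in>span B. \<forall>b\<in>B. \<bar>representation B x b\<bar> \<le> C * norm x"
proof -
  have "\<exists>c>0. \<forall>x\<in>span B. \<bar>representation B x b\<bar> \<le> c * norm x" if b: "b \<in> B" for b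
  proof -
    define V where "V = span (B - {b})"
    have bV: "b \<notin> V" using assms(2) b unfolding V_def dependent_def by blast
    have "closed V" unfolding V_def
      by (intro complete_imp_closed complete_span_finite_independent)
        (use assms independent_mono[of B "B - {b}"] in auto)
    then have d: "infdist b V > 0"
      using infdist_pos_not_in_closed bV span_zero V_def by blast
    have "\<bar>representation B x b\<bar> \<le> (1 / infdist b V) * norm x" if x: "x \<in> span B" for x
    proof (cases "representation B x b = 0")
      case True then show ?thesis using d by simp
    next
      case False
      define s where "s = representation B x b"
      define y where "y = (\<Sum>c\<in>B - {b}. representation B x c *\<^sub>R c)"
      have yV: "y \<in> V" unfolding y_def V_def by (intro span_sum span_scale span_base)
      have "x = (\<Sum>c\<in>B. representation B x c *\<^sub>R c)"
        using sum_representation_eq[OF assms(2) x assms(1) order_refl] by simp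
      also have "\<dots> = s *\<^sub>R b + y"
        unfolding y_def s_def using sum.remove[OF assms(1) b] by blast
      finally have xe: "x = s *\<^sub>R b + y" .
      have "(- 1 / s) *\<^sub>R y \<in> V" using yV unfolding V_def by (rule span_scale)
      then have "infdist b V \<le> norm (b - (- 1 / s) *\<^sub>R y)"
        using infdist_le dist_norm by metis
      also have "b - (- 1 / s) *\<^sub>R y = (1 / s) *\<^sub>R x"
      proof -
        have "s \<noteq> 0" using False s_def by simp
        then show ?thesis by (subst xe) (simp add: algebra_simps)
      qed
      finally show ?thesis using False d by (simp add: s_def field_simps)
    qed
    then show ?thesis using d by (intro exI[of _ "1 / infdist b V"]) auto
  qed
  then obtain c where c: "\<And>b. b \<in> B \<Longrightarrow> c b > 0"
    "\<And>b x. b \<in> B \<Longrightarrow> x \<in> span B \<Longrightarrow> \<bar>representation B x b\<bar> \<le> c b * norm x" by metis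
  have "\<bar>representation B x b\<bar> \<le> (1 + (\<Sum>b\<in>B. c b)) * norm x" if "x \<in> span B" "b \<in> B" for x b
  proof -
    have "c b \<le> (\<Sum>b\<in>B. c b)" using that c(1) assms(1) by (intro member_le_sum) (auto intro: less_imp_le)
    then have "c b * norm x \<le> (1 + (\<Sum>b\<in>B. c b)) * norm x" by (intro mult_right_mono) auto
    then show ?thesis using c(2) that by fastforce
  qed
  moreover have "1 + (\<Sum>b\<in>B. c b) > 0" using c(1) by (simp add: add_pos_nonneg sum_nonneg less_imp_le)
  ultimately show ?thesis by blast
qed

text \<open>
  A normed space of dimension \<open>n\<close> with coordinates \<open>\<kappa>\<close> in a basis \<open>e\<close>.  The space is a type of class
  \<open>real_normed_vector\<close> with an assumption on its dimension, so continuity of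
  linear maps and compactness of bounded closed sets are derived from the boundedness of the coordinates.
\<close>

locale bounded_coordinates =
  fixes n :: nat and e :: "nat \<Rightarrow> 'a::real_normed_vector" and \<kappa> :: "nat \<Rightarrow> 'a \<Rightarrow> real"
  assumes bounded_linear_coord: "i < n \<Longrightarrow> bounded_linear (\<kappa> i)"
    and expansion: "x = (\<Sum>i<n. \<kappa> i x *\<^sub>R e i)"
    and dim_UNIV: "dim (UNIV :: 'a set) = n"

lemma bounded_coordinates_exist:
  assumes "dim (UNIV :: 'a::real_normed_vector set) = n" "n > 0"
  shows "\<exists>(e :: nat \<Rightarrow> 'a) \<kappa>. bounded_coordinates n e \<kappa>"
proof -
  obtain B :: "'a set" where B: "independent B" "UNIV \<subseteq> span B" "card B = n"
    using basis_exists[of "UNIV :: 'a set"] assms(1) by auto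
  have fB: "finite B" using B(3) assms(2) card.infinite by fastforce
  have sB: "x \<in> span B" for x using B(2) by auto
  obtain e where "bij_betw e {0..<n} B" using ex_bij_betw_nat_finite[OF fB] B(3) by auto
  then have e: "bij_betw e {..<n} B" by (simp add: atLeast0LessThan)
  then have eB: "e i \<in> B" if "i < n" for i using that bij_betwE by auto
  obtain C where C: "C > 0" "\<And>x b. x \<in> span B \<Longrightarrow> b \<in> B \<Longrightarrow> \<bar>representation B x b\<bar> \<le> C * norm x"
    using representation_bound[OF fB B(1)] by blast
  have "bounded_coordinates n e (\<lambda>i x. representation B x (e i))"
  proof (rule bounded_coordinates.intro)
    show "bounded_linear (\<lambda>x. representation B x (e i))" if "i < n" for i
      by (rule bounded_linear_intro[where K = C])
        (use C sB eB that in \<open>auto simp: representation_add[OF B(1)] representation_scale[OF B(1)] mult.commute\<close>)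
    show "x = (\<Sum>i<n. representation B x (e i) *\<^sub>R e i)" for x
      using sum_representation_eq[OF B(1) sB fB order_refl, of x]
        sum.reindex_bij_betw[OF e, of "\<lambda>b. representation B x b *\<^sub>R b"] by simp
  qed (rule assms)
  then show ?thesis by blast
qed

context bounded_coordinates
begin

lemma coord_bound: "\<exists>C>0. \<forall>i<n. \<forall>x. \<bar>\<kappa> i x\<bar> \<le> C * norm x"
proof -
  have "\<forall>i. \<exists>c\<ge>0. i < n \<longrightarrow> (\<forall>x. \<bar>\<kappa> i x\<bar> \<le> norm x * c)"
    using bounded_linear.nonneg_bounded[OF bounded_linear_coord] by (metis order_refl real_norm_def)
  then obtain c where c: "\<And>i. c i \<ge> 0" "\<And>i x. i < n \<Longrightarrow> \<bar>\<kappa> i x\<bar> \<le> norm x * c i" by metis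
  have "\<bar>\<kappa> i x\<bar> \<le> (1 + (\<Sum>i<n. c i)) * norm x" if "i < n" for i x
  proof -
    have "c i \<le> (\<Sum>i<n. c i)" using that c by (intro member_le_sum) auto
    then have "norm x * c i \<le> norm x * (1 + (\<Sum>i<n. c i))" by (intro mult_left_mono) auto
    then show ?thesis using c(2)[OF that, of x] by (simp add: mult.commute)
  qed
  moreover have "1 + (\<Sum>i<n. c i) > 0" using c(1) by (simp add: add_pos_nonneg sum_nonneg)
  ultimately show ?thesis by blast
qed

lemma norm_le_coord_sum:
  "\<exists>E>0. \<forall>x. norm x \<le> E * (\<Sum>i<n. \<bar>\<kappa> i x\<bar>)"
proof (intro exI conjI allI)
  let ?E = "1 + (\<Sum>i<n. norm (e i))"
  show "?E > 0" by (simp add: add_pos_nonneg sum_nonneg)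
  fix x
  have "norm x = norm (\<Sum>i<n. \<kappa> i x *\<^sub>R e i)" using arg_cong[OF expansion, of norm] .
  also have "\<dots> \<le> (\<Sum>i<n. \<bar>\<kappa> i x\<bar> * norm (e i))"
    by (rule order_trans[OF norm_sum]) simp
  also have "\<dots> \<le> (\<Sum>i<n. \<bar>\<kappa> i x\<bar> * ?E)"
  proof (intro sum_mono mult_left_mono)
    fix i assume "i \<in> {..<n}"
    then have "norm (e i) \<le> (\<Sum>i<n. norm (e i))" by (intro member_le_sum) auto
    then show "norm (e i) \<le> ?E" by simp
  qed simp
  finally show "norm x \<le> ?E * (\<Sum>i<n. \<bar>\<kappa> i x\<bar>)" by (simp add: sum_distrib_right mult.commute)
qed

lemma linear_imp_bounded_linear:
  fixes f :: "'a \<Rightarrow> 'b::real_normed_vector"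
  assumes "linear f"
  shows "bounded_linear f"
proof -
  have f: "(\<Sum>i<n. \<kappa> i x *\<^sub>R f (e i)) = f x" for x
  proof -
    have "f x = f (\<Sum>i<n. \<kappa> i x *\<^sub>R e i)" using arg_cong[OF expansion, of f] .
    then show ?thesis unfolding linear_sum[OF assms] linear_scale[OF assms] by (rule sym)
  qed
  have "bounded_linear (\<lambda>x. \<Sum>i<n. \<kappa> i x *\<^sub>R f (e i))"
    by (intro bounded_linear_sum bounded_linear_scaleR_const bounded_linear_coord) auto
  then show ?thesis unfolding f .
qed

lemma bounded_imp_convergent_subseq:
  fixes x :: "nat \<Rightarrow> 'a"
  assumes "\<And>k. norm (x k) \<le> R"
  shows "\<exists>l r. strict_mono (r :: nat \<Rightarrow> nat) \<and> (x \<circ> r) \<longlonglongrightarrow> l"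
proof -
  obtain C where C: "C > 0" "\<And>i x. i < n \<Longrightarrow> \<bar>\<kappa> i x\<bar> \<le> C * norm x" using coord_bound by blast
  define p where "p = (\<lambda>k i. if i < n then \<kappa> i (x k) else 0)"
  have "\<forall>d\<subseteq>{..<n}. \<exists>l r. strict_mono r \<and>
      (\<forall>\<epsilon>>0. eventually (\<lambda>k. \<forall>i\<in>d. dist (p (r k) i) (l i) < \<epsilon>) sequentially)"
  proof (rule compact_lemma_general[where unproj = "\<lambda>g. g" and proj = "\<lambda>g i. g i"])
    fix i assume "i \<in> {..<n}"
    then have "\<bar>p k i\<bar> \<le> C * R" for k
      using C assms by (auto simp: p_def intro: order_trans[OF C(2)])
    then show "bounded ((\<lambda>g. g i) ` range p)" by (auto simp: bounded_iff)
  qed auto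
  then have "\<exists>l r. strict_mono (r :: nat \<Rightarrow> nat) \<and>
      (\<forall>\<epsilon>>0. eventually (\<lambda>k. \<forall>i\<in>{..<n}. dist (p (r k) i) (l i) < \<epsilon>) sequentially)"
    by blast
  then obtain l r where r: "strict_mono (r :: nat \<Rightarrow> nat)" and
    l: "\<And>\<epsilon>. \<epsilon> > 0 \<Longrightarrow> eventually (\<lambda>k. \<forall>i\<in>{..<n}. dist (p (r k) i) (l i) < \<epsilon>) sequentially"
    by blast
  have conv: "(\<lambda>k. \<kappa> i (x (r k))) \<longlonglongrightarrow> l i" if "i < n" for i
  proof (rule tendstoI)
    fix \<epsilon> :: real assume "\<epsilon> > 0"
    from l[OF this] show "\<forall>\<^sub>F k in sequentially. dist (\<kappa> i (x (r k))) (l i) < \<epsilon>"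
      by eventually_elim (use that in \<open>auto simp: p_def\<close>)
  qed
  have "(\<lambda>k. \<Sum>i<n. \<kappa> i (x (r k)) *\<^sub>R e i) \<longlonglongrightarrow> (\<Sum>i<n. l i *\<^sub>R e i)"
    by (intro tendsto_intros conv) simp
  then have "(x \<circ> r) \<longlonglongrightarrow> (\<Sum>i<n. l i *\<^sub>R e i)"
    by (simp add: o_def flip: expansion)
  then show ?thesis using r by blast
qed

lemma closed_bounded_compact:
  fixes S :: "'a set"
  assumes "closed S" "bounded S"
  shows "compact S"
  unfolding compact_eq_seq_compact_metric seq_compact_def
proof (intro allI impI)
  fix x :: "nat \<Rightarrow> 'a" assume x: "\<forall>k. x k \<in> S"
  obtain R where "\<And>y. y \<in> S \<Longrightarrow> norm y \<le> R" using assms(2) by (auto simp: bounded_iff)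
  then obtain l r where lr: "strict_mono (r :: nat \<Rightarrow> nat)" "(x \<circ> r) \<longlonglongrightarrow> l"
    using bounded_imp_convergent_subseq[of x] x by blast
  moreover have "l \<in> S" by (rule closed_sequentially[OF assms(1) _ lr(2)]) (use x in simp)
  ultimately show "\<exists>l\<in>S. \<exists>r. strict_mono r \<and> (x \<circ> r) \<longlonglongrightarrow> l" by blast
qed

end

section \<open>Null sets of Hausdorff measure\<close>

lemma hausdorff_measure_eq_0_iff:
  fixes A :: "'a::metric_space set"
  shows "hausdorff_measure s A = 0 \<longleftrightarrow>
    (\<forall>\<delta>>0. \<forall>\<epsilon>>0. \<exists>U :: nat \<Rightarrow> 'a set. A \<subseteq> (\<Union>i. U i) \<and>
      (\<forall>i. bounded (U i) \<and> diameter (U i) \<le> \<delta>) \<and> (\<Sum>i. hausdorff_weight s (U i)) < ennreal \<epsilon>)"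
proof -
  have content: "hausdorff_content s \<delta> A = 0 \<longleftrightarrow>
    (\<forall>\<epsilon>>0. \<exists>U :: nat \<Rightarrow> 'a set. A \<subseteq> (\<Union>i. U i) \<and>
      (\<forall>i. bounded (U i) \<and> diameter (U i) \<le> \<delta>) \<and> (\<Sum>i. hausdorff_weight s (U i)) < ennreal \<epsilon>)"
    (is "?L \<longleftrightarrow> ?R") for \<delta>
  proof
    assume ?L
    then show ?R
      unfolding hausdorff_content_def
      by (metis (mono_tags, lifting) INF_less_iff ennreal_less_zero_iff mem_Collect_eq)
  next
    assume R: ?R
    have "hausdorff_content s \<delta> A \<le> 0"
    proof (rule ennreal_le_epsilon)
      fix \<epsilon> :: real assume "\<epsilon> > 0"
      with R obtain U :: "nat \<Rightarrow> 'a set" where U: "A \<subseteq> (\<Union>i. U i)"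
        "\<forall>i. bounded (U i) \<and> diameter (U i) \<le> \<delta>" "(\<Sum>i. hausdorff_weight s (U i)) < ennreal \<epsilon>"
        by blast
      then have "hausdorff_content s \<delta> A \<le> (\<Sum>i. hausdorff_weight s (U i))"
        unfolding hausdorff_content_def by (intro INF_lower) auto
      with U(3) show "hausdorff_content s \<delta> A \<le> 0 + ennreal \<epsilon>" by simp
    qed
    then show ?L by simp
  qed
  have "hausdorff_measure s A = 0 \<longleftrightarrow> (\<forall>\<delta>>0. hausdorff_content s \<delta> A = 0)"
    unfolding hausdorff_measure_def bot_ennreal[symmetric] SUP_bot_conv by auto
  then show ?thesis using content by simp
qed

lemma hausdorff_null_mono:
  assumes "hausdorff_measure s B = 0" "A \<subseteq> B"
  shows "hausdorff_measure s A = 0"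
  unfolding hausdorff_measure_eq_0_iff
proof (intro allI impI)
  fix \<delta> \<epsilon> :: real assume "\<delta> > 0" "\<epsilon> > 0"
  then obtain U where U: "B \<subseteq> (\<Union>i. U i)" "\<forall>i::nat. bounded (U i) \<and> diameter (U i) \<le> \<delta>"
    "(\<Sum>i. hausdorff_weight s (U i)) < ennreal \<epsilon>"
    using assms(1) unfolding hausdorff_measure_eq_0_iff by blast
  with assms(2) show "\<exists>U. A \<subseteq> (\<Union>i. U i) \<and> (\<forall>i::nat. bounded (U i) \<and> diameter (U i) \<le> \<delta>) \<and>
    (\<Sum>i. hausdorff_weight s (U i)) < ennreal \<epsilon>"
    by (intro exI[of _ U]) auto
qed

lemma hausdorff_null_UN_nat:
  fixes A :: "nat \<Rightarrow> 'a::metric_space set"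
  assumes "\<And>k. hausdorff_measure s (A k) = 0"
  shows "hausdorff_measure s (\<Union>k. A k) = 0"
  unfolding hausdorff_measure_eq_0_iff
proof (intro allI impI)
  fix \<delta> \<epsilon> :: real assume d: "\<delta> > 0" and e: "\<epsilon> > 0"
  have "\<exists>U. A k \<subseteq> (\<Union>i. U i) \<and> (\<forall>i::nat. bounded (U i) \<and> diameter (U i) \<le> \<delta>) \<and>
    (\<Sum>i. hausdorff_weight s (U i)) < ennreal (\<epsilon> / 2 * (1/2) ^ Suc k)" for k
    using assms[of k] d e unfolding hausdorff_measure_eq_0_iff by simp
  then obtain U where U: "\<And>k. A k \<subseteq> (\<Union>i. U k i)"
    "\<And>k i::nat. bounded (U k i) \<and> diameter (U k i) \<le> \<delta>"
    "\<And>k. (\<Sum>i. hausdorff_weight s (U k i)) < ennreal (\<epsilon> / 2 * (1/2) ^ Suc k)"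
    by metis
  define V where "V = (\<lambda>p. U (fst (prod_decode p)) (snd (prod_decode p)))"
  have "(\<Union>k. A k) \<subseteq> (\<Union>p. V p)"
  proof
    fix x assume "x \<in> (\<Union>k. A k)"
    then obtain k i where "x \<in> U k i" using U(1) by blast
    then have "x \<in> V (prod_encode (k, i))" by (simp add: V_def)
    then show "x \<in> (\<Union>p. V p)" by blast
  qed
  moreover have "(\<Sum>p. hausdorff_weight s (V p)) < ennreal \<epsilon>"
  proof -
    have "(\<Sum>p. hausdorff_weight s (V p)) = (\<Sum>k. \<Sum>i. hausdorff_weight s (U k i))"
      unfolding V_def
      using suminf_ennreal_2dimen[of _ "\<lambda>(k, i). hausdorff_weight s (U k i)", OF refl]
      by (simp add: case_prod_beta)
    also have "\<dots> \<le> (\<Sum>k. ennreal (\<epsilon> / 2 * (1/2) ^ Suc k))"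
      by (intro suminf_le less_imp_le[OF U(3)]) auto
    also have "\<dots> = ennreal (\<epsilon> / 2)"
    proof (rule suminf_ennreal_eq)
      show "(\<lambda>k. \<epsilon> / 2 * (1/2) ^ Suc k) sums (\<epsilon> / 2)"
        using sums_mult[OF power_half_series, of "\<epsilon> / 2"] by simp
    qed (use e in simp)
    also have "\<dots> < ennreal \<epsilon>" using e by (simp add: ennreal_lessI)
    finally show ?thesis .
  qed
  ultimately show "\<exists>V. (\<Union>k. A k) \<subseteq> (\<Union>i. V i) \<and>
    (\<forall>i::nat. bounded (V i) \<and> diameter (V i) \<le> \<delta>) \<and> (\<Sum>i. hausdorff_weight s (V i)) < ennreal \<epsilon>"
    using U(2) by (intro exI[of _ V]) (simp add: V_def)
qed

lemma hausdorff_null_UN_countable: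
  fixes A :: "'i::countable \<Rightarrow> 'a::metric_space set"
  assumes "\<And>k. hausdorff_measure s (A k) = 0"
  shows "hausdorff_measure s (\<Union>k. A k) = 0"
proof (rule hausdorff_null_mono)
  show "hausdorff_measure s (\<Union>k. A (from_nat k)) = 0"
    by (rule hausdorff_null_UN_nat) (rule assms)
  show "(\<Union>k. A k) \<subseteq> (\<Union>k. A (from_nat k))"
    by clarsimp (metis from_nat_to_nat)
qed

text \<open>
  Upper bounds \<open>b\<close> of the diameters suffice, and a finite index set is padded by empty sets, which have
  weight zero.
\<close>

lemma hausdorff_null_finite_covers:
  fixes A :: "'a::metric_space set"
  assumes "s > 0"
    and cover: "\<And>\<delta> \<epsilon>::real. \<delta> > 0 \<Longrightarrow> \<epsilon> > 0 \<Longrightarrow> \<exists>(I :: 'i set) U b. finite I \<and> A \<subseteq> (\<Union>i\<in>I. U i) \<and>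
      (\<forall>i\<in>I. 0 \<le> b i \<and> b i \<le> \<delta> \<and> (\<forall>x\<in>U i. \<forall>y\<in>U i. dist x y \<le> b i)) \<and>
      (\<Sum>i\<in>I. b i powr s) < \<epsilon>"
  shows "hausdorff_measure s A = 0"
  unfolding hausdorff_measure_eq_0_iff
proof (intro allI impI)
  fix \<delta> \<epsilon> :: real assume d: "\<delta> > 0" and e: "\<epsilon> > 0"
  obtain I :: "'i set" and U b where fin: "finite I" and A: "A \<subseteq> (\<Union>i\<in>I. U i)"
    and b: "\<And>i. i \<in> I \<Longrightarrow> 0 \<le> b i \<and> b i \<le> \<delta> \<and> (\<forall>x\<in>U i. \<forall>y\<in>U i. dist x y \<le> b i)"
    and sum: "(\<Sum>i\<in>I. b i powr s) < \<epsilon>"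
    using cover[OF d e] by blast
  obtain h where h: "bij_betw h {..<card I} I"
    using ex_bij_betw_nat_finite[OF fin] by (auto simp: atLeast0LessThan)
  define V where "V = (\<lambda>k. if k < card I then U (h k) else {})"
  have hI: "h k \<in> I" if "k < card I" for k using that h bij_betwE by blast
  have diam: "bounded (V k) \<and> diameter (V k) \<le> \<delta>" for k
  proof (cases "k < card I")
    case True
    then have V: "V k = U (h k)" by (simp add: V_def)
    note bk = b[OF hI[OF True]]
    have "bounded (V k)" unfolding V bounded_def using bk
      by (metis bounded_def bounded_empty)
    moreover have "diameter (V k) \<le> \<delta>" unfolding V diameter_def
      using bk d by (auto intro!: cSUP_least intro: order_trans)
    ultimately show ?thesis by simp
  next
    case False
    then show ?thesis using d by (simp add: V_def)
  qed
  have weight: "hausdorff_weight s (V k) \<le> ennreal (b (h k) powr s)" if "k < card I" for k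
  proof (cases "U (h k) = {}")
    case False
    have "0 \<le> diameter (V k)" using diam diameter_ge_0 by blast
    moreover have "diameter (V k) \<le> b (h k)"
      using that b[OF hI[OF that]] False unfolding V_def diameter_def
      by (auto intro!: cSUP_least)
    ultimately show ?thesis
      using that False assms(1) by (auto simp: hausdorff_weight_def V_def intro!: ennreal_leI powr_mono2)
  qed (simp add: hausdorff_weight_def V_def)
  have "(\<Sum>k. hausdorff_weight s (V k)) = (\<Sum>k<card I. hausdorff_weight s (V k))"
    by (rule suminf_finite) (auto simp: V_def hausdorff_weight_def)
  also have "\<dots> \<le> (\<Sum>k<card I. ennreal (b (h k) powr s))"
    by (intro sum_mono weight) simp
  also have "\<dots> = ennreal (\<Sum>k<card I. b (h k) powr s)" by (simp add: sum_ennreal)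
  also have "(\<Sum>k<card I. b (h k) powr s) = (\<Sum>i\<in>I. b i powr s)"
    by (rule sum.reindex_bij_betw[OF h])
  also have "ennreal \<dots> < ennreal \<epsilon>" using sum e by (simp add: ennreal_lessI)
  finally have "(\<Sum>k. hausdorff_weight s (V k)) < ennreal \<epsilon>" .
  moreover have "A \<subseteq> (\<Union>k. V k)"
  proof
    fix x assume "x \<in> A"
    then obtain i where i: "i \<in> I" "x \<in> U i" using A by blast
    then obtain k where "k < card I" "h k = i" using h by (metis bij_betw_imp_surj_on imageE lessThan_iff)
    then have "x \<in> V k" using i by (simp add: V_def)
    then show "x \<in> (\<Union>k. V k)" by blast
  qed
  ultimately show "\<exists>V. A \<subseteq> (\<Union>i. V i) \<and> (\<forall>i::nat. bounded (V i) \<and> diameter (V i) \<le> \<delta>) \<and>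
    (\<Sum>i. hausdorff_weight s (V i)) < ennreal \<epsilon>"
    using diam by (intro exI[of _ V]) simp
qed

text \<open>
  The label of the dyadic cube of side \<open>1 / 2 ^ k\<close> in \<open>\<real>\<^sup>m\<close> that contains the point with
  coordinates \<open>P 0 x, \<dots>, P (m - 1) x\<close>.
\<close>

definition dyadic_cell :: "nat \<Rightarrow> (nat \<Rightarrow> 'b \<Rightarrow> real) \<Rightarrow> nat \<Rightarrow> 'b \<Rightarrow> nat \<Rightarrow> int" where
  "dyadic_cell m P k x = restrict (\<lambda>i. \<lfloor>2 ^ k * P i x\<rfloor>) {..<m}"

text \<open>
  The labels of the cubes \<open>j\<close> levels below the cube with label \<open>c\<close>.
\<close>

definition subcells :: "nat \<Rightarrow> nat \<Rightarrow> (nat \<Rightarrow> int) \<Rightarrow> (nat \<Rightarrow> int) set" where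
  "subcells m j c = (\<Pi>\<^sub>E i\<in>{..<m}. {c i * 2 ^ j ..< (c i + 1) * 2 ^ j})"

lemma finite_subcells: "finite (subcells m j c)"
  unfolding subcells_def by (intro finite_PiE) auto

lemma card_subcells: "card (subcells m j c) = 2 ^ (j * m)"
  unfolding subcells_def by (simp add: card_PiE algebra_simps nat_power_eq power_mult)

lemma dyadic_cell_in_subcells: "dyadic_cell m P (k + j) x \<in> subcells m j (dyadic_cell m P k x)"
proof -
  have "\<lfloor>2 ^ k * P i x\<rfloor> * 2 ^ j \<le> \<lfloor>2 ^ (k + j) * P i x\<rfloor> \<and>
    \<lfloor>2 ^ (k + j) * P i x\<rfloor> < (\<lfloor>2 ^ k * P i x\<rfloor> + 1) * 2 ^ j" for i
  proof -
    have "of_int \<lfloor>2 ^ k * P i x\<rfloor> * (2::real) ^ j \<le> 2 ^ k * P i x * 2 ^ j"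
      by (intro mult_right_mono) auto
    moreover have "2 ^ k * P i x * (2::real) ^ j < (of_int \<lfloor>2 ^ k * P i x\<rfloor> + 1) * 2 ^ j"
      by (intro mult_strict_right_mono) (use floor_correct in auto)
    ultimately show ?thesis by (simp add: le_floor_iff floor_less_iff power_add mult_ac)
  qed
  then show ?thesis by (auto simp: dyadic_cell_def subcells_def)
qed

lemma dyadic_cell_eqD:
  assumes "dyadic_cell m P k x = dyadic_cell m P k y" "i < m"
  shows "\<bar>P i x - P i y\<bar> \<le> 1 / 2 ^ k"
proof -
  have "\<lfloor>2 ^ k * P i x\<rfloor> = \<lfloor>2 ^ k * P i y\<rfloor>"
    using fun_cong[OF assms(1), of i] assms(2) by (simp add: dyadic_cell_def)
  then have "\<bar>2 ^ k * P i x - 2 ^ k * P i y\<bar> \<le> 1" by linarith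
  then have "2 ^ k * \<bar>P i x - P i y\<bar> \<le> 1"
    by (simp flip: right_diff_distrib add: abs_mult)
  then show ?thesis by (simp add: field_simps)
qed

text \<open>
  Each cube that is met contains at most \<open>2 ^ (j * m)\<close> subcubes that are met, and at least one fewer if
  it is not full.
\<close>

lemma card_dyadic_refinement:
  assumes "finite (dyadic_cell m P k ` A)"
  shows "card (dyadic_cell m P (k + j) ` A) +
      card {c \<in> dyadic_cell m P k ` A. \<not> subcells m j c \<subseteq> dyadic_cell m P (k + j) ` A}
    \<le> 2 ^ (j * m) * card (dyadic_cell m P k ` A)"
proof -
  let ?Z = "dyadic_cell m P k ` A" and ?Z' = "dyadic_cell m P (k + j) ` A"
  let ?D = "{c \<in> ?Z. \<not> subcells m j c \<subseteq> ?Z'}"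
  have "?Z' = (\<Union>c\<in>?Z. ?Z' \<inter> subcells m j c)"
    using dyadic_cell_in_subcells by fastforce
  then have "card ?Z' \<le> (\<Sum>c\<in>?Z. card (?Z' \<inter> subcells m j c))"
    using card_UN_le[OF assms] by metis
  moreover have "card (?Z' \<inter> subcells m j c) + (if c \<in> ?D then 1 else 0) \<le> 2 ^ (j * m)"
    if "c \<in> ?Z" for c
  proof (cases "c \<in> ?D")
    case True
    then have "?Z' \<inter> subcells m j c \<subset> subcells m j c" by auto
    then have "card (?Z' \<inter> subcells m j c) < card (subcells m j c)"
      by (rule psubset_card_mono[OF finite_subcells])
    then show ?thesis using True by (simp add: card_subcells)
  next
    case False
    have "card (?Z' \<inter> subcells m j c) \<le> card (subcells m j c)"
      by (intro card_mono finite_subcells) auto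
    then show ?thesis unfolding if_not_P[OF False] by (simp add: card_subcells)
  qed
  then have "(\<Sum>c\<in>?Z. card (?Z' \<inter> subcells m j c) + (if c \<in> ?D then 1 else 0)) \<le> (\<Sum>c\<in>?Z. 2 ^ (j * m))"
    by (rule sum_mono)
  moreover have "(\<Sum>c\<in>?Z. if c \<in> ?D then 1 else (0::nat)) = card ?D"
  proof -
    have "(\<Sum>c\<in>?Z. if c \<in> ?D then 1 else (0::nat)) = (\<Sum>c\<in>{c \<in> ?Z. c \<in> ?D}. 1)"
      by (rule sum.inter_filter[OF assms, symmetric])
    also have "{c \<in> ?Z. c \<in> ?D} = ?D" by blast
    finally show ?thesis by simp
  qed
  ultimately show ?thesis unfolding sum.distrib by (simp add: mult.commute)
qed

text \<open>
  The segment between \<open>P x\<close> and \<open>P y\<close> is cut into \<open>2 ^ j\<close> equal steps.  Fullness gives a point of \<open>A\<close> in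
  the subcube of each division point.  Consecutive points of this chain differ in each coordinate by at most
  \<open>3 / 2 ^ (k + j)\<close>, so each of the \<open>2 ^ j\<close> steps contributes at most \<open>9 * c / 4 ^ (k + j)\<close>.
\<close>

lemma full_cell_oscillation:
  assumes holder: "\<And>x y M. x \<in> A \<Longrightarrow> y \<in> A \<Longrightarrow> (\<And>i. i < m \<Longrightarrow> \<bar>P i x - P i y\<bar> \<le> M) \<Longrightarrow>
      \<bar>g x - g y\<bar> \<le> c * M\<^sup>2"
    and full: "subcells m j (dyadic_cell m P k x) \<subseteq> dyadic_cell m P (k + j) ` A"
    and xy: "x \<in> A" "y \<in> A" "dyadic_cell m P k x = dyadic_cell m P k y"
  shows "\<bar>g x - g y\<bar> \<le> 9 * c / (4 ^ k * 2 ^ j)"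
proof -
  define w where "w = (\<lambda>(l::nat) i. P i x + (real l / 2 ^ j) * (P i y - P i x))"
  have "\<exists>a\<in>A. \<forall>i<m. \<lfloor>2 ^ (k + j) * P i a\<rfloor> = \<lfloor>2 ^ (k + j) * w l i\<rfloor>" if l: "l \<le> 2 ^ j" for l
  proof -
    define t where "t = real l / 2 ^ j"
    have "real l \<le> 2 ^ j" using l by (metis of_nat_le_iff of_nat_numeral of_nat_power)
    then have t: "0 \<le> t" "t \<le> 1" by (auto simp: t_def)
    have "restrict (\<lambda>i. \<lfloor>2 ^ (k + j) * w l i\<rfloor>) {..<m} \<in> subcells m j (dyadic_cell m P k x)"
    proof -
      have "\<lfloor>2 ^ k * P i x\<rfloor> * 2 ^ j \<le> \<lfloor>2 ^ (k + j) * w l i\<rfloor> \<and>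
        \<lfloor>2 ^ (k + j) * w l i\<rfloor> < (\<lfloor>2 ^ k * P i x\<rfloor> + 1) * 2 ^ j" if i: "i < m" for i
      proof -
        define d where "d = \<lfloor>2 ^ k * P i x\<rfloor>"
        define X where "X = 2 ^ k * P i x"
        define Y where "Y = 2 ^ k * P i y"
        have "d = \<lfloor>2 ^ k * P i y\<rfloor>"
          using fun_cong[OF xy(3), of i] i by (simp add: dyadic_cell_def d_def)
        then have b: "of_int d \<le> X" "X < of_int d + 1" "of_int d \<le> Y" "Y < of_int d + 1"
          unfolding d_def X_def Y_def by linarith+
        have w: "2 ^ k * w l i = (1 - t) * X + t * Y"
          unfolding w_def t_def[symmetric] X_def Y_def by (simp add: algebra_simps)
        have "of_int d \<le> (1 - t) * X + t * Y"
          using convex_bound_le[of "- X" "- of_int d" "- Y" "1 - t" t] b t by simp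
        moreover have "(1 - t) * X + t * Y < of_int d + 1"
          using convex_bound_lt[of X "of_int d + 1" Y "1 - t" t] b t by simp
        ultimately have "of_int d * 2 ^ j \<le> (2 ^ k * w l i) * 2 ^ j"
            "(2 ^ k * w l i) * 2 ^ j < (of_int d + 1) * 2 ^ j"
          unfolding w by (auto intro: mult_right_mono mult_strict_right_mono)
        then show ?thesis
          unfolding d_def[symmetric] by (simp add: le_floor_iff floor_less_iff power_add mult_ac)
      qed
      then show ?thesis by (auto simp: dyadic_cell_def subcells_def)
    qed
    then obtain a where a: "a \<in> A" "dyadic_cell m P (k + j) a = restrict (\<lambda>i. \<lfloor>2 ^ (k + j) * w l i\<rfloor>) {..<m}"
      using full by force
    have "\<forall>i<m. \<lfloor>2 ^ (k + j) * P i a\<rfloor> = \<lfloor>2 ^ (k + j) * w l i\<rfloor>"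
    proof (intro allI impI)
      fix i assume "i < m"
      then show "\<lfloor>2 ^ (k + j) * P i a\<rfloor> = \<lfloor>2 ^ (k + j) * w l i\<rfloor>"
        using fun_cong[OF a(2), of i] by (simp add: dyadic_cell_def)
    qed
    then show ?thesis using a(1) by blast
  qed
  then obtain a where a: "\<And>l. l \<le> 2 ^ j \<Longrightarrow> a l \<in> A"
    "\<And>l i. l \<le> 2 ^ j \<Longrightarrow> i < m \<Longrightarrow> \<lfloor>2 ^ (k + j) * P i (a l)\<rfloor> = \<lfloor>2 ^ (k + j) * w l i\<rfloor>"
    by metis
  \<comment> \<open>The end points of the chain must be \<open>x\<close> and \<open>y\<close> themselves.\<close>
  define b where "b = (\<lambda>l. if l = 0 then x else if l = 2 ^ j then y else a l)"
  have bA: "b l \<in> A" if "l \<le> 2 ^ j" for l using that a(1) xy by (simp add: b_def)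
  have near: "\<bar>P i (b l) - w l i\<bar> \<le> 1 / 2 ^ (k + j)" if "l \<le> 2 ^ j" "i < m" for l i
  proof (cases "l = 0 \<or> l = 2 ^ j")
    case True
    then show ?thesis by (auto simp: b_def w_def)
  next
    case False
    then have "\<bar>2 ^ (k + j) * P i (b l) - 2 ^ (k + j) * w l i\<bar> \<le> 1"
      using a(2)[OF that] by (simp add: b_def) linarith
    then have "2 ^ (k + j) * \<bar>P i (b l) - w l i\<bar> \<le> 1"
      by (simp flip: right_diff_distrib add: abs_mult)
    then show ?thesis by (simp add: field_simps)
  qed
  have triple: "\<bar>u' - u\<bar> \<le> 3 / 2 ^ (k + j)"
    if "\<bar>v' - v\<bar> \<le> 1 / 2 ^ (k + j)" "\<bar>u - v\<bar> \<le> 1 / 2 ^ (k + j)" "\<bar>u' - v'\<bar> \<le> 1 / 2 ^ (k + j)"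
    for u u' v v' :: real
  proof -
    have "(3::real) / 2 ^ (k + j) = 3 * (1 / 2 ^ (k + j))" by simp
    then show ?thesis using that by linarith
  qed
  have step: "\<bar>g (b (Suc l)) - g (b l)\<bar> \<le> c * (3 / 2 ^ (k + j))\<^sup>2" if l: "l < 2 ^ j" for l
  proof (rule holder)
    show "b (Suc l) \<in> A" "b l \<in> A" using bA l by auto
    fix i assume i: "i < m"
    have "w (Suc l) i - w l i = (P i y - P i x) / 2 ^ j"
      by (simp add: w_def field_simps)
    moreover have "\<bar>(P i y - P i x) / 2 ^ j\<bar> \<le> 1 / 2 ^ (k + j)"
      using dyadic_cell_eqD[OF xy(3) i] by (simp add: power_add field_simps abs_minus_commute)
    ultimately show "\<bar>P i (b (Suc l)) - P i (b l)\<bar> \<le> 3 / 2 ^ (k + j)"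
      using near[of l i] near[of "Suc l" i] l i
      by (intro triple[of "w (Suc l) i" "w l i"]) auto
  qed
  have "g y - g x = (\<Sum>l<2 ^ j. g (b (Suc l)) - g (b l))"
    by (subst sum_lessThan_telescope) (simp add: b_def)
  then have "\<bar>g x - g y\<bar> = \<bar>\<Sum>l<2 ^ j. g (b (Suc l)) - g (b l)\<bar>"
    using abs_minus_commute[of "g x" "g y"] by simp
  also have "\<dots> \<le> (\<Sum>l<2 ^ j. \<bar>g (b (Suc l)) - g (b l)\<bar>)" by (rule sum_abs)
  also have "\<dots> \<le> (\<Sum>l<(2::nat) ^ j. c * (3 / 2 ^ (k + j))\<^sup>2)"
    by (intro sum_mono step) simp
  also have "\<dots> = 9 * c / (4 ^ k * 2 ^ j)"
  proof -
    have "(4::real) ^ k = 2 ^ k * 2 ^ k" by (simp flip: power_mult_distrib)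
    then have "(3 / 2 ^ (k + j))\<^sup>2 = 9 / (4 ^ k * (2 ^ j * (2::real) ^ j))"
      by (simp add: power2_eq_square power_add mult_ac)
    then show ?thesis by simp
  qed
  finally show ?thesis .
qed

text \<open>
  The number of cubes of level \<open>k\<close> that are met, divided by \<open>2 ^ (m * k)\<close>, decreases in \<open>k\<close>, hence is a
  Cauchy sequence, and cubes that are not full at depth \<open>j\<close> are paid for by its decrease from \<open>k\<close> to
  \<open>k + j\<close>.
\<close>

lemma nonfull_cells_rare:
  assumes fin: "finite (dyadic_cell m P 0 ` A)"
  shows "(\<lambda>k. card {c \<in> dyadic_cell m P k ` A. \<not> subcells m j c \<subseteq> dyadic_cell m P (k + j) ` A}
    / 2 ^ (m * k)) \<longlonglongrightarrow> 0"
proof -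
  let ?Z = "\<lambda>k. dyadic_cell m P k ` A"
  let ?D = "\<lambda>j k. {c \<in> ?Z k. \<not> subcells m j c \<subseteq> ?Z (k + j)}"
  have finZ: "finite (?Z k)" for k
  proof (rule finite_subset)
    show "?Z k \<subseteq> (\<Union>c\<in>?Z 0. subcells m k c)"
      using dyadic_cell_in_subcells[of m P 0 k] by auto
    show "finite (\<Union>c\<in>?Z 0. subcells m k c)"
      by (rule finite_UN_I[OF fin finite_subcells])
  qed
  define a where "a = (\<lambda>k. card (?Z k) / 2 ^ (m * k))"
  have bound: "card (?D j k) / 2 ^ (m * k) \<le> 2 ^ (j * m) * (a k - a (k + j))" for j k
  proof -
    have "real (card (?Z (k + j)) + card (?D j k)) \<le> real (2 ^ (j * m) * card (?Z k))"
      using card_dyadic_refinement[OF finZ] of_nat_le_iff by blast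
    then have "real (card (?D j k)) \<le> 2 ^ (j * m) * real (card (?Z k)) - real (card (?Z (k + j)))" by simp
    then have "card (?D j k) / 2 ^ (m * k) \<le> (2 ^ (j * m) * real (card (?Z k)) - real (card (?Z (k + j)))) / 2 ^ (m * k)"
      by (simp add: divide_right_mono)
    also have "\<dots> = 2 ^ (j * m) * (a k - a (k + j))"
      by (simp add: a_def field_simps power_add)
    finally show ?thesis .
  qed
  have dec: "a (Suc k) \<le> a k" for k
  proof -
    have "0 \<le> (2::real) ^ (1 * m) * (a k - a (k + 1))"
      by (rule order_trans[OF _ bound]) simp
    moreover have "(0::real) < 2 ^ (1 * m)" by simp
    ultimately have "0 \<le> a k - a (k + 1)" by (metis mult_le_cancel_left_pos mult_zero_right)
    then show ?thesis by simp
  qed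
  obtain l where l: "a \<longlonglongrightarrow> l"
    by (rule decseq_convergent[of a 0]) (use dec in \<open>auto simp: a_def intro: decseq_SucI\<close>)
  have "(\<lambda>k. 2 ^ (j * m) * (a k - a (k + j))) \<longlonglongrightarrow> 2 ^ (j * m) * (l - l)"
    by (intro tendsto_intros l LIMSEQ_ignore_initial_segment[OF l])
  then have lim: "(\<lambda>k. 2 ^ (j * m) * (a k - a (k + j))) \<longlonglongrightarrow> 0" by simp
  show ?thesis
    by (rule tendsto_sandwich[OF _ _ tendsto_const lim]) (use bound in auto)
qed

text \<open>
  The images of the cubes of level \<open>k\<close> cover \<open>g ` A\<close>.  The at most \<open>2 ^ (m * k)\<close> full cubes have images of diameter
  at most \<open>9 * c / (4 ^ k * 2 ^ j)\<close>, with total weight at most \<open>(9 * c / 2 ^ j) powr (m / 2)\<close>, which is small for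
  large \<open>j\<close>; then, for large \<open>k\<close>, there are too few other cubes to matter.  The last assumption
  places \<open>A\<close> in a single cube of level 0.
\<close>

lemma hausdorff_null_square_holder_image:
  fixes g :: "'b \<Rightarrow> real" and P :: "nat \<Rightarrow> 'b \<Rightarrow> real"
  assumes "m > 0" "c > 0"
    and holder: "\<And>x y M. x \<in> A \<Longrightarrow> y \<in> A \<Longrightarrow> (\<And>i. i < m \<Longrightarrow> \<bar>P i x - P i y\<bar> \<le> M) \<Longrightarrow>
      \<bar>g x - g y\<bar> \<le> c * M\<^sup>2"
    and cell: "\<And>x y i. x \<in> A \<Longrightarrow> y \<in> A \<Longrightarrow> i < m \<Longrightarrow> \<lfloor>P i x\<rfloor> = \<lfloor>P i y\<rfloor>"
  shows "hausdorff_measure (real m / 2) (g ` A) = 0"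
proof (cases "A = {}")
  case True
  then show ?thesis
    unfolding hausdorff_measure_eq_0_iff
    by (intro allI impI exI[of _ "\<lambda>_. {}"]) (auto simp: hausdorff_weight_def)
next
  case False
  then obtain x0 where x0: "x0 \<in> A" by blast
  let ?s = "real m / 2"
  let ?cell = "dyadic_cell m P"
  let ?D = "\<lambda>j k. {c \<in> ?cell k ` A. \<not> subcells m j c \<subseteq> ?cell (k + j) ` A}"
  have Z0: "?cell 0 ` A \<subseteq> {?cell 0 x0}"
    using cell[OF _ x0] by (auto simp: dyadic_cell_def restrict_def fun_eq_iff)
  then have fin0: "finite (?cell 0 ` A)" using finite_subset by blast
  have subZ: "?cell k ` A \<subseteq> subcells m k (?cell 0 x0)" for k
  proof
    fix z assume "z \<in> ?cell k ` A"
    then obtain x where "x \<in> A" "z = ?cell k x" by blast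
    then show "z \<in> subcells m k (?cell 0 x0)"
      using dyadic_cell_in_subcells[of m P 0 k x] Z0 by auto
  qed
  have finZ: "finite (?cell k ` A)" for k by (rule finite_subset[OF subZ finite_subcells])
  have cardZ: "real (card (?cell k ` A)) \<le> 2 ^ (m * k)" for k
  proof -
    have "card (?cell k ` A) \<le> 2 ^ (k * m)"
      using card_mono[OF finite_subcells subZ] by (simp add: card_subcells)
    then have "real (card (?cell k ` A)) \<le> real (2 ^ (k * m))" using of_nat_le_iff by blast
    then show ?thesis by (simp add: mult.commute)
  qed
  have scale: "(a / 4 ^ k) powr ?s = a powr ?s / 2 ^ (m * k)" if "a > 0" for a k
  proof -
    have "(4::real) ^ k = 2 ^ (2 * k)" by (simp add: power_mult)
    also have "\<dots> = 2 powr (2 * real k)" using powr_realpow[of 2 "2 * k"] by simp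
    finally have "((4::real) ^ k) powr ?s = 2 powr real (m * k)"
      by (simp only: powr_powr) (simp add: mult.commute)
    also have "\<dots> = 2 ^ (m * k)" by (rule powr_realpow) simp
    finally show ?thesis using that by (simp add: powr_divide)
  qed
  show ?thesis
  proof (rule hausdorff_null_finite_covers[where 'i = "nat \<Rightarrow> int"])
    fix \<delta> \<epsilon> :: real assume d: "\<delta> > 0" and e: "\<epsilon> > 0"
    have "(\<lambda>j. (9 * c * (1/2) ^ j) powr ?s) \<longlonglongrightarrow> (9 * c * 0) powr ?s"
      by (intro tendsto_powr' tendsto_mult tendsto_const LIMSEQ_power_zero) (use assms(1,2) in auto)
    then have "\<forall>\<^sub>F j in sequentially. (9 * c * (1/2) ^ j) powr ?s < \<epsilon> / 2"
      by (rule order_tendstoD) (use e in simp)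
    then obtain j where j: "(9 * c * (1/2) ^ j) powr ?s < \<epsilon> / 2"
      using eventually_happens trivial_limit_sequentially by blast
    have "(\<lambda>k. c powr ?s * (card (?D j k) / 2 ^ (m * k))) \<longlonglongrightarrow> c powr ?s * 0"
      by (intro tendsto_intros nonfull_cells_rare fin0)
    then have "\<forall>\<^sub>F k in sequentially. c powr ?s * (card (?D j k) / 2 ^ (m * k)) < \<epsilon> / 2"
      by (rule order_tendstoD) (use e in simp)
    moreover have "(\<lambda>k. 9 * c * (1/4) ^ k) \<longlonglongrightarrow> 9 * c * 0"
      by (intro tendsto_intros LIMSEQ_power_zero) auto
    then have "\<forall>\<^sub>F k in sequentially. 9 * c * (1/4) ^ k < \<delta>"
      by (rule order_tendstoD) (use d in simp)
    ultimately have "\<forall>\<^sub>F k in sequentially. c powr ?s * (card (?D j k) / 2 ^ (m * k)) < \<epsilon> / 2 \<and>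
        9 * c * (1/4) ^ k < \<delta>"
      by (rule eventually_conj)
    then obtain k where k: "c powr ?s * (card (?D j k) / 2 ^ (m * k)) < \<epsilon> / 2" "9 * c * (1/4) ^ k < \<delta>"
      using eventually_happens trivial_limit_sequentially by blast
    define b where "b = (\<lambda>z. if z \<in> ?D j k then c / 4 ^ k else (9 * c * (1/2) ^ j) / 4 ^ k)"
    define U where "U = (\<lambda>z. g ` {x \<in> A. ?cell k x = z})"
    have "9 * c * (1/2) ^ j / 4 ^ k \<le> 9 * c / 4 ^ k"
      using assms(2) by (intro divide_right_mono) (auto simp: power_le_one)
    moreover have "c / 4 ^ k \<le> 9 * c / 4 ^ k"
      using assms(2) by (intro divide_right_mono) auto
    moreover have "9 * c / 4 ^ k < \<delta>" using k(2) by (simp add: power_divide)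
    ultimately have "c / 4 ^ k \<le> \<delta>" "9 * c * (1/2) ^ j / 4 ^ k \<le> \<delta>" by linarith+
    then have b: "0 \<le> b z \<and> b z \<le> \<delta>" for z
      using assms(2) unfolding b_def by (simp del: divide_le_eq)
    have U: "dist u v \<le> b z" if z: "z \<in> ?cell k ` A" and uv: "u \<in> U z" "v \<in> U z" for z u v
    proof -
      obtain x y where x: "x \<in> A" "?cell k x = z" "u = g x" and y: "y \<in> A" "?cell k y = z" "v = g y"
        using uv by (auto simp: U_def)
      show ?thesis
      proof (cases "z \<in> ?D j k")
        case True
        have "\<bar>g x - g y\<bar> \<le> c * (1 / 2 ^ k)\<^sup>2"
          using x y by (intro holder dyadic_cell_eqD[of m P k]) auto
        also have "(1 / 2 ^ k)\<^sup>2 = 1 / (4::real) ^ k"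
          by (simp add: power_divide power2_eq_square flip: power_mult_distrib)
        finally show ?thesis using True x(3) y(3) by (simp add: b_def dist_real_def)
      next
        case False
        have "\<bar>g x - g y\<bar> \<le> 9 * c / (4 ^ k * 2 ^ j)"
          by (rule full_cell_oscillation[OF holder]) (use False z x y in auto)
        then show ?thesis unfolding b_def if_not_P[OF False] using x(3) y(3)
          by (simp add: dist_real_def power_divide mult.commute)
      qed
    qed
    have "(\<Sum>z\<in>?cell k ` A. b z powr ?s) \<le>
        (\<Sum>z\<in>?cell k ` A. (if z \<in> ?D j k then (c / 4 ^ k) powr ?s else 0) + (9 * c * (1/2) ^ j / 4 ^ k) powr ?s)"
      by (intro sum_mono) (auto simp: b_def)
    also have "\<dots> = card (?D j k) * (c / 4 ^ k) powr ?s + card (?cell k ` A) * (9 * c * (1/2) ^ j / 4 ^ k) powr ?s"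
    proof -
      have "(\<Sum>z\<in>?cell k ` A. if z \<in> ?D j k then (c / 4 ^ k) powr ?s else 0) =
          (\<Sum>z\<in>{z \<in> ?cell k ` A. z \<in> ?D j k}. (c / 4 ^ k) powr ?s)"
        by (rule sum.inter_filter[OF finZ, symmetric])
      also have "{z \<in> ?cell k ` A. z \<in> ?D j k} = ?D j k" by blast
      finally show ?thesis unfolding sum.distrib by simp
    qed
    also have "\<dots> = c powr ?s * (card (?D j k) / 2 ^ (m * k)) +
        card (?cell k ` A) * ((9 * c * (1/2) ^ j) powr ?s / 2 ^ (m * k))"
      using assms(2) by (simp add: scale)
    also have "\<dots> \<le> c powr ?s * (card (?D j k) / 2 ^ (m * k)) +
        2 ^ (m * k) * ((9 * c * (1/2) ^ j) powr ?s / 2 ^ (m * k))"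
      by (intro add_left_mono mult_right_mono cardZ) auto
    also have "\<dots> < \<epsilon>"
    proof -
      have "2 ^ (m * k) * ((9 * c * (1/2) ^ j) powr ?s / 2 ^ (m * k)) = (9 * c * (1/2) ^ j) powr ?s"
        by simp
      then show ?thesis using k(1) j by linarith
    qed
    finally have "(\<Sum>z\<in>?cell k ` A. b z powr ?s) < \<epsilon>" .
    moreover have "g ` A \<subseteq> (\<Union>z\<in>?cell k ` A. U z)" by (auto simp: U_def)
    ultimately show "\<exists>(I :: (nat \<Rightarrow> int) set) U b. finite I \<and> g ` A \<subseteq> (\<Union>i\<in>I. U i) \<and>
      (\<forall>i\<in>I. 0 \<le> b i \<and> b i \<le> \<delta> \<and> (\<forall>x\<in>U i. \<forall>y\<in>U i. dist x y \<le> b i)) \<and>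
      (\<Sum>i\<in>I. b i powr ?s) < \<epsilon>"
      using finZ b U by (intro exI[of _ "?cell k ` A"] exI[of _ U] exI[of _ b]) blast
  qed (use assms(1) in simp)
qed

section \<open>Quadratic upper bound for a norm with Lipschitz derivative\<close>

lemma sgn_diff_le:
  fixes z w :: "'a::real_normed_vector"
  assumes "norm z = 1" "w \<noteq> 0"
  shows "norm (sgn w - z) \<le> 2 * norm (w - z)"
proof -
  have "sgn w - w = ((1 - norm w) / norm w) *\<^sub>R w"
    using assms(2) by (simp add: sgn_div_norm left_diff_distrib scaleR_diff_left divide_inverse)
  then have "norm (sgn w - w) = \<bar>1 - norm w\<bar>"
    using assms(2) by simp
  also have "\<dots> \<le> norm (w - z)"
    using norm_triangle_ineq3[of w z] assms(1) by (simp add: abs_minus_commute)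
  finally show ?thesis
    using norm_triangle_ineq[of "sgn w - w" "w - z"] by simp
qed

text \<open>
  The derivative of a norm is positively homogeneous of degree 0.
\<close>

lemma norm_has_derivative_scaled:
  fixes D :: "'a::real_normed_vector \<Rightarrow> 'a \<Rightarrow>\<^sub>L real"
  assumes D: "\<forall>x \<in> sphere 0 1. (norm has_derivative blinfun_apply (D x)) (at x)"
    and w: "w \<noteq> 0"
  shows "(norm has_derivative blinfun_apply (D (sgn w))) (at w)"
proof -
  let ?c = "norm w"
  have c: "?c > 0" using w by simp
  have "(norm has_derivative blinfun_apply (D (sgn w))) (at ((1 / ?c) *\<^sub>R w))"
    using D w by (simp add: sgn_div_norm divide_inverse)
  then have "((\<lambda>x. norm ((1 / ?c) *\<^sub>R x)) has_derivative (\<lambda>h. D (sgn w) ((1 / ?c) *\<^sub>R h))) (at w)"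
    by (rule has_derivative_compose[rotated]) (auto intro!: derivative_eq_intros)
  then have "((\<lambda>x. ?c * norm ((1 / ?c) *\<^sub>R x)) has_derivative (\<lambda>h. ?c * D (sgn w) ((1 / ?c) *\<^sub>R h))) (at w)"
    by (rule has_derivative_mult_right)
  moreover have "(\<lambda>x. ?c * norm ((1 / ?c) *\<^sub>R x)) = norm" using c by (auto simp: fun_eq_iff)
  moreover have "(\<lambda>h. ?c * D (sgn w) ((1 / ?c) *\<^sub>R h)) = blinfun_apply (D (sgn w))"
    using c by (auto simp: fun_eq_iff blinfun.scaleR_right)
  ultimately show ?thesis by metis
qed

text \<open>
  For \<open>norm h < 1\<close> the segment from \<open>z\<close> to \<open>z + h\<close> avoids 0, and the mean value theorem applies with the Lipschitz
  bound for \<open>D\<close> on the sphere.  For \<open>norm h \<ge> 1\<close> the other terms are bounded by a multiple of \<open>(norm h)\<^sup>2\<close>.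
\<close>

lemma norm_quadratic_upper_bound_unit:
  fixes D :: "'a::real_normed_vector \<Rightarrow> 'a \<Rightarrow>\<^sub>L real"
  assumes D: "\<forall>x \<in> sphere 0 1. (norm has_derivative blinfun_apply (D x)) (at x)"
    and L: "L-lipschitz_on (sphere 0 1) D" and M: "\<And>x. norm x = 1 \<Longrightarrow> norm (D x) \<le> M"
    and z: "norm z = 1"
  shows "norm (z + h) \<le> 1 + D z h + (2 * L + M + 1) * (norm h)\<^sup>2"
proof -
  have L0: "0 \<le> L" using L lipschitz_on_nonneg by blast
  have M0: "0 \<le> M" using M[OF z] norm_ge_zero order_trans by blast
  show ?thesis
  proof (cases "norm h < 1")
    case True
    have nz: "z + t *\<^sub>R h \<noteq> 0" if "0 \<le> t" "t \<le> 1" for t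
    proof
      assume "z + t *\<^sub>R h = 0"
      then have "norm z = norm (t *\<^sub>R h)" by (metis add_eq_0_iff norm_minus_cancel)
      also have "\<dots> \<le> norm h" using that by (simp add: mult_left_le_one_le)
      finally show False using True z by simp
    qed
    have der: "((\<lambda>t. norm (z + t *\<^sub>R h)) has_derivative (\<lambda>s. D (sgn (z + t *\<^sub>R h)) (s *\<^sub>R h))) (at t)"
      if "0 \<le> t" "t \<le> 1" for t
    proof -
      have "((\<lambda>t. z + t *\<^sub>R h) has_derivative (\<lambda>s. s *\<^sub>R h)) (at t)"
        by (auto intro!: derivative_eq_intros)
      from has_derivative_compose[OF this norm_has_derivative_scaled[OF D nz[OF that]]]
      show ?thesis .
    qed
    have "\<exists>\<xi>\<in>{0<..<1}. norm (z + 1 *\<^sub>R h) - norm (z + 0 *\<^sub>R h) = D (sgn (z + \<xi> *\<^sub>R h)) ((1 - 0) *\<^sub>R h)"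
      by (rule mvt_simple) (use der in \<open>auto intro: has_derivative_at_withinI\<close>)
    then obtain \<xi> where \<xi>: "0 < \<xi>" "\<xi> < 1" "norm (z + h) - norm z = D (sgn (z + \<xi> *\<^sub>R h)) h"
      by auto
    let ?w = "z + \<xi> *\<^sub>R h"
    have "norm (D (sgn ?w) - D z) \<le> L * norm (sgn ?w - z)"
      using lipschitz_onD[OF L, of "sgn ?w" z] nz[of \<xi>] \<xi> z by (simp add: dist_norm norm_sgn)
    also have "\<dots> \<le> L * (2 * norm h)"
    proof (rule mult_left_mono[OF _ L0])
      have "norm (sgn ?w - z) \<le> 2 * norm (\<xi> *\<^sub>R h)"
        using sgn_diff_le[OF z nz[of \<xi>]] \<xi> by simp
      also have "\<dots> \<le> 2 * norm h" using \<xi> by (simp add: mult_left_le_one_le)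
      finally show "norm (sgn ?w - z) \<le> 2 * norm h" .
    qed
    finally have b: "norm (D (sgn ?w) - D z) \<le> 2 * L * norm h" by simp
    have "D (sgn ?w) h - D z h \<le> norm ((D (sgn ?w) - D z) h)"
      by (simp add: blinfun.diff_left)
    also have "\<dots> \<le> norm (D (sgn ?w) - D z) * norm h" by (rule norm_blinfun)
    also have "\<dots> \<le> 2 * L * norm h * norm h" by (rule mult_right_mono[OF b]) simp
    finally have "norm (z + h) \<le> 1 + D z h + 2 * L * (norm h)\<^sup>2"
      using \<xi>(3) z by (simp add: power2_eq_square)
    moreover have "0 \<le> (M + 1) * (norm h)\<^sup>2" using M0 by simp
    ultimately show ?thesis by (simp add: algebra_simps)
  next
    case False
    have "- D z h \<le> norm (D z) * norm h" using norm_blinfun[of "D z" h] by simp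
    also have "\<dots> \<le> M * norm h" by (rule mult_right_mono[OF M[OF z]]) simp
    finally have "norm (z + h) - 1 - D z h \<le> (M + 1) * norm h"
      using norm_triangle_ineq[of z h] z by (simp add: algebra_simps)
    also have "\<dots> \<le> (M + 1) * (norm h)\<^sup>2"
      using False M0 by (intro mult_left_mono self_le_power) auto
    also have "\<dots> \<le> (2 * L + M + 1) * (norm h)\<^sup>2"
      using L0 by (intro mult_right_mono) auto
    finally show ?thesis by simp
  qed
qed

text \<open>
  The bound \<open>norm_upper\<close> is global: for large increments \<open>h\<close> the quadratic term dominates.  The bounds of the
  distance function that it yields are therefore global as well.
\<close>

locale smooth_norm =
  fixes G :: "'a::real_normed_vector \<Rightarrow> 'a \<Rightarrow>\<^sub>L real" and K :: real
  assumes K_pos: "K > 0"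
    and norm_upper: "z \<noteq> 0 \<Longrightarrow> norm (z + h) \<le> norm z + G z h + K / norm z * (norm h)\<^sup>2"
    and G_continuous: "z \<noteq> 0 \<Longrightarrow> isCont G z"

lemma smooth_norm_exists:
  assumes "norm_deriv_lipschitz_on_sphere TYPE('a::real_normed_vector)"
  shows "\<exists>(G :: 'a \<Rightarrow> 'a \<Rightarrow>\<^sub>L real) K. smooth_norm G K"
proof -
  obtain D :: "'a \<Rightarrow> 'a \<Rightarrow>\<^sub>L real" and L where
    D: "\<forall>x \<in> sphere 0 1. (norm has_derivative blinfun_apply (D x)) (at x)"
    and L: "L-lipschitz_on (sphere 0 1) D"
    using assms unfolding norm_deriv_lipschitz_on_sphere_def by blast
  have L0: "0 \<le> L" using L lipschitz_on_nonneg by blast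
  obtain M where M0: "M \<ge> 0" and M: "\<And>x. norm x = 1 \<Longrightarrow> norm (D x) \<le> M"
  proof (cases "\<exists>a::'a. norm a = 1")
    case True
    then obtain a :: 'a where a: "norm a = 1" by blast
    have "norm (D x) \<le> norm (D a) + L * 2" if x: "norm x = 1" for x
    proof -
      have "norm (D x - D a) \<le> L * norm (x - a)"
        using lipschitz_onD[OF L, of x a] a x by (simp add: dist_norm)
      also have "\<dots> \<le> L * 2"
        using norm_triangle_ineq4[of x a] a x by (intro mult_left_mono[OF _ L0]) simp
      finally show ?thesis using norm_triangle_ineq2[of "D x" "D a"] by simp
    qed
    then show ?thesis using that[of "norm (D a) + L * 2"] L0 by simp
  next
    case False
    then show ?thesis using that[of 0] by simp
  qed
  let ?K = "2 * L + M + 1"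
  have "smooth_norm (\<lambda>z. D (sgn z)) ?K"
  proof
    show "?K > 0" using L0 M0 by simp
    fix z :: 'a assume z: "z \<noteq> 0"
    show "norm (z + h) \<le> norm z + D (sgn z) h + ?K / norm z * (norm h)\<^sup>2" for h
    proof -
      let ?c = "norm z"
      have c: "?c > 0" using z by simp
      have "norm (z + h) = ?c * norm (sgn z + (1 / ?c) *\<^sub>R h)"
      proof -
        have "z + h = ?c *\<^sub>R (sgn z + (1 / ?c) *\<^sub>R h)"
          using c by (simp add: scaleR_add_right sgn_div_norm)
        then show ?thesis by (metis abs_norm_cancel norm_scaleR)
      qed
      also have "\<dots> \<le> ?c * (1 + D (sgn z) ((1 / ?c) *\<^sub>R h) + ?K * (norm ((1 / ?c) *\<^sub>R h))\<^sup>2)"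
        using z by (intro mult_left_mono norm_quadratic_upper_bound_unit[OF D L M])
          (auto simp: norm_sgn)
      also have "\<dots> = norm z + D (sgn z) h + ?K / norm z * (norm h)\<^sup>2"
        using c by (simp add: blinfun.scaleR_right power2_eq_square field_simps)
      finally show ?thesis .
    qed
    have "continuous_on (- {0::'a}) (\<lambda>z. D (sgn z))"
      by (intro continuous_on_compose2[OF lipschitz_on_continuous_on[OF L]] continuous_intros)
        (auto simp: norm_sgn split: if_splits)
    then show "isCont (\<lambda>z. D (sgn z)) z"
      using z by (simp add: continuous_on_eq_continuous_at open_Compl)
  qed
  then show ?thesis by blast
qed

context smooth_norm
begin

text \<open>
  Euler's relation for the norm, read off from \<open>norm_upper\<close> with \<open>h = s *\<^sub>R z\<close> for small \<open>s > 0\<close>.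
  It keeps the two slopes at a critical point apart.
\<close>

lemma norm_le_G_self: "norm z \<le> G z z"
proof (cases "z = 0")
  case False
  have "norm z * (1 - K * s) \<le> G z z" if s: "s > 0" for s
  proof -
    have "(1 + s) * norm z = norm (z + s *\<^sub>R z)"
      using s by (metis abs_of_pos add_pos_pos norm_scaleR scaleR_add_left scaleR_one zero_less_one)
    also have "\<dots> \<le> norm z + G z (s *\<^sub>R z) + K / norm z * (norm (s *\<^sub>R z))\<^sup>2"
      by (rule norm_upper[OF False])
    finally have "s * (norm z * (1 - K * s)) \<le> s * G z z"
      using s False by (simp add: blinfun.scaleR_right power2_eq_square algebra_simps)
    then show ?thesis using s by simp
  qed
  then have ev: "\<forall>\<^sub>F s in at_right 0. norm z * (1 - K * s) \<le> G z z"
    by (auto simp: eventually_at_right_field intro: exI[of _ 1])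
  have "((\<lambda>s. norm z * (1 - K * s)) \<longlongrightarrow> norm z * (1 - K * 0)) (at_right 0)"
    by (intro tendsto_intros)
  from tendsto_upperbound[OF this ev] show ?thesis by simp
qed simp

end

section \<open>Critical points of the distance function\<close>

definition nearest :: "'a::metric_space set \<Rightarrow> 'a \<Rightarrow> 'a set" where
  "nearest F x = {y \<in> F. dist x y = infdist x F}"

locale distance_function = bounded_coordinates n e \<kappa> + smooth_norm G K
  for n and e :: "nat \<Rightarrow> 'a::real_normed_vector" and \<kappa> and G :: "'a \<Rightarrow> 'a \<Rightarrow>\<^sub>L real" and K +
  fixes F :: "'a set"
  assumes F_closed: "closed F" and F_nonempty: "F \<noteq> {}" and n_ge_2: "2 \<le> n"
begin

abbreviation f :: "'a \<Rightarrow> real" where "f x \<equiv> infdist x F"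

lemma f_pos: "x \<notin> F \<Longrightarrow> f x > 0"
  using infdist_pos_not_in_closed F_closed F_nonempty by blast

lemma f_lipschitz: "\<bar>f x - f y\<bar> \<le> norm (x - y)"
  using infdist_triangle_abs[of x F y] by (simp add: dist_norm)

text \<open>
  Nearest points of a convergent sequence stay bounded, so a subsequence converges, and the limit is again
  nearest because \<open>F\<close> is closed and \<open>f\<close> is continuous.
\<close>

lemma nearest_limit:
  assumes x: "x \<longlonglongrightarrow> x0" and y: "\<And>k. y k \<in> nearest F (x k)"
  obtains r y0 where "strict_mono (r :: nat \<Rightarrow> nat)" "(y \<circ> r) \<longlonglongrightarrow> y0" "y0 \<in> nearest F x0"
proof -
  obtain R where R: "\<And>k. norm (x k) \<le> R"
    using convergent_imp_bounded[OF x] by (auto simp: bounded_iff)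
  have "norm (y k) \<le> R + (f 0 + R)" for k
  proof -
    have "norm (y k) \<le> norm (x k) + dist (x k) (y k)"
      using norm_triangle_ineq4[of "x k" "x k - y k"] by (simp add: dist_norm)
    also have "dist (x k) (y k) = f (x k)" using y[of k] by (simp add: nearest_def)
    also have "\<dots> \<le> f 0 + norm (x k)" using f_lipschitz[of "x k" 0] by simp
    finally show ?thesis using R[of k] by simp
  qed
  then obtain r y0 where r: "strict_mono (r :: nat \<Rightarrow> nat)" and y0: "(y \<circ> r) \<longlonglongrightarrow> y0"
    using bounded_imp_convergent_subseq[of y] by blast
  have "y0 \<in> F"
    by (rule closed_sequentially[OF F_closed _ y0]) (use y in \<open>simp add: nearest_def\<close>)
  moreover have "dist x0 y0 = f x0"
  proof (rule LIMSEQ_unique)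
    have xr: "(x \<circ> r) \<longlonglongrightarrow> x0" by (rule LIMSEQ_subseq_LIMSEQ[OF x r])
    show "(\<lambda>k. dist ((x \<circ> r) k) ((y \<circ> r) k)) \<longlonglongrightarrow> dist x0 y0"
      by (intro tendsto_dist xr y0)
    have "(\<lambda>k. f ((x \<circ> r) k)) \<longlonglongrightarrow> f x0" by (intro tendsto_infdist xr)
    then show "(\<lambda>k. dist ((x \<circ> r) k) ((y \<circ> r) k)) \<longlonglongrightarrow> f x0"
      using y by (simp add: nearest_def)
  qed
  ultimately show ?thesis using that[OF r y0] by (simp add: nearest_def)
qed

lemma nearest_nonempty: "\<exists>y. y \<in> nearest F x"
proof -
  have "\<exists>y\<in>F. dist x y < f x + 1 / real (Suc k)" for k
  proof (rule ccontr)
    assume "\<not> ?thesis"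
    then have "f x + 1 / real (Suc k) \<le> f x"
      unfolding infdist_notempty[OF F_nonempty] by (intro cINF_greatest F_nonempty) auto
    then show False by simp
  qed
  then obtain y where y: "\<And>k. y k \<in> F" "\<And>k. dist x (y k) < f x + 1 / real (Suc k)" by metis
  have "norm (y k) \<le> norm x + (f x + 1)" for k
  proof -
    have "norm (y k) \<le> norm x + dist x (y k)"
      using norm_triangle_ineq4[of x "x - y k"] by (simp add: dist_norm)
    moreover have "1 / real (Suc k) \<le> 1" by simp
    ultimately show ?thesis using y(2)[of k] by linarith
  qed
  then obtain r y0 where r: "strict_mono (r :: nat \<Rightarrow> nat)" and y0: "(y \<circ> r) \<longlonglongrightarrow> y0"
    using bounded_imp_convergent_subseq[of y] by blast
  have yF: "y0 \<in> F" by (rule closed_sequentially[OF F_closed _ y0]) (use y in simp)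
  have "(\<lambda>k. f x + 1 / real (Suc k)) \<longlonglongrightarrow> f x + 0"
    by (intro tendsto_intros LIMSEQ_Suc lim_1_over_n)
  from LIMSEQ_subseq_LIMSEQ[OF this r]
  have "dist x y0 \<le> f x + 0"
    by (rule tendsto_le[OF trivial_limit_sequentially])
      (use y(2) in \<open>auto intro!: tendsto_dist y0[unfolded o_def] always_eventually less_imp_le simp: o_def\<close>)
  then show ?thesis using infdist_le[OF yF, of x] yF by (auto simp: nearest_def)
qed

text \<open>
  A fixed nearest point \<open>y\<close> of \<open>x\<close> competes in the infimum for every \<open>x'\<close>.
\<close>

lemma f_upper:
  assumes "x \<notin> F" "y \<in> nearest F x"
  shows "f x' \<le> f x + G (x - y) (x' - x) + K / f x * (norm (x' - x))\<^sup>2"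
proof -
  have y: "y \<in> F" "norm (x - y) = f x" using assms(2) by (auto simp: nearest_def dist_norm)
  have "f x' \<le> norm (x - y + (x' - x))"
    using infdist_le[OF y(1), of x'] by (simp add: dist_norm)
  also have "\<dots> \<le> norm (x - y) + G (x - y) (x' - x) + K / norm (x - y) * (norm (x' - x))\<^sup>2"
    by (rule norm_upper) (use y(1) assms(1) in auto)
  finally show ?thesis using y(2) by simp
qed

text \<open>
  By separation, a point is critical in this sense exactly if 0 lies in the convex hull of its slopes, that is,
  in the Clarke subdifferential of \<open>f\<close>.  The formulation with directions \<open>v\<close> avoids convex hulls.
\<close>

definition crit :: "'a set" where
  "crit = {x. x \<notin> F \<and> (\<forall>v. \<exists>y\<in>nearest F x. G (x - y) v \<le> 0)}"

lemma nearest_limit_G: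
  assumes x: "x \<longlonglongrightarrow> x0" and y: "\<And>k. y k \<in> nearest F (x k)" and x0: "x0 \<notin> F"
  obtains r y0 where "strict_mono (r :: nat \<Rightarrow> nat)" "y0 \<in> nearest F x0"
    "(\<lambda>k. G (x (r k) - y (r k)) v) \<longlonglongrightarrow> G (x0 - y0) v"
proof -
  obtain r y0 where r: "strict_mono (r :: nat \<Rightarrow> nat)" and y0: "(y \<circ> r) \<longlonglongrightarrow> y0" "y0 \<in> nearest F x0"
    using nearest_limit[OF x y] by blast
  have "x0 - y0 \<noteq> 0" using y0(2) x0 by (auto simp: nearest_def)
  moreover have "(\<lambda>k. (x \<circ> r) k - (y \<circ> r) k) \<longlonglongrightarrow> x0 - y0"
    by (intro tendsto_intros LIMSEQ_subseq_LIMSEQ[OF x r] y0)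
  ultimately have "(\<lambda>k. G ((x \<circ> r) k - (y \<circ> r) k)) \<longlonglongrightarrow> G (x0 - y0)"
    using isCont_tendsto_compose[OF G_continuous] by blast
  then have "(\<lambda>k. G ((x \<circ> r) k - (y \<circ> r) k) v) \<longlonglongrightarrow> G (x0 - y0) v"
    by (rule blinfun.tendsto[OF _ tendsto_const])
  then show ?thesis using that r y0 by (simp add: o_def)
qed

text \<open>
  Critical points at bounded levels stay bounded when \<open>F\<close> is bounded; a limit of critical points is critical
  because slopes converge along subsequences.
\<close>

lemma crit_values_closed:
  assumes "compact F"
  shows "closedin (top_of_set {0<..}) (f ` crit)"
proof -
  have sub: "f ` crit \<subseteq> {0<..}" using f_pos by (auto simp: crit_def)
  have "r \<in> f ` crit" if u: "\<And>k. u k \<in> f ` crit" and lim: "u \<longlonglongrightarrow> r" and r: "r > 0" for u r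
  proof -
    have "\<forall>k. \<exists>x. x \<in> crit \<and> u k = f x" using u by blast
    then obtain x where x: "\<And>k. x k \<in> crit" "\<And>k. u k = f (x k)" by metis
    obtain R where R: "\<And>y. y \<in> F \<Longrightarrow> norm y \<le> R"
      using compact_imp_bounded[OF assms] by (auto simp: bounded_iff)
    obtain R' where R': "\<And>k. \<bar>u k\<bar> \<le> R'"
      using convergent_imp_bounded[OF lim] by (auto simp: bounded_iff)
    have "norm (x k) \<le> R + R'" for k
    proof -
      obtain y where y: "y \<in> nearest F (x k)" using nearest_nonempty by blast
      have "norm (x k) \<le> norm y + dist (x k) y"
        using norm_triangle_ineq[of y "x k - y"] by (simp add: dist_norm)
      also have "dist (x k) y = u k" using y x(2) by (simp add: nearest_def)
      finally show ?thesis using y R[of y] R'[of k] by (simp add: nearest_def)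
    qed
    then obtain x0 s where s: "strict_mono (s :: nat \<Rightarrow> nat)" and x0: "(x \<circ> s) \<longlonglongrightarrow> x0"
      using bounded_imp_convergent_subseq[of x] by blast
    have fx0: "f x0 = r"
    proof (rule LIMSEQ_unique)
      show "(\<lambda>k. f ((x \<circ> s) k)) \<longlonglongrightarrow> f x0" by (intro tendsto_infdist x0)
      show "(\<lambda>k. f ((x \<circ> s) k)) \<longlonglongrightarrow> r"
        using LIMSEQ_subseq_LIMSEQ[OF lim s] x(2) by (simp add: o_def)
    qed
    have x0F: "x0 \<notin> F" using fx0 r by auto
    have "\<exists>y\<in>nearest F x0. G (x0 - y) v \<le> 0" for v
    proof -
      have "\<exists>y\<in>nearest F (x k). G (x k - y) v \<le> 0" for k using x(1)[of k] by (simp add: crit_def)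
      then obtain y where y: "\<And>k. y k \<in> nearest F (x k)" "\<And>k. G (x k - y k) v \<le> 0" by metis
      obtain t y0 where y0: "y0 \<in> nearest F x0"
        "(\<lambda>k. G ((x \<circ> s) (t k) - (y \<circ> s) (t k)) v) \<longlonglongrightarrow> G (x0 - y0) v"
        by (rule nearest_limit_G[OF x0 _ x0F, of "y \<circ> s"]) (use y(1) in auto)
      have "G (x0 - y0) v \<le> 0"
        by (rule tendsto_upperbound[OF y0(2)]) (use y(2) in auto)
      then show ?thesis using y0(1) by blast
    qed
    then have "x0 \<in> crit" using x0F by (simp add: crit_def)
    then show ?thesis using fx0 by blast
  qed
  then show ?thesis using sub unfolding closedin_limpt islimpt_sequential by fastforce
qed

section \<open>Critical values form a null set\<close>

lemma crit_quadratic: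
  assumes "x \<in> crit"
  shows "f x' \<le> f x + K / f x * (norm (x' - x))\<^sup>2"
proof -
  obtain y where "y \<in> nearest F x" "G (x - y) (x' - x) \<le> 0"
    using assms by (auto simp: crit_def)
  then show ?thesis using f_upper[of x y x'] assms by (auto simp: crit_def)
qed

text \<open>
  Two slopes whose difference \<open>p - q\<close> is bounded away from 0, with \<open>l\<close> a coordinate in which the difference is largest.
  The witnesses are the slope \<open>p = G z\<close>, \<open>z = x - y\<close>, and a slope that is nonpositive on \<open>z\<close>; then
  \<open>(p - q) z \<ge> norm z\<close>.
\<close>

lemma crit_two_slopes:
  assumes x: "x \<in> crit" and C: "C > 0" "\<And>i u. i < n \<Longrightarrow> \<bar>\<kappa> i u\<bar> \<le> C * norm u"
  shows "\<exists>(p :: 'a \<Rightarrow>\<^sub>L real) (q :: 'a \<Rightarrow>\<^sub>L real). \<exists>l<n.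
    (\<forall>x'. f x' \<le> f x + blinfun_apply p (x' - x) + K / f x * (norm (x' - x))\<^sup>2) \<and>
    (\<forall>x'. f x' \<le> f x + blinfun_apply q (x' - x) + K / f x * (norm (x' - x))\<^sup>2) \<and>
    (\<forall>i<n. \<bar>blinfun_apply (p - q) (e i)\<bar> \<le> \<bar>blinfun_apply (p - q) (e l)\<bar>) \<and> 1 \<le> real n * C * \<bar>blinfun_apply (p - q) (e l)\<bar>"
proof -
  have xF: "x \<notin> F" using x by (simp add: crit_def)
  obtain y where y: "y \<in> nearest F x" using nearest_nonempty by blast
  define z where "z = x - y"
  have z: "norm z > 0" using y xF by (auto simp: z_def nearest_def)
  obtain y' where y': "y' \<in> nearest F x" "G (x - y') z \<le> 0" using x by (auto simp: crit_def)
  define w where "w = G z - G (x - y')"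
  have wz: "norm z \<le> w z" using norm_le_G_self[of z] y'(2) by (simp add: w_def blinfun.diff_left)
  let ?S = "(\<lambda>i. \<bar>w (e i)\<bar>) ` {..<n}"
  have fin: "finite ?S" "?S \<noteq> {}" using n_ge_2 by (auto simp: lessThan_empty_iff)
  obtain l where l: "l < n" "\<bar>w (e l)\<bar> = Max ?S" using Max_in[OF fin] by auto
  then have lmax: "\<bar>w (e i)\<bar> \<le> \<bar>w (e l)\<bar>" if "i < n" for i
    using that fin by simp
  have "w z = w (\<Sum>i<n. \<kappa> i z *\<^sub>R e i)" using arg_cong[OF expansion, of w] .
  also have "\<dots> = (\<Sum>i<n. \<kappa> i z * w (e i))" by (simp add: blinfun.sum_right blinfun.scaleR_right)
  also have "\<dots> \<le> (\<Sum>i<n. C * norm z * \<bar>w (e l)\<bar>)"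
  proof (rule sum_mono)
    fix i assume i: "i \<in> {..<n}"
    have "\<kappa> i z * w (e i) \<le> \<bar>\<kappa> i z\<bar> * \<bar>w (e i)\<bar>" by (metis abs_ge_self abs_mult)
    also have "\<dots> \<le> C * norm z * \<bar>w (e l)\<bar>" using i C lmax by (intro mult_mono) auto
    finally show "\<kappa> i z * w (e i) \<le> C * norm z * \<bar>w (e l)\<bar>" .
  qed
  finally have "norm z * 1 \<le> norm z * (real n * C * \<bar>w (e l)\<bar>)" using wz by (simp add: mult_ac)
  then have "1 \<le> real n * C * \<bar>w (e l)\<bar>" using z by (simp only: mult_le_cancel_left_pos)
  then show ?thesis
    using l(1) lmax f_upper[OF xF y] f_upper[OF xF y'(1)] unfolding w_def z_def
    by (intro exI[of _ "G (x - y)"] exI[of _ "G (x - y')"] exI[of _ l] conjI allI impI) auto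
qed

text \<open>
  If \<open>w\<close> is almost zero on \<open>h\<close>, then \<open>h\<close> is almost in the kernel of \<open>w\<close>, on which the coordinate \<open>l\<close> where \<open>w\<close> is
  largest is controlled by the others.
\<close>

lemma coord_dist_of_transversal:
  fixes w :: "'a \<Rightarrow>\<^sub>L real"
  assumes E: "E > 0" "\<And>u. norm u \<le> E * (\<Sum>i<n. \<bar>\<kappa> i u\<bar>)" and C: "C > 0"
    and l: "l < n" "\<And>i. i < n \<Longrightarrow> \<bar>w (e i)\<bar> \<le> \<bar>w (e l)\<bar>" "1 \<le> real n * C * \<bar>w (e l)\<bar>"
    and w: "\<bar>w h\<bar> \<le> 1 / (2 * E * real n * C) * norm h"
    and M: "\<And>i. i < n \<Longrightarrow> i \<noteq> l \<Longrightarrow> \<bar>\<kappa> i h\<bar> \<le> M"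
  shows "norm h \<le> 4 * E * real n * M"
proof -
  let ?W = "\<bar>w (e l)\<bar>"
  have n: "real n > 0" using n_ge_2 by simp
  have W: "?W > 0" using l(3) by (cases "?W = 0") auto
  have M0: "M \<ge> 0"
  proof -
    define i where "i = (if l = 0 then 1 else 0 :: nat)"
    have "i < n" "i \<noteq> l" using n_ge_2 by (auto simp: i_def)
    then show ?thesis using M[of i] by linarith
  qed
  have off: "(\<Sum>i\<in>{..<n} - {l}. g i) \<le> n * B" if "\<And>i. i < n \<Longrightarrow> i \<noteq> l \<Longrightarrow> g i \<le> B" "B \<ge> 0" for g :: "nat \<Rightarrow> real" and B :: real
  proof -
    have "(\<Sum>i\<in>{..<n} - {l}. g i) \<le> (\<Sum>i\<in>{..<n} - {l}. B)" using that by (intro sum_mono) auto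
    also have "\<dots> \<le> (\<Sum>i\<in>{..<n}. B)" using that by (intro sum_mono2) auto
    finally show ?thesis by simp
  qed
  have "w h = w (\<Sum>i<n. \<kappa> i h *\<^sub>R e i)" using arg_cong[OF expansion, of w] .
  also have "\<dots> = (\<Sum>i<n. \<kappa> i h * w (e i))" by (simp add: blinfun.sum_right blinfun.scaleR_right)
  also have "\<dots> = \<kappa> l h * w (e l) + (\<Sum>i\<in>{..<n} - {l}. \<kappa> i h * w (e i))"
    using l(1) by (intro sum.remove) auto
  finally have "\<bar>\<kappa> l h * w (e l)\<bar> \<le> \<bar>w h\<bar> + \<bar>\<Sum>i\<in>{..<n} - {l}. \<kappa> i h * w (e i)\<bar>" by linarith
  also have "\<bar>\<Sum>i\<in>{..<n} - {l}. \<kappa> i h * w (e i)\<bar> \<le> (\<Sum>i\<in>{..<n} - {l}. \<bar>\<kappa> i h\<bar> * \<bar>w (e i)\<bar>)"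
    by (rule order_trans[OF sum_abs]) (simp add: abs_mult)
  also have "\<dots> \<le> n * (M * ?W)"
    by (rule off) (use M M0 l(2) in \<open>auto intro!: mult_mono\<close>)
  finally have "\<bar>\<kappa> l h\<bar> * ?W \<le> 1 / (2 * E * real n * C) * norm h + n * (M * ?W)"
    using w by (simp add: abs_mult)
  also have "1 / (2 * E * real n * C) * norm h \<le> norm h / (2 * E) * ?W"
  proof -
    have "1 * (norm h / (2 * E)) \<le> (real n * C * ?W) * (norm h / (2 * E))"
      using E by (intro mult_right_mono l(3)) auto
    then show ?thesis using E C n by (simp add: field_simps)
  qed
  finally have "\<bar>\<kappa> l h\<bar> * ?W \<le> (norm h / (2 * E) + n * M) * ?W" by (simp add: algebra_simps)
  then have kl: "\<bar>\<kappa> l h\<bar> \<le> norm h / (2 * E) + n * M" using W by simp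
  have "norm h \<le> E * (\<bar>\<kappa> l h\<bar> + (\<Sum>i\<in>{..<n} - {l}. \<bar>\<kappa> i h\<bar>))"
    using E(2)[of h] l(1) by (simp add: sum.remove)
  also have "\<dots> \<le> E * ((norm h / (2 * E) + n * M) + n * M)"
    using E by (intro mult_left_mono add_mono kl off M M0) auto
  finally show ?thesis using E by (simp add: algebra_simps)
qed

text \<open>
  Adding the bound at \<open>x\<close> with slope \<open>q\<close>, evaluated at \<open>x'\<close>, to the bound at \<open>x'\<close> with slope \<open>p'\<close>, evaluated at \<open>x\<close>,
  cancels the values of \<open>f\<close> and bounds \<open>p' - q\<close> on \<open>x' - x\<close> from above.  Exchanging the two kinds of
  slopes bounds \<open>q' - p\<close>; closeness of \<open>p'\<close> to \<open>p\<close> and of \<open>q'\<close> to \<open>q\<close> does the rest.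
\<close>

lemma slope_difference_small:
  fixes p q p' q' :: "'a \<Rightarrow>\<^sub>L real"
  assumes A: "A \<ge> 0"
    and x: "\<And>u. f u \<le> f x + p (u - x) + A * (norm (u - x))\<^sup>2" "\<And>u. f u \<le> f x + q (u - x) + A * (norm (u - x))\<^sup>2"
    and x': "\<And>u. f u \<le> f x' + p' (u - x') + A * (norm (u - x'))\<^sup>2" "\<And>u. f u \<le> f x' + q' (u - x') + A * (norm (u - x'))\<^sup>2"
    and near: "\<bar>blinfun_apply (p - p') (x' - x)\<bar> \<le> \<tau> * norm (x' - x)" "\<bar>blinfun_apply (q - q') (x' - x)\<bar> \<le> \<tau> * norm (x' - x)"
  shows "\<bar>blinfun_apply (p - q) (x' - x)\<bar> \<le> (2 * A * norm (x' - x) + \<tau>) * norm (x' - x)"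
proof -
  let ?h = "x' - x"
  have flip: "blinfun_apply r (x - x') = - blinfun_apply r ?h" for r
    by (metis blinfun.minus_right minus_diff_eq)
  have sq: "A * (norm ?h)\<^sup>2 + A * (norm ?h)\<^sup>2 = 2 * A * norm ?h * norm ?h"
    by (simp add: power2_eq_square)
  have "f x' \<le> f x + q ?h + A * (norm ?h)\<^sup>2" "f x \<le> f x' - p' ?h + A * (norm ?h)\<^sup>2"
       "f x' \<le> f x + p ?h + A * (norm ?h)\<^sup>2" "f x \<le> f x' - q' ?h + A * (norm ?h)\<^sup>2"
    using x(1,2)[of x'] x'(1,2)[of x] by (simp_all add: flip norm_minus_commute[of x x'])
  then have "p' ?h - q ?h \<le> 2 * A * norm ?h * norm ?h" "q' ?h - p ?h \<le> 2 * A * norm ?h * norm ?h"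
    using sq by linarith+
  moreover have "(2 * A * norm ?h + \<tau>) * norm ?h = 2 * A * norm ?h * norm ?h + \<tau> * norm ?h"
    by (simp add: algebra_simps)
  ultimately show ?thesis using near unfolding blinfun.diff_left by linarith
qed

text \<open>
  Rounding the two slopes, the point, and the inverse of its distance to \<open>F\<close> splits the critical set into
  countably many pieces.  On each piece the coordinates other than \<open>l\<close> control the distance, and the
  quadratic variation of \<open>f\<close> makes the image null.
\<close>

lemma crit_values_null: "hausdorff_measure ((real n - 1) / 2) (f ` crit) = 0"
proof -
  obtain C where C: "C > 0" "\<And>i u. i < n \<Longrightarrow> \<bar>\<kappa> i u\<bar> \<le> C * norm u"
    using coord_bound by blast
  obtain E where E: "E > 0" "\<And>u. norm u \<le> E * (\<Sum>i<n. \<bar>\<kappa> i u\<bar>)"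
    using norm_le_coord_sum by blast
  have n: "real n > 0" using n_ge_2 by simp
  have "\<forall>x. \<exists>(p :: 'a \<Rightarrow>\<^sub>L real) (q :: 'a \<Rightarrow>\<^sub>L real). \<exists>l. x \<in> crit \<longrightarrow> l < n \<and>
    (\<forall>x'. f x' \<le> f x + blinfun_apply p (x' - x) + K / f x * (norm (x' - x))\<^sup>2) \<and>
    (\<forall>x'. f x' \<le> f x + blinfun_apply q (x' - x) + K / f x * (norm (x' - x))\<^sup>2) \<and>
    (\<forall>i<n. \<bar>blinfun_apply (p - q) (e i)\<bar> \<le> \<bar>blinfun_apply (p - q) (e l)\<bar>) \<and> 1 \<le> real n * C * \<bar>blinfun_apply (p - q) (e l)\<bar>"
    (is "\<forall>x. ?Q x")
  proof
    fix x show "?Q x"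
    proof (cases "x \<in> crit")
      case True
      from crit_two_slopes[OF True C] show ?thesis by blast
    qed blast
  qed
  then obtain p q :: "'a \<Rightarrow> 'a \<Rightarrow>\<^sub>L real" and l where pql: "\<And>x. x \<in> crit \<Longrightarrow> l x < n \<and>
    (\<forall>x'. f x' \<le> f x + p x (x' - x) + K / f x * (norm (x' - x))\<^sup>2) \<and>
    (\<forall>x'. f x' \<le> f x + q x (x' - x) + K / f x * (norm (x' - x))\<^sup>2) \<and>
    (\<forall>i<n. \<bar>blinfun_apply (p x - q x) (e i)\<bar> \<le> \<bar>blinfun_apply (p x - q x) (e (l x))\<bar>) \<and> 1 \<le> real n * C * \<bar>blinfun_apply (p x - q x) (e (l x))\<bar>"
    by metis
  \<comment> \<open>The threshold of \<open>coord_dist_of_transversal\<close>: on each piece \<open>p x - q x\<close> has to be below \<open>\<theta>\<close> times the distance.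
    Rounding the slopes to multiples of \<open>\<epsilon>\<close> uses up one half of it.\<close>
  define \<theta> where "\<theta> = 1 / (2 * E * real n * C)"
  have \<theta>: "\<theta> > 0" using E C n by (simp add: \<theta>_def)
  define \<epsilon> where "\<epsilon> = \<theta> / (2 * real n * C)"
  have \<epsilon>: "\<epsilon> > 0" using \<theta> C n by (simp add: \<epsilon>_def)
  define lev where "lev = (\<lambda>x. nat \<lceil>1 / f x\<rceil>)"
  \<comment> \<open>On the pieces with \<open>1 / f x \<le> j\<close> the quadratic coefficient is at most \<open>K * j\<close>.  Cubes of side \<open>1 / S j\<close> are so small
    that the quadratic error uses up at most the other half of \<open>\<theta>\<close>.\<close>
  define S where "S = (\<lambda>j. 4 * K * real j * E * real n / \<theta> + 1)"
  have S: "S j > 0" for j using K_pos E n \<theta> by (simp add: S_def add_nonneg_pos)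
  define key where "key = (\<lambda>x. (l x, lev x, map (\<lambda>i. \<lfloor>p x (e i) / \<epsilon>\<rfloor>) [0..<n],
      map (\<lambda>i. \<lfloor>q x (e i) / \<epsilon>\<rfloor>) [0..<n], map (\<lambda>i. \<lfloor>S (lev x) * \<kappa> i x\<rfloor>) [0..<n]))"
  have "hausdorff_measure ((real n - 1) / 2) (f ` {x \<in> crit. key x = \<iota>})= 0" for \<iota>
  proof -
    obtain l0 j k1 k2 k3 where \<iota>: "\<iota> = (l0, j, k1, k2, k3)" by (metis prod_cases5)
    let ?A = "{x \<in> crit. key x = \<iota>}"
    \<comment> \<open>All coordinates but \<open>l0\<close>, scaled to make the piece lie in a unit cube.\<close>
    let ?P = "\<lambda>i x. S j * \<kappa> (if i < l0 then i else Suc i) x"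
    have lx: "l x = l0" "lev x = j" if "x \<in> ?A" for x using that by (auto simp: key_def \<iota>)
    have fx: "K / f x \<le> K * j" if "x \<in> ?A" for x
    proof -
      have "1 / f x \<le> real j" using lx(2)[OF that] of_nat_ceiling[of "1 / f x"] by (simp add: lev_def)
      then have "K * (1 / f x) \<le> K * j" using K_pos by (intro mult_left_mono) auto
      then show ?thesis by simp
    qed
    have quad: "f u \<le> f x + p x (u - x) + K * j * (norm (u - x))\<^sup>2"
        "f u \<le> f x + q x (u - x) + K * j * (norm (u - x))\<^sup>2"
        "f u \<le> f x + K * j * (norm (u - x))\<^sup>2" if "x \<in> ?A" for x u
    proof -
      have "K / f x * (norm (u - x))\<^sup>2 \<le> K * j * (norm (u - x))\<^sup>2"
        by (intro mult_right_mono fx that) simp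
      moreover have "x \<in> crit" using that by simp
      then have "f u \<le> f x + p x (u - x) + K / f x * (norm (u - x))\<^sup>2"
          "f u \<le> f x + q x (u - x) + K / f x * (norm (u - x))\<^sup>2"
          "f u \<le> f x + K / f x * (norm (u - x))\<^sup>2"
        using pql crit_quadratic by blast+
      ultimately show "f u \<le> f x + p x (u - x) + K * j * (norm (u - x))\<^sup>2"
        "f u \<le> f x + q x (u - x) + K * j * (norm (u - x))\<^sup>2"
        "f u \<le> f x + K * j * (norm (u - x))\<^sup>2" by linarith+
    qed
    have floors: "\<lfloor>p x (e i) / \<epsilon>\<rfloor> = \<lfloor>p y (e i) / \<epsilon>\<rfloor>" "\<lfloor>q x (e i) / \<epsilon>\<rfloor> = \<lfloor>q y (e i) / \<epsilon>\<rfloor>"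
        "\<lfloor>S j * \<kappa> i x\<rfloor> = \<lfloor>S j * \<kappa> i y\<rfloor>"
      if "x \<in> ?A" "y \<in> ?A" "i < n" for x y i
    proof -
      have "key x = key y" using that by auto
      then show "\<lfloor>p x (e i) / \<epsilon>\<rfloor> = \<lfloor>p y (e i) / \<epsilon>\<rfloor>" "\<lfloor>q x (e i) / \<epsilon>\<rfloor> = \<lfloor>q y (e i) / \<epsilon>\<rfloor>"
        "\<lfloor>S j * \<kappa> i x\<rfloor> = \<lfloor>S j * \<kappa> i y\<rfloor>"
        using that(3) lx(2)[OF that(1)] by (auto simp: key_def)
    qed
    have kdiff: "\<kappa> i (y - x) = \<kappa> i y - \<kappa> i x" if "i < n" for i x y
      by (rule linear_diff[OF bounded_linear.linear[OF bounded_linear_coord[OF that]]])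
    have slope: "\<bar>blinfun_apply (r - r') h\<bar> \<le> \<theta> / 2 * norm h"
      if eqs: "\<And>i. i < n \<Longrightarrow> \<lfloor>r (e i) / \<epsilon>\<rfloor> = \<lfloor>r' (e i) / \<epsilon>\<rfloor>" for r r' :: "'a \<Rightarrow>\<^sub>L real" and h
    proof -
      have d: "\<bar>blinfun_apply (r - r') (e i)\<bar> \<le> \<epsilon>" if "i < n" for i
      proof -
        have "\<bar>r (e i) / \<epsilon> - r' (e i) / \<epsilon>\<bar> \<le> 1" using eqs[OF that] by linarith
        then have "\<bar>r (e i) - r' (e i)\<bar> / \<epsilon> \<le> 1" using \<epsilon> by (simp flip: diff_divide_distrib)
        then show ?thesis using \<epsilon> by (simp add: blinfun.diff_left field_simps)
      qed
      have "blinfun_apply (r - r') h = blinfun_apply (r - r') (\<Sum>i<n. \<kappa> i h *\<^sub>R e i)" using arg_cong[OF expansion, of "blinfun_apply (r - r')"] .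
      also have "\<dots> = (\<Sum>i<n. \<kappa> i h * blinfun_apply (r - r') (e i))" by (simp add: blinfun.sum_right blinfun.scaleR_right)
      also have "\<bar>\<dots>\<bar> \<le> (\<Sum>i<n. C * norm h * \<epsilon>)"
        by (rule order_trans[OF sum_abs], rule sum_mono)
          (use C in \<open>auto simp: abs_mult intro!: mult_mono C(2) d\<close>)
      also have "\<dots> = \<theta> / 2 * norm h" using C n by (simp add: \<epsilon>_def)
      finally show ?thesis .
    qed
    have main: "norm (y - x) \<le> 4 * E * real n * (M / S j)"
      if x: "x \<in> ?A" and y: "y \<in> ?A" and M: "\<And>i. i < n - 1 \<Longrightarrow> \<bar>?P i x - ?P i y\<bar> \<le> M" for x y M
    proof (rule coord_dist_of_transversal[OF E C(1), of "l x" "p x - q x"])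
      show "l x < n" "1 \<le> real n * C * \<bar>blinfun_apply (p x - q x) (e (l x))\<bar>"
        "\<And>i. i < n \<Longrightarrow> \<bar>blinfun_apply (p x - q x) (e i)\<bar> \<le> \<bar>blinfun_apply (p x - q x) (e (l x))\<bar>"
        using pql[of x] x by auto
      show "\<bar>\<kappa> i (y - x)\<bar> \<le> M / S j" if i: "i < n" "i \<noteq> l x" for i
      proof -
        have "\<exists>i'<n - 1. (if i' < l0 then i' else Suc i') = i"
          using i lx(1)[OF x] pql[of x] x by (intro exI[of _ "if i < l0 then i else i - 1"]) auto
        then have "\<bar>S j * \<kappa> i x - S j * \<kappa> i y\<bar> \<le> M" using M by blast
        then have "S j * \<bar>\<kappa> i (y - x)\<bar> \<le> M"
          using S[of j] kdiff[OF i(1)] by (simp add: abs_minus_commute abs_mult flip: right_diff_distrib)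
        then show ?thesis using S[of j] by (simp add: field_simps)
      qed
      have "2 * (K * j) * norm (y - x) \<le> \<theta> / 2"
      proof -
        have "\<bar>\<kappa> i (y - x)\<bar> \<le> 1 / S j" if "i < n" for i
        proof -
          have "\<bar>S j * \<kappa> i y - S j * \<kappa> i x\<bar> \<le> 1" using floors(3)[OF x y that] by linarith
          then have "S j * \<bar>\<kappa> i (y - x)\<bar> \<le> 1"
            using S[of j] kdiff[OF that] by (simp add: abs_mult flip: right_diff_distrib)
          then show ?thesis using S[of j] by (simp add: field_simps)
        qed
        then have "(\<Sum>i<n. \<bar>\<kappa> i (y - x)\<bar>) \<le> (\<Sum>i<n. 1 / S j)" by (intro sum_mono) auto
        then have "E * (\<Sum>i<n. \<bar>\<kappa> i (y - x)\<bar>) \<le> E * (n / S j)" using E by (intro mult_left_mono) auto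
        then have "norm (y - x) \<le> E * real n / S j" using E(2)[of "y - x"] by simp
        then have "2 * (K * j) * norm (y - x) \<le> 2 * (K * j) * (E * real n / S j)"
          using K_pos by (intro mult_left_mono) auto
        also have "\<dots> = \<theta> / 2 * ((S j - 1) / S j)" using \<theta> by (simp add: S_def)
        also have "\<dots> \<le> \<theta> / 2 * 1" using \<theta> S[of j] by (intro mult_left_mono) auto
        finally show ?thesis by simp
      qed
      then have "2 * (K * j) * norm (y - x) + \<theta> / 2 \<le> \<theta>" by simp
      then have "(2 * (K * j) * norm (y - x) + \<theta> / 2) * norm (y - x) \<le> \<theta> * norm (y - x)"
        by (rule mult_right_mono) simp
      moreover have "\<bar>blinfun_apply (p x - q x) (y - x)\<bar> \<le> (2 * (K * j) * norm (y - x) + \<theta> / 2) * norm (y - x)"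
        by (rule slope_difference_small[OF _ quad(1,2)[OF x] quad(1,2)[OF y]])
          (use K_pos floors(1,2)[OF x y] in \<open>auto intro!: slope simp del: times_divide_eq_left\<close>)
      ultimately show "\<bar>blinfun_apply (p x - q x) (y - x)\<bar> \<le> 1 / (2 * E * real n * C) * norm (y - x)"
        by (simp add: \<theta>_def)
    qed
    define c where "c = K * j * (4 * E * real n / S j)\<^sup>2 + 1"
    have "hausdorff_measure (real (n - 1) / 2) (f ` ?A) = 0"
    proof (rule hausdorff_null_square_holder_image[where P = ?P and c = c])
      show "n - 1 > 0" using n_ge_2 by simp
      show "c > 0" using K_pos by (simp add: c_def add_nonneg_pos)
      show "\<bar>f x - f y\<bar> \<le> c * M\<^sup>2"
        if x: "x \<in> ?A" and y: "y \<in> ?A" and M: "\<And>i. i < n - 1 \<Longrightarrow> \<bar>?P i x - ?P i y\<bar> \<le> M" for x y M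
      proof -
        have "\<bar>f x - f y\<bar> \<le> K * j * (norm (y - x))\<^sup>2"
          using quad(3)[OF x, of y] quad(3)[OF y, of x] by (simp add: norm_minus_commute)
        also have "\<dots> \<le> K * j * (4 * E * real n * (M / S j))\<^sup>2"
          using K_pos main[OF x y M] by (intro mult_left_mono power_mono) auto
        also have "\<dots> = K * j * (4 * E * real n / S j)\<^sup>2 * M\<^sup>2" by (simp add: power2_eq_square)
        also have "\<dots> \<le> c * M\<^sup>2" unfolding c_def by (intro mult_right_mono) auto
        finally show ?thesis .
      qed
      show "\<lfloor>?P i x\<rfloor> = \<lfloor>?P i y\<rfloor>" if "x \<in> ?A" "y \<in> ?A" "i < n - 1" for x y i
        using floors(3)[OF that(1,2), of "if i < l0 then i else Suc i"] that(3) by (auto split: if_splits)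
    qed
    then show ?thesis using n_ge_2 by (simp add: of_nat_diff)
  qed
  then have "hausdorff_measure ((real n - 1) / 2) (\<Union>\<iota>. f ` {x \<in> crit. key x = \<iota>}) = 0"
    by (rule hausdorff_null_UN_countable)
  then show ?thesis by (rule hausdorff_null_mono) auto
qed

end

section \<open>Uniform ascent at regular points\<close>

text \<open>
  What regularity of a point is used for: near \<open>x0\<close> there are quadratic upper bounds whose slopes ascend
  along \<open>v\<close> at rate \<open>\<eta>\<close>, and \<open>f\<close> itself ascends along \<open>v\<close> at that rate.  Everything on
  level sets and superlevel sets below follows from this and the Lipschitz continuity of \<open>f\<close>.
\<close>

definition uniform_ascent ::
    "('a::real_normed_vector \<Rightarrow> real) \<Rightarrow> 'a \<Rightarrow> 'a \<Rightarrow> real \<Rightarrow> real \<Rightarrow> real \<Rightarrow> bool" where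
  "uniform_ascent f x0 v \<eta> \<delta> c \<longleftrightarrow> 0 < \<eta> \<and> 0 < \<delta> \<and> 0 < c \<and>
    (\<forall>x. dist x0 x < \<delta> \<longrightarrow>
      (\<exists>p :: 'a \<Rightarrow>\<^sub>L real. \<eta> \<le> p v \<and> (\<forall>u. f u \<le> f x + p (u - x) + c * (norm (u - x))\<^sup>2))) \<and>
    (\<forall>x t. dist x0 x < \<delta> \<longrightarrow> dist x0 (x + t *\<^sub>R v) < \<delta> \<longrightarrow> 0 \<le> t \<longrightarrow>
      f x + \<eta> * t \<le> f (x + t *\<^sub>R v))"

context distance_function
begin

text \<open>
  Otherwise there would be points converging to \<open>x0\<close> with slopes ascending along \<open>v\<close> at rates tending to 0 or
  less, and a limit of such slopes would be a slope at \<open>x0\<close> that does not ascend along \<open>v\<close>.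
\<close>

lemma regular_uniform:
  assumes "x0 \<notin> F" "x0 \<notin> crit"
  shows "\<exists>v. \<exists>\<eta>>0. \<exists>\<delta>>0. \<forall>x y. dist x0 x < \<delta> \<longrightarrow> y \<in> nearest F x \<longrightarrow> G (x - y) v \<ge> \<eta>"
proof -
  obtain v where v: "\<And>y. y \<in> nearest F x0 \<Longrightarrow> G (x0 - y) v > 0"
    using assms by (auto simp: crit_def not_le)
  have "\<exists>k::nat. \<forall>x y. dist x0 x < 1 / real (Suc k) \<longrightarrow> y \<in> nearest F x \<longrightarrow> G (x - y) v \<ge> 1 / real (Suc k)"
  proof (rule ccontr)
    assume "\<not> ?thesis"
    then have "\<forall>k. \<exists>x y. dist x0 x < 1 / real (Suc k) \<and> y \<in> nearest F x \<and> G (x - y) v < 1 / real (Suc k)"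
      by (meson not_le)
    then obtain x y where xy: "\<And>k. dist x0 (x k) < 1 / real (Suc k)"
      "\<And>k. y k \<in> nearest F (x k)" "\<And>k. G (x k - y k) v < 1 / real (Suc k)" by metis
    have lim0: "(\<lambda>k. 1 / real (Suc k)) \<longlonglongrightarrow> 0" by (intro LIMSEQ_Suc lim_1_over_n)
    have "x \<longlonglongrightarrow> x0"
      by (subst tendsto_dist_iff, rule tendsto_sandwich[OF _ _ tendsto_const lim0])
        (use xy(1) in \<open>auto simp: dist_commute intro!: always_eventually less_imp_le\<close>)
    then obtain r y0 where r: "strict_mono (r :: nat \<Rightarrow> nat)" and y0: "y0 \<in> nearest F x0"
      "(\<lambda>k. G (x (r k) - y (r k)) v) \<longlonglongrightarrow> G (x0 - y0) v"
      by (rule nearest_limit_G[OF _ xy(2) assms(1)])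
    have "G (x0 - y0) v \<le> 0"
      by (rule tendsto_le[OF trivial_limit_sequentially LIMSEQ_subseq_LIMSEQ[OF lim0 r] y0(2)])
        (use xy(3) in \<open>auto intro!: always_eventually less_imp_le simp: o_def\<close>)
    then show False using v y0(1) by fastforce
  qed
  then obtain k :: nat where
    "\<forall>x y. dist x0 x < 1 / real (Suc k) \<longrightarrow> y \<in> nearest F x \<longrightarrow> G (x - y) v \<ge> 1 / real (Suc k)" by blast
  moreover have "1 / real (Suc k) > 0" by simp
  ultimately show ?thesis by blast
qed

text \<open>
  The upper bound at \<open>x + t *\<^sub>R v\<close>, evaluated at \<open>x\<close>, says that \<open>f\<close> grows from \<open>x\<close> to \<open>x + t *\<^sub>R v\<close> by at least \<open>\<eta> * t\<close>
  minus a quadratic term; the quadratic term is at most \<open>\<eta> / 2 * t\<close> in a small enough ball.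
\<close>

lemma uniform_ascent_at_regular_point:
  assumes "x0 \<notin> F" "x0 \<notin> crit"
  shows "\<exists>v \<eta> \<delta> c. uniform_ascent f x0 v \<eta> \<delta> c"
proof -
  obtain v \<eta> \<delta> where \<eta>: "\<eta> > 0" and \<delta>: "\<delta> > 0" and
    G: "\<And>x y. dist x0 x < \<delta> \<Longrightarrow> y \<in> nearest F x \<Longrightarrow> G (x - y) v \<ge> \<eta>"
    using regular_uniform[OF assms] by blast
  have f0: "f x0 > 0" by (rule f_pos[OF assms(1)])
  define c where "c = 2 * K / f x0"
  have c: "c > 0" using K_pos f0 by (simp add: c_def)
  define \<rho> where "\<rho> = min \<delta> (min (f x0 / 2) (\<eta> / (4 * c * (norm v + 1))))"
  have \<rho>: "\<rho> > 0" using \<delta> f0 \<eta> c by (auto simp: \<rho>_def add_nonneg_pos)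
  have upper: "\<exists>p :: 'a \<Rightarrow>\<^sub>L real. p v \<ge> \<eta> \<and> (\<forall>u. f u \<le> f x + p (u - x) + c * (norm (u - x))\<^sup>2)"
    if x: "dist x0 x < \<rho>" for x
  proof -
    have "f x0 / 2 \<le> f x"
    proof -
      have "norm (x0 - x) < f x0 / 2" using x by (simp add: \<rho>_def dist_norm)
      then show ?thesis using f_lipschitz[of x0 x] by linarith
    qed
    then have fx: "f x > 0" "K / f x \<le> c"
      using f0 K_pos by (auto simp: c_def field_simps)
    then have xF: "x \<notin> F" by auto
    obtain y where y: "y \<in> nearest F x" using nearest_nonempty by blast
    have "f u \<le> f x + G (x - y) (u - x) + c * (norm (u - x))\<^sup>2" for u
      using f_upper[OF xF y, of u] mult_right_mono[OF fx(2), of "(norm (u - x))\<^sup>2"] by simp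
    then show ?thesis using G[of x y] x y by (auto simp: \<rho>_def)
  qed
  have ascent: "f x + \<eta> / 2 * t \<le> f (x + t *\<^sub>R v)"
    if x: "dist x0 x < \<rho>" and x': "dist x0 (x + t *\<^sub>R v) < \<rho>" and t: "t \<ge> 0" for x t
  proof -
    obtain p :: "'a \<Rightarrow>\<^sub>L real" where p: "p v \<ge> \<eta>"
      "f x \<le> f (x + t *\<^sub>R v) + p (x - (x + t *\<^sub>R v)) + c * (norm (x - (x + t *\<^sub>R v)))\<^sup>2"
      using upper[OF x'] by blast
    have "t * norm v = dist x (x + t *\<^sub>R v)" using t by (simp add: dist_norm)
    also have "\<dots> \<le> 2 * \<rho>" using x x' dist_triangle2[of x "x + t *\<^sub>R v" x0] by (simp add: dist_commute)
    finally have "c * (t * norm v) * (t * norm v) \<le> c * (2 * \<rho>) * (t * (norm v + 1))"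
    proof (intro mult_mono[of "c * (t * norm v)"])
      show "c * (t * norm v) \<le> c * (2 * \<rho>)" if "t * norm v \<le> 2 * \<rho>"
        using c that by (intro mult_left_mono) auto
    qed (use c t \<rho> in \<open>auto simp: algebra_simps\<close>)
    also have "\<dots> \<le> c * (2 * (\<eta> / (4 * c * (norm v + 1)))) * (t * (norm v + 1))"
      using c t by (intro mult_right_mono mult_left_mono) (auto simp: \<rho>_def)
    also have "\<dots> = \<eta> / 2 * t"
    proof -
      have "c * (2 * (\<eta> / (4 * c * b))) * (t * b) = \<eta> / 2 * t" if "b > 0" for b
        using c that by simp
      moreover have "norm v + 1 > 0" by (simp add: add_nonneg_pos)
      ultimately show ?thesis by blast
    qed
    finally have "c * (norm (x - (x + t *\<^sub>R v)))\<^sup>2 \<le> \<eta> / 2 * t"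
      using t by (simp add: power2_eq_square mult_ac)
    moreover have "t * \<eta> \<le> t * p v" using p(1) t by (intro mult_left_mono)
    moreover have "p (x - (x + t *\<^sub>R v)) = - (t * p v)"
      by (simp add: blinfun.minus_right blinfun.scaleR_right)
    moreover have "t * \<eta> = \<eta> / 2 * t + \<eta> / 2 * t" by simp
    ultimately show ?thesis using p(2) by linarith
  qed
  have "uniform_ascent f x0 v (\<eta> / 2) \<rho> c"
    unfolding uniform_ascent_def
  proof (intro conjI allI impI)
    fix x assume "dist x0 x < \<rho>"
    from upper[OF this] obtain p :: "'a \<Rightarrow>\<^sub>L real" where "\<eta> \<le> p v"
      "\<forall>u. f u \<le> f x + p (u - x) + c * (norm (u - x))\<^sup>2" by blast
    with \<eta> show "\<exists>p :: 'a \<Rightarrow>\<^sub>L real. \<eta> / 2 \<le> p v \<and>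
        (\<forall>u. f u \<le> f x + p (u - x) + c * (norm (u - x))\<^sup>2)"
      by (intro exI[of _ p]) auto
  qed (use \<eta> \<rho> c ascent in auto)
  then show ?thesis by blast
qed

end

section \<open>Inner products on a finite-dimensional normed space\<close>

locale inner_product_form =
  fixes B :: "'a::real_vector \<Rightarrow> 'a \<Rightarrow> real"
  assumes inner_product: "inner_product_on_space B"
begin

lemma bilinear_B: "bilinear B" and B_commute: "B x y = B y x" and B_pos: "x \<noteq> 0 \<Longrightarrow> 0 < B x x"
  using inner_product unfolding inner_product_on_space_def by auto

lemmas B_simps = bilinear_ladd[OF bilinear_B] bilinear_radd[OF bilinear_B]
  bilinear_lsub[OF bilinear_B] bilinear_rsub[OF bilinear_B]
  bilinear_lmul[OF bilinear_B] bilinear_rmul[OF bilinear_B]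
  bilinear_lneg[OF bilinear_B] bilinear_rneg[OF bilinear_B]
  bilinear_lzero[OF bilinear_B] bilinear_rzero[OF bilinear_B]

lemma B_nonneg: "0 \<le> B x x"
  by (cases "x = 0") (auto simp: B_simps intro: less_imp_le B_pos)

lemma ip_norm_nonneg: "0 \<le> ip_norm B x"
  by (simp add: ip_norm_def B_nonneg)

lemma ip_norm_square: "(ip_norm B x)\<^sup>2 = B x x"
  by (simp add: ip_norm_def B_nonneg)

lemma ip_norm_zero_iff: "ip_norm B x = 0 \<longleftrightarrow> x = 0"
  using B_pos[of x] by (cases "x = 0") (auto simp: ip_norm_def B_simps)

lemma ip_norm_scale: "ip_norm B (c *\<^sub>R x) = \<bar>c\<bar> * ip_norm B x"
  by (simp add: ip_norm_def B_simps real_sqrt_mult flip: mult.assoc)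

lemma ip_norm_minus_commute: "ip_norm B (x - y) = ip_norm B (y - x)"
  using ip_norm_scale[of "-1" "x - y"] by simp

lemma B_le_ip_norm: "B x y \<le> ip_norm B x * ip_norm B y"
proof (cases "y = 0")
  case False
  have "0 \<le> B (B y y *\<^sub>R x - B x y *\<^sub>R y) (B y y *\<^sub>R x - B x y *\<^sub>R y)" by (rule B_nonneg)
  also have "\<dots> = B y y * (B x x * B y y - (B x y)\<^sup>2)"
    by (simp add: B_simps B_commute[of y x] power2_eq_square algebra_simps)
  finally have "(B x y)\<^sup>2 \<le> B x x * B y y"
    using B_pos[OF False] by (simp add: zero_le_mult_iff)
  then have "\<bar>B x y\<bar> \<le> sqrt (B x x * B y y)" by (rule real_le_rsqrt[of "\<bar>B x y\<bar>", simplified])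
  then show ?thesis by (simp add: ip_norm_def real_sqrt_mult)
qed (simp add: B_simps ip_norm_def)

lemma ip_norm_triangle: "ip_norm B (x + y) \<le> ip_norm B x + ip_norm B y"
proof (rule power2_le_imp_le)
  have "(ip_norm B (x + y))\<^sup>2 = B x x + B y y + 2 * B x y"
    by (simp add: ip_norm_square B_simps B_commute[of y x])
  also have "\<dots> \<le> B x x + B y y + 2 * (ip_norm B x * ip_norm B y)"
    using B_le_ip_norm[of x y] by simp
  also have "\<dots> = (ip_norm B x + ip_norm B y)\<^sup>2"
    by (simp add: power2_sum ip_norm_square)
  finally show "(ip_norm B (x + y))\<^sup>2 \<le> (ip_norm B x + ip_norm B y)\<^sup>2" .
qed (simp add: ip_norm_nonneg)

lemma ip_dist_triangle: "ip_dist B x z \<le> ip_dist B x y + ip_dist B y z"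
  using ip_norm_triangle[of "x - y" "y - z"] by (simp add: ip_dist_def)

lemma ip_dist_commute: "ip_dist B x y = ip_dist B y x"
  by (simp add: ip_dist_def ip_norm_minus_commute)

lemma Metric_space_ip_dist: "Metric_space Q (ip_dist B)"
  by unfold_locales
    (auto simp: ip_dist_triangle ip_dist_commute, auto simp: ip_dist_def ip_norm_nonneg ip_norm_zero_iff)

lemma convex_mball:
  assumes "subspace Q"
  shows "convex (Metric_space.mball Q (ip_dist B) x \<rho>)"
proof (rule convexI)
  interpret Metric_space Q "ip_dist B" by (rule Metric_space_ip_dist)
  fix y z u w assume y: "y \<in> mball x \<rho>" and z: "z \<in> mball x \<rho>"
    and uw: "0 \<le> u" "0 \<le> w" "u + w = (1::real)"
  have "x - (u *\<^sub>R y + w *\<^sub>R z) = u *\<^sub>R (x - y) + w *\<^sub>R (x - z)"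
  proof -
    have "u *\<^sub>R (x - y) + w *\<^sub>R (x - z) = (u + w) *\<^sub>R x - (u *\<^sub>R y + w *\<^sub>R z)"
      by (simp add: algebra_simps)
    then show ?thesis using uw(3) by simp
  qed
  then have "ip_dist B x (u *\<^sub>R y + w *\<^sub>R z) \<le> u * ip_dist B x y + w * ip_dist B x z"
    using ip_norm_triangle[of "u *\<^sub>R (x - y)" "w *\<^sub>R (x - z)"] uw by (simp add: ip_dist_def ip_norm_scale)
  also have "\<dots> < \<rho>" using y z uw by (intro convex_bound_lt) auto
  finally show "u *\<^sub>R y + w *\<^sub>R z \<in> mball x \<rho>"
    using y z assms by (simp add: subspace_add subspace_scale)
qed

text \<open>
  After subtracting \<open>c / 2 * |u|^2\<close> the quadratic supports become affine, and a function with an affine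
  support from above at each point is concave.
\<close>

lemma concave_on_of_quadratic_supports:
  assumes "convex D"
    and support: "\<And>u. u \<in> D \<Longrightarrow> \<exists>l. linear l \<and> (\<forall>w\<in>D. s w \<le> s u + l (w - u) + c / 2 * (ip_norm B (w - u))\<^sup>2)"
  shows "concave_on D (\<lambda>u. s u - c / 2 * (ip_norm B u)\<^sup>2)"
  unfolding concave_on_iff
proof (intro conjI ballI allI impI)
  fix x y and u w :: real
  assume xy: "x \<in> D" "y \<in> D" and uw: "0 \<le> u" "0 \<le> w" "u + w = 1"
  define z where "z = u *\<^sub>R x + w *\<^sub>R y"
  have zD: "z \<in> D" using assms(1) xy uw by (simp add: z_def convexD)
  obtain l where l: "linear l" "\<And>a. a \<in> D \<Longrightarrow> s a \<le> s z + l (a - z) + c / 2 * (ip_norm B (a - z))\<^sup>2"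
    using support[OF zD] by blast
  let ?h = "\<lambda>u. s u - c / 2 * (ip_norm B u)\<^sup>2"
  let ?k = "\<lambda>a. l a - c * B z a"
  have h: "?h a \<le> ?h z + ?k (a - z)" if "a \<in> D" for a
  proof -
    have "(ip_norm B (a - z))\<^sup>2 = (ip_norm B a)\<^sup>2 - (ip_norm B z)\<^sup>2 - 2 * B z (a - z)"
      by (simp add: ip_norm_square B_simps B_commute[of a z])
    then have "c / 2 * (ip_norm B (a - z))\<^sup>2 =
        c / 2 * (ip_norm B a)\<^sup>2 - c / 2 * (ip_norm B z)\<^sup>2 - c * B z (a - z)"
      by (simp add: right_diff_distrib)
    then show ?thesis using l(2)[OF that] by linarith
  qed
  have "u * ?h x + w * ?h y \<le> u * (?h z + ?k (x - z)) + w * (?h z + ?k (y - z))"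
    using h[OF xy(1)] h[OF xy(2)] uw by (intro add_mono mult_left_mono) auto
  also have "\<dots> = (u + w) * ?h z + (l (u *\<^sub>R (x - z) + w *\<^sub>R (y - z)) - c * B z (u *\<^sub>R (x - z) + w *\<^sub>R (y - z)))"
    unfolding linear_add[OF l(1)] linear_scale[OF l(1)] bilinear_radd[OF bilinear_B] bilinear_rmul[OF bilinear_B]
    by (simp add: algebra_simps)
  also have "u *\<^sub>R (x - z) + w *\<^sub>R (y - z) = 0"
  proof -
    have "u *\<^sub>R (x - z) + w *\<^sub>R (y - z) = z - (u + w) *\<^sub>R z"
      by (simp add: z_def algebra_simps)
    then show ?thesis using uw by simp
  qed
  finally show "u * ?h x + w * ?h y \<le> ?h (u *\<^sub>R x + w *\<^sub>R y)"
    using uw linear_0[OF l(1)] by (simp add: z_def[symmetric] B_simps)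
qed (rule assms(1))

end

context bounded_coordinates
begin

lemma inner_product_exists: "inner_product_on_space (\<lambda>x y. \<Sum>i<n. \<kappa> i x * \<kappa> i y)"
proof -
  have lin: "linear (\<kappa> i)" if "i < n" for i using bounded_linear.linear bounded_linear_coord that by blast
  have "0 < (\<Sum>i<n. \<kappa> i x * \<kappa> i x)" if "x \<noteq> 0" for x
  proof -
    have "\<exists>i<n. \<kappa> i x \<noteq> 0"
    proof (rule ccontr)
      assume "\<not> ?thesis"
      then have "(\<Sum>i<n. \<kappa> i x *\<^sub>R e i) = 0" by (intro sum.neutral) auto
      then show False using that expansion[of x] by metis
    qed
    then obtain i where i: "i < n" "\<kappa> i x \<noteq> 0" by blast
    then have "0 < \<kappa> i x * \<kappa> i x" by (simp add: zero_less_mult_iff linorder_neq_iff[symmetric])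
    then show ?thesis by (intro sum_pos2[of _ i]) (use i in auto)
  qed
  moreover have "bilinear (\<lambda>x y. \<Sum>i<n. \<kappa> i x * \<kappa> i y)"
    unfolding bilinear_def
    by (auto intro!: linearI simp: linear_add[OF lin] linear_scale[OF lin] sum.distrib[symmetric]
        sum_distrib_left algebra_simps intro: sum.cong)
  ultimately show ?thesis
    unfolding inner_product_on_space_def by (auto simp: mult.commute)
qed

end

locale finite_dim_inner_product = bounded_coordinates n e \<kappa> + inner_product_form B
  for n and e :: "nat \<Rightarrow> 'a::real_normed_vector" and \<kappa> and B :: "'a \<Rightarrow> 'a \<Rightarrow> real"
begin

lemma ip_norm_upper: "\<exists>b>0. \<forall>x. ip_norm B x \<le> b * norm x"
proof -
  obtain C where C: "C > 0" "\<And>i u. i < n \<Longrightarrow> \<bar>\<kappa> i u\<bar> \<le> C * norm u"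
    using coord_bound by blast
  have ip_sum: "ip_norm B (\<Sum>i\<in>I. g i) \<le> (\<Sum>i\<in>I. ip_norm B (g i))" if "finite I" for I :: "nat set" and g
    using that
  proof (induction I rule: finite_induct)
    case empty
    show ?case using ip_norm_zero_iff[of 0] by simp
  next
    case (insert i I)
    then show ?case using ip_norm_triangle[of "g i" "\<Sum>i\<in>I. g i"] by simp
  qed
  let ?b = "1 + (\<Sum>i<n. C * ip_norm B (e i))"
  have "ip_norm B x \<le> ?b * norm x" for x
  proof -
    have "ip_norm B x = ip_norm B (\<Sum>i<n. \<kappa> i x *\<^sub>R e i)" using arg_cong[OF expansion, of "ip_norm B"] .
    also have "\<dots> \<le> (\<Sum>i<n. \<bar>\<kappa> i x\<bar> * ip_norm B (e i))"
      by (rule order_trans[OF ip_sum]) (simp_all add: ip_norm_scale)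
    also have "\<dots> \<le> (\<Sum>i<n. C * norm x * ip_norm B (e i))"
      by (intro sum_mono mult_right_mono C ip_norm_nonneg) simp
    also have "\<dots> = (\<Sum>i<n. C * ip_norm B (e i)) * norm x"
      unfolding sum_distrib_right by (intro sum.cong) (simp_all add: mult_ac)
    also have "\<dots> \<le> ?b * norm x" by (intro mult_right_mono) auto
    finally show ?thesis .
  qed
  moreover have "?b > 0" using C ip_norm_nonneg by (intro add_pos_nonneg sum_nonneg) auto
  ultimately show ?thesis by blast
qed

lemma continuous_ip_norm: "continuous_on S (ip_norm B)"
proof -
  obtain b where b: "b > 0" "\<And>x. ip_norm B x \<le> b * norm x" using ip_norm_upper by blast
  have "\<bar>ip_norm B x - ip_norm B y\<bar> \<le> b * dist x y" for x y
    using ip_norm_triangle[of "x - y" y] ip_norm_triangle[of "y - x" x]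
      b(2)[of "x - y"] ip_norm_minus_commute[of x y] by (simp add: dist_norm)
  then have "b-lipschitz_on S (ip_norm B)"
    using b(1) by (intro lipschitz_onI) (auto simp: dist_real_def)
  then show ?thesis by (rule lipschitz_on_continuous_on)
qed

text \<open>
  The minimum over the unit sphere, which is compact.
\<close>

lemma ip_norm_lower: "\<exists>a>0. \<forall>x. a * norm x \<le> ip_norm B x"
proof (cases "\<exists>u::'a. norm u = 1")
  case True
  have "sphere (0::'a) 1 = {x. norm x = 1}" by auto
  moreover have "closed {x::'a. norm x = 1}" by (intro closed_Collect_eq continuous_intros)
  moreover have "bounded {x::'a. norm x = 1}" by (rule boundedI[of _ 1]) simp
  ultimately have cpt: "compact (sphere (0::'a) 1)" using closed_bounded_compact by simp
  then obtain u :: 'a where u: "norm u = 1" "\<And>y. norm y = 1 \<Longrightarrow> ip_norm B u \<le> ip_norm B y"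
    using continuous_attains_inf[OF cpt _ continuous_ip_norm] True
    by (metis (no_types, lifting) empty_iff mem_sphere_0)
  have "ip_norm B u > 0" using u(1) ip_norm_zero_iff[of u] ip_norm_nonneg[of u] by fastforce
  moreover have "ip_norm B u * norm x \<le> ip_norm B x" for x
  proof (cases "x = 0")
    case False
    then have "ip_norm B u \<le> ip_norm B ((1 / norm x) *\<^sub>R x)" by (intro u(2)) simp
    then show ?thesis using False by (simp add: ip_norm_scale field_simps)
  qed (simp add: ip_norm_nonneg)
  ultimately show ?thesis by blast
next
  case False
  have "x = 0" for x :: 'a using False norm_sgn[of x] by metis
  then show ?thesis by (intro exI[of _ 1]) (metis ip_norm_nonneg mult_1 norm_zero zero_less_one)
qed

lemma open_imp_openin_ip:
  assumes "open W"
  shows "openin (Metric_space.mtopology UNIV (ip_dist B)) W"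
proof -
  interpret M: Metric_space UNIV "ip_dist B" by (rule Metric_space_ip_dist)
  obtain a where a: "a > 0" "\<And>x. a * norm x \<le> ip_norm B x" using ip_norm_lower by blast
  show ?thesis unfolding M.openin_mtopology
  proof (intro conjI allI impI)
    fix x assume "x \<in> W"
    then obtain d where d: "d > 0" "ball x d \<subseteq> W" using assms open_contains_ball by blast
    have "M.mball x (a * d) \<subseteq> ball x d"
    proof
      fix y assume "y \<in> M.mball x (a * d)"
      then have "a * norm (x - y) < a * d" using a(2)[of "x - y"] by (simp add: ip_dist_def)
      then show "y \<in> ball x d" using a(1) by (simp add: dist_norm)
    qed
    then show "\<exists>r>0. M.mball x r \<subseteq> W" using d a(1) by (intro exI[of _ "a * d"]) auto
  qed simp
qed

lemma orthogonal_complement: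
  assumes "v \<noteq> 0"
  shows "subspace {q. B q v = 0}" "dim {q. B q v = 0} = n - 1"
proof -
  let ?Q = "{q. B q v = 0}"
  show sub: "subspace ?Q" by (auto simp: subspace_def B_simps)
  obtain b where b: "b \<subseteq> ?Q" "independent b" "?Q \<subseteq> span b" "card b = dim ?Q"
    using basis_exists[of ?Q] by blast
  have "v \<notin> ?Q" using B_pos[OF assms] by simp
  then have v: "v \<notin> span b" using span_minimal[OF b(1) sub] by blast
  have ind: "independent (insert v b)" using v b(2) by (simp add: independent_insert)
  have "x \<in> span (insert v b)" for x
  proof -
    have "x - (B x v / B v v) *\<^sub>R v \<in> ?Q" using B_pos[OF assms] by (simp add: B_simps)
    then show ?thesis using b(3) by (auto simp: span_breakdown_eq)
  qed
  then have spans: "UNIV \<subseteq> span (insert v b)" by auto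
  have "x \<in> span (e ` {..<n})" for x
    by (subst expansion[of x]) (intro span_sum span_scale span_base, simp)
  then have "finite (insert v b)"
    using independent_span_bound[OF _ ind, of "e ` {..<n}"] by auto
  moreover have "dim (UNIV :: 'a set) = card (insert v b)"
    using dim_unique[OF _ spans ind refl] by simp
  moreover have "v \<notin> b" using v span_base by blast
  ultimately show "dim ?Q = n - 1" using b(4) dim_UNIV by simp
qed

section \<open>Level sets as graphs\<close>

text \<open>
  On each line \<open>u + t *\<^sub>R (- v)\<close> near \<open>x0\<close> the function \<open>f\<close> decreases strictly in \<open>t\<close> and crosses the level \<open>r\<close> exactly once, at
  \<open>t = s u\<close>.  Comparing the rate \<open>\<eta>\<close> with the Lipschitz constant 1 of \<open>f\<close> gives the Lipschitz constant \<open>1 / \<eta>\<close> for \<open>s\<close>.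
  The direction is \<open>- v\<close>, and not \<open>v\<close>, because \<open>s\<close> has to inherit upper bounds from \<open>f\<close>: the superlevel set of \<open>f\<close>
  is then the region below the graph of \<open>s\<close>.
\<close>

lemma level_set_graph:
  assumes asc: "uniform_ascent f x0 v \<eta> \<delta> c"
    and lip: "\<And>x y. \<bar>f x - f y\<bar> \<le> norm (x - y)"
    and r: "f x0 = r"
  defines "Q \<equiv> {q. B q v = 0}"
  shows "\<exists>u0 \<rho> W s \<Lambda> c2. v \<noteq> 0 \<and> 0 < \<rho> \<and> open W \<and> x0 \<in> W \<and> 0 \<le> \<Lambda> \<and>
    (let D = Metric_space.mball Q (ip_dist B) u0 \<rho> in
     {x. f x = r} \<inter> W = {u + s u *\<^sub>R (- v) |u. u \<in> D} \<and>
     (\<forall>u\<in>D. \<forall>w\<in>D. \<bar>s u - s w\<bar> \<le> \<Lambda> * norm (u - w)) \<and>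
     concave_on D (\<lambda>u. s u - c2 / 2 * (ip_norm B u)\<^sup>2))"
proof -
  have \<eta>: "\<eta> > 0" and \<delta>: "\<delta> > 0" and c: "c > 0" using asc by (auto simp: uniform_ascent_def)
  have slope: "\<exists>p :: 'a \<Rightarrow>\<^sub>L real. \<eta> \<le> p v \<and> (\<forall>u. f u \<le> f x + p (u - x) + c * (norm (u - x))\<^sup>2)"
    if "dist x0 x < \<delta>" for x using asc that by (auto simp: uniform_ascent_def)
  have ascent: "f x + \<eta> * t \<le> f (x + t *\<^sub>R v)"
    if "dist x0 x < \<delta>" "dist x0 (x + t *\<^sub>R v) < \<delta>" "0 \<le> t" for x t
    using asc that by (auto simp: uniform_ascent_def)
  have v: "v \<noteq> 0"
    using slope[of x0] \<delta> \<eta> by (auto simp: blinfun.zero_right)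
  have Bv: "B v v > 0" using B_pos[OF v] .
  have subQ: "subspace Q" unfolding Q_def by (rule orthogonal_complement[OF v])
  obtain a where a: "a > 0" "\<And>x. a * norm x \<le> ip_norm B x" using ip_norm_lower by blast
  define \<tau> where "\<tau> = (\<lambda>x. - B x v / B v v)"
  define \<pi> where "\<pi> = (\<lambda>x. x + \<tau> x *\<^sub>R v)"
  have \<pi>Q: "\<pi> x \<in> Q" for x using Bv by (simp add: \<pi>_def \<tau>_def Q_def B_simps)
  have dec: "\<pi> x + \<tau> x *\<^sub>R (- v) = x" for x by (simp add: \<pi>_def)
  have \<tau>Q: "\<tau> (u + t *\<^sub>R (- v)) = t" "\<pi> (u + t *\<^sub>R (- v)) = u" if "u \<in> Q" for u t
    using that Bv by (simp_all add: \<pi>_def \<tau>_def Q_def B_simps)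
  have lin\<tau>: "linear \<tau>" unfolding \<tau>_def
    by (rule linearI) (simp_all add: B_simps diff_divide_distrib)
  have cont\<tau>: "continuous_on UNIV \<tau>"
    by (rule linear_continuous_on[OF linear_imp_bounded_linear[OF lin\<tau>]])
  have cont\<pi>: "continuous_on UNIV \<pi>" unfolding \<pi>_def by (intro continuous_intros cont\<tau>)
  define u0 where "u0 = \<pi> x0"
  define t0 where "t0 = \<tau> x0"
  \<comment> \<open>\<open>T\<close> is half the height of the cylinder around \<open>x0\<close>, and \<open>\<rho>\<close> is the radius of its base.  The
    cylinder stays in the \<open>\<delta>\<close>-ball, and from the axis to any other vertical line \<open>f\<close> changes by less than \<open>\<eta> * T\<close>, its least change along
    half of the axis; so \<open>f\<close> crosses the level \<open>r\<close> inside the cylinder on each vertical line.\<close>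
  define T where "T = \<delta> / (2 * (norm v + 1))"
  have nv: "norm v + 1 > 0" by (simp add: add_nonneg_pos)
  have T: "T > 0" using \<delta> nv by (simp add: T_def)
  have Tv: "T * norm v \<le> \<delta> / 2"
  proof -
    have "T * norm v \<le> T * (norm v + 1)" using T by simp
    also have "\<dots> = \<delta> / 2"
    proof -
      have "\<delta> / (2 * b) * b = \<delta> / 2" if "b > 0" for b using that by simp
      then show ?thesis using nv unfolding T_def by blast
    qed
    finally show ?thesis .
  qed
  define \<rho> where "\<rho> = a * min (\<delta> / 2) (\<eta> * T)"
  have \<rho>: "\<rho> > 0" using a \<delta> \<eta> T by (simp add: \<rho>_def)
  interpret M: Metric_space Q "ip_dist B" by (rule Metric_space_ip_dist)
  define D where "D = M.mball u0 \<rho>"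
  have D: "u \<in> D \<longleftrightarrow> u \<in> Q \<and> ip_norm B (u0 - u) < \<rho>" for u
    using \<pi>Q by (auto simp: D_def u0_def ip_dist_def)
  have Dn: "norm (u - u0) < \<delta> / 2" "norm (u - u0) < \<eta> * T" if "u \<in> D" for u
  proof -
    have "a * norm (u0 - u) < a * min (\<delta> / 2) (\<eta> * T)"
      using that a(2)[of "u0 - u"] D by (simp add: \<rho>_def)
    then show "norm (u - u0) < \<delta> / 2" "norm (u - u0) < \<eta> * T"
      using a(1) by (auto simp: norm_minus_commute)
  qed
  let ?x = "\<lambda>u t. u + t *\<^sub>R (- v)"
  have x0: "?x u0 t0 = x0" unfolding u0_def t0_def by (rule dec)
  have u0D: "u0 \<in> D" using \<rho> \<pi>Q ip_norm_zero_iff[of 0] by (simp add: D u0_def)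
  have near: "dist x0 (?x u t) < \<delta>" if "u \<in> D" "\<bar>t - t0\<bar> \<le> T" for u t
  proof -
    have "?x u t - x0 = (u - u0) - (t - t0) *\<^sub>R v" by (subst x0[symmetric]) (simp add: algebra_simps)
    then have "dist x0 (?x u t) = norm ((u - u0) - (t - t0) *\<^sub>R v)"
      by (metis dist_commute dist_norm)
    also have "\<dots> \<le> norm (u - u0) + \<bar>t - t0\<bar> * norm v"
      using norm_triangle_ineq4[of "u - u0" "(t - t0) *\<^sub>R v"] by simp
    also have "\<bar>t - t0\<bar> * norm v \<le> T * norm v" using that by (intro mult_right_mono) auto
    finally show ?thesis using Tv Dn(1)[OF that(1)] by linarith
  qed
  have mono: "f (?x u t) + \<eta> * (t - t') \<le> f (?x u t')"
    if "u \<in> D" "\<bar>t - t0\<bar> \<le> T" "\<bar>t' - t0\<bar> \<le> T" "t' \<le> t" for u t t'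
  proof -
    have e: "?x u t + (t - t') *\<^sub>R v = ?x u t'" by (simp add: algebra_simps)
    show ?thesis
      using ascent[of "?x u t" "t - t'"] near[OF that(1,2)] near[OF that(1,3)] that(4)
      unfolding e by simp
  qed
  have cont: "continuous_on S f" for S
    by (rule lipschitz_on_continuous_on[of 1], rule lipschitz_onI) (use lip in \<open>auto simp: dist_real_def dist_norm\<close>)
  have "\<exists>t. \<bar>t - t0\<bar> \<le> T \<and> f (?x u t) = r \<and> \<bar>t - t0\<bar> < T" if u: "u \<in> D" for u
  proof -
    have lo: "f (?x u (t0 + T)) < r"
    proof -
      have "f (?x u (t0 + T)) \<le> f (?x u0 (t0 + T)) + norm (u - u0)"
        using lip[of "?x u (t0 + T)" "?x u0 (t0 + T)"] by simp
      moreover have "f (?x u0 (t0 + T)) + \<eta> * T \<le> r"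
        using mono[OF u0D, of "t0 + T" t0] x0 r T by simp
      ultimately show ?thesis using Dn(2)[OF u] by linarith
    qed
    have hi: "r < f (?x u (t0 - T))"
    proof -
      have "f (?x u0 (t0 - T)) \<le> f (?x u (t0 - T)) + norm (u - u0)"
        using lip[of "?x u0 (t0 - T)" "?x u (t0 - T)"] by (simp add: norm_minus_commute)
      moreover have "r + \<eta> * T \<le> f (?x u0 (t0 - T))"
        using mono[OF u0D, of t0 "t0 - T"] x0 r T by simp
      ultimately show ?thesis using Dn(2)[OF u] by linarith
    qed
    have "\<exists>t. t0 - T \<le> t \<and> t \<le> t0 + T \<and> f (?x u t) = r"
    proof (rule IVT2'[of "\<lambda>t. f (?x u t)"])
      show "continuous_on {t0 - T..t0 + T} (\<lambda>t. f (?x u t))"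
        by (intro continuous_on_compose2[OF cont[of UNIV]] continuous_intros) auto
    qed (use lo hi T in auto)
    then obtain t where t: "t0 - T \<le> t" "t \<le> t0 + T" "f (?x u t) = r" by blast
    then have "t \<noteq> t0 - T" "t \<noteq> t0 + T" using lo hi by auto
    then show ?thesis using t by (intro exI[of _ t]) auto
  qed
  then obtain s where s: "\<And>u. u \<in> D \<Longrightarrow> \<bar>s u - t0\<bar> \<le> T" "\<And>u. u \<in> D \<Longrightarrow> f (?x u (s u)) = r"
    "\<And>u. u \<in> D \<Longrightarrow> \<bar>s u - t0\<bar> < T" by metis
  have uniq: "t = s u" if "u \<in> D" "\<bar>t - t0\<bar> \<le> T" "f (?x u t) = r" for u t
  proof (cases "t \<le> s u")
    case True
    then have "\<eta> * (s u - t) \<le> 0" using mono[OF that(1) s(1)[OF that(1)] that(2)] s(2) that by simp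
    then show ?thesis using True \<eta> by (simp add: mult_le_0_iff)
  next
    case False
    then have "\<eta> * (t - s u) \<le> 0" using mono[OF that(1,2) s(1)[OF that(1)]] s(2) that by simp
    then show ?thesis using False \<eta> by (simp add: mult_le_0_iff)
  qed
  have lip1: "\<eta> * (s w - s u) \<le> norm (u - w)" if "u \<in> D" "w \<in> D" for u w
  proof (cases "s u \<le> s w")
    case True
    have "r + \<eta> * (s w - s u) \<le> f (?x w (s u))"
      using mono[OF that(2) s(1)[OF that(2)] s(1)[OF that(1)] True] s(2)[OF that(2)] by simp
    also have "\<dots> \<le> r + norm (u - w)"
      using lip[of "?x w (s u)" "?x u (s u)"] s(2)[OF that(1)] by (simp add: norm_minus_commute)
    finally show ?thesis by simp
  next
    case False
    then have "\<eta> * (s w - s u) \<le> 0" using \<eta> by (simp add: mult_le_0_iff)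
    then show ?thesis by (rule order_trans) simp
  qed
  have lipS: "\<bar>s u - s w\<bar> \<le> 1 / \<eta> * norm (u - w)" if "u \<in> D" "w \<in> D" for u w
  proof -
    have "\<eta> * \<bar>s u - s w\<bar> \<le> norm (u - w)"
      using lip1[OF that] lip1[OF that(2,1)] \<eta> by (auto simp: abs_if norm_minus_commute)
    then show ?thesis using \<eta> by (simp add: field_simps)
  qed
  \<comment> \<open>A Lipschitz constant of the graph map \<open>u \<mapsto> u + s u *\<^sub>R (- v)\<close> from the inner product norm on \<open>Q\<close>
    to the given norm.\<close>
  define m where "m = (1 + norm v / \<eta>) / a"
  define c2 where "c2 = 2 * (c * m\<^sup>2 / \<eta>)"
  have concave: "concave_on D (\<lambda>u. s u - c2 / 2 * (ip_norm B u)\<^sup>2)"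
  proof (rule concave_on_of_quadratic_supports)
    show "convex D" unfolding D_def by (rule convex_mball[OF subQ])
    fix u assume u: "u \<in> D"
    obtain p :: "'a \<Rightarrow>\<^sub>L real" where p: "\<eta> \<le> p v"
      "\<And>y. f y \<le> f (?x u (s u)) + p (y - ?x u (s u)) + c * (norm (y - ?x u (s u)))\<^sup>2"
      using slope[OF near[OF u s(1)[OF u]]] by blast
    have pv: "p v > 0" using p(1) \<eta> by simp
    have "s w \<le> s u + p (w - u) / p v + c2 / 2 * (ip_norm B (w - u))\<^sup>2" if w: "w \<in> D" for w
    proof -
      let ?h = "?x w (s w) - ?x u (s u)"
      have h: "?h = (w - u) - (s w - s u) *\<^sub>R v" by (simp add: algebra_simps)
      have "norm ?h \<le> norm (w - u) + \<bar>s w - s u\<bar> * norm v"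
        unfolding h using norm_triangle_ineq4[of "w - u" "(s w - s u) *\<^sub>R v"] by simp
      also have "\<dots> \<le> norm (w - u) + (1 / \<eta> * norm (w - u)) * norm v"
        using lipS[OF w u] by (intro add_left_mono mult_right_mono) auto
      also have "\<dots> = (1 + norm v / \<eta>) * norm (w - u)" by (simp add: algebra_simps)
      also have "\<dots> \<le> (1 + norm v / \<eta>) * (ip_norm B (w - u) / a)"
        using a(1) a(2)[of "w - u"] \<eta> by (intro mult_left_mono) (auto simp: field_simps)
      finally have "norm ?h \<le> m * ip_norm B (w - u)" by (simp add: m_def)
      then have nh: "c * (norm ?h)\<^sup>2 \<le> c * (m * ip_norm B (w - u))\<^sup>2"
        using c by (intro mult_left_mono power_mono) auto
      have "0 \<le> p ?h + c * (norm ?h)\<^sup>2" using p(2)[of "?x w (s w)"] s(2)[OF u] s(2)[OF w] by simp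
      also have "p ?h = p (w - u) - (s w - s u) * p v"
        unfolding h by (simp add: blinfun.diff_right blinfun.scaleR_right)
      finally have "(s w - s u) * p v \<le> p (w - u) + c * (m * ip_norm B (w - u))\<^sup>2" using nh by simp
      then have "s w - s u \<le> (p (w - u) + c * (m * ip_norm B (w - u))\<^sup>2) / p v"
        using pv by (simp add: field_simps)
      also have "\<dots> = p (w - u) / p v + c * (m * ip_norm B (w - u))\<^sup>2 / p v"
        by (rule add_divide_distrib)
      also have "c * (m * ip_norm B (w - u))\<^sup>2 / p v \<le> c * (m * ip_norm B (w - u))\<^sup>2 / \<eta>"
        using p(1) \<eta> c by (intro divide_left_mono) auto
      also have "\<dots> = c2 / 2 * (ip_norm B (w - u))\<^sup>2" by (simp add: c2_def power_mult_distrib)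
      finally show ?thesis by simp
    qed
    moreover have "linear (\<lambda>y. p y / p v)"
      by (rule linearI) (simp_all add: blinfun.add_right blinfun.scaleR_right add_divide_distrib)
    ultimately show "\<exists>l. linear l \<and> (\<forall>w\<in>D. s w \<le> s u + l (w - u) + c2 / 2 * (ip_norm B (w - u))\<^sup>2)"
      by blast
  qed
  define W where "W = {x. ip_norm B (u0 - \<pi> x) < \<rho> \<and> \<bar>\<tau> x - t0\<bar> < T}"
  have "open W" unfolding W_def
    by (intro open_Collect_conj open_Collect_less continuous_intros cont\<tau>
        continuous_on_compose2[OF continuous_ip_norm[of UNIV]] cont\<pi>) auto
  moreover have "x0 \<in> W" using \<rho> T ip_norm_zero_iff[of 0] by (simp add: W_def u0_def t0_def)
  moreover have "{x. f x = r} \<inter> W = {u + s u *\<^sub>R (- v) |u. u \<in> D}"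
  proof (intro equalityI subsetI)
    fix x assume x: "x \<in> {x. f x = r} \<inter> W"
    then have xD: "\<pi> x \<in> D" using \<pi>Q by (simp add: D W_def)
    have "\<tau> x = s (\<pi> x)"
      by (rule uniq[OF xD]) (use x dec[of x] in \<open>auto simp: W_def\<close>)
    then show "x \<in> {u + s u *\<^sub>R (- v) |u. u \<in> D}" using dec[of x] xD by (metis (mono_tags, lifting) mem_Collect_eq)
  next
    fix x assume "x \<in> {u + s u *\<^sub>R (- v) |u. u \<in> D}"
    then obtain u where u: "u \<in> D" "x = ?x u (s u)" by blast
    then have "\<tau> x = s u" "\<pi> x = u" using \<tau>Q[of u "s u"] D by auto
    then show "x \<in> {x. f x = r} \<inter> W" using u s(2,3)[OF u(1)] D by (simp add: W_def)
  qed
  ultimately have "v \<noteq> 0 \<and> 0 < \<rho> \<and> open W \<and> x0 \<in> W \<and> 0 \<le> 1 / \<eta> \<and>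
    (let D = M.mball u0 \<rho> in
     {x. f x = r} \<inter> W = {u + s u *\<^sub>R (- v) |u. u \<in> D} \<and>
     (\<forall>u\<in>D. \<forall>w\<in>D. \<bar>s u - s w\<bar> \<le> 1 / \<eta> * norm (u - w)) \<and>
     concave_on D (\<lambda>u. s u - c2 / 2 * (ip_norm B u)\<^sup>2))"
    unfolding Let_def D_def[symmetric] using v \<rho> \<eta> lipS concave by auto
  then show ?thesis by blast
qed

lemma level_set_semiconcave_surface:
  assumes asc: "\<And>x. f x = r \<Longrightarrow> \<exists>v \<eta> \<delta> c. uniform_ascent f x v \<eta> \<delta> c"
    and lip: "\<And>x y. \<bar>f x - f y\<bar> \<le> norm (x - y)"
    and ne: "{x. f x = r} \<noteq> {}" and n: "0 < n"
  shows "semiconcave_surface (n - 1) B {x. f x = r}"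
  unfolding semiconcave_surface_def
proof (intro conjI ballI)
  show "dim (UNIV :: 'a set) = n - 1 + 1" using dim_UNIV n by simp
  show "{x. f x = r} \<noteq> {}" by (rule ne)
  fix x0 assume "x0 \<in> {x. f x = r}"
  then have r: "f x0 = r" by simp
  obtain v \<eta> \<delta> c where "uniform_ascent f x0 v \<eta> \<delta> c" using asc[OF r] by blast
  from level_set_graph[OF this lip r] obtain u0 \<rho> W s \<Lambda> c2 where v: "v \<noteq> 0" and \<rho>: "0 < \<rho>"
    and W: "open W" "x0 \<in> W"
    and D: "{x. f x = r} \<inter> W = {u + s u *\<^sub>R (- v) |u. u \<in> Metric_space.mball {q. B q v = 0} (ip_dist B) u0 \<rho>}"
    "concave_on (Metric_space.mball {q. B q v = 0} (ip_dist B) u0 \<rho>) (\<lambda>u. s u - c2 / 2 * (ip_norm B u)\<^sup>2)"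
    unfolding Let_def by blast
  let ?Q = "{q. B q v = 0}"
  note subQ = orthogonal_complement(1)[OF v]
  interpret M: Metric_space ?Q "ip_dist B" by (rule Metric_space_ip_dist)
  let ?D = "M.mball u0 \<rho>"
  have "locally_semiconcave_on B ?Q ?D s"
    unfolding locally_semiconcave_on_def
  proof
    fix x assume "x \<in> ?D"
    then obtain d where d: "d > 0" "M.mball x d \<subseteq> ?D"
      using M.openin_mball[of u0 \<rho>] unfolding M.openin_mtopology by blast
    have "concave_on (M.mball x d) (\<lambda>u. s u - c2 / 2 * (ip_norm B u)\<^sup>2)"
      using D(2) d(2) convex_mball[OF subQ] unfolding concave_on_def by (rule convex_on_subset)
    then show "\<exists>\<delta>>0. M.mball x \<delta> \<subseteq> ?D \<and> semiconcave_on B (M.mball x \<delta>) s"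
      unfolding semiconcave_on_def using d by blast
  qed
  moreover have "\<forall>q\<in>?Q. B q (- v) = 0" by (simp add: B_simps)
  moreover have "- v \<noteq> 0" using v by simp
  ultimately show "\<exists>Q W D v s. subspace Q \<and> dim Q = n - 1 \<and>
        openin (Metric_space.mtopology UNIV (ip_dist B)) W \<and> x0 \<in> W \<and>
        openin (Metric_space.mtopology Q (ip_dist B)) D \<and>
        v \<noteq> 0 \<and> (\<forall>q\<in>Q. B q v = 0) \<and> locally_semiconcave_on B Q D s \<and>
        {x. f x = r} \<inter> W = {u + s u *\<^sub>R v |u. u \<in> D}"
    using subQ orthogonal_complement(2)[OF v] open_imp_openin_ip[OF W(1)] W(2) M.openin_mball D(1)
    by blast
qed

text \<open>
  The chart is the projection along \<open>v\<close> to the orthogonal complement of \<open>v\<close>, followed by linear coordinates there; it is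
  bilipschitz because the graph function is Lipschitz.
\<close>

lemma level_set_lipschitz_manifold:
  fixes f :: "'a \<Rightarrow> real"
  assumes asc: "\<And>x. f x = r \<Longrightarrow> \<exists>v \<eta> \<delta> c. uniform_ascent f x v \<eta> \<delta> c"
    and lip: "\<And>x y. \<bar>f x - f y\<bar> \<le> norm (x - y)" and n: "2 \<le> n"
  shows "lipschitz_manifold (n - 1) {x. f x = r}"
  unfolding lipschitz_manifold_def
proof
  fix x0 assume "x0 \<in> {x. f x = r}"
  then have r: "f x0 = r" by simp
  let ?M = "{x. f x = r}"
  let ?m = "n - 1"
  obtain v \<eta> \<delta> c where "uniform_ascent f x0 v \<eta> \<delta> c" using asc[OF r] by blast
  from level_set_graph[OF this lip r] obtain u0 \<rho> W s \<Lambda> where v: "v \<noteq> 0" and \<rho>: "0 < \<rho>"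
    and W: "open W" "x0 \<in> W" and \<Lambda>: "0 \<le> \<Lambda>"
    and MW: "?M \<inter> W = {u + s u *\<^sub>R (- v) |u. u \<in> Metric_space.mball {q. B q v = 0} (ip_dist B) u0 \<rho>}"
    and sL: "\<forall>u\<in>Metric_space.mball {q. B q v = 0} (ip_dist B) u0 \<rho>.
      \<forall>w\<in>Metric_space.mball {q. B q v = 0} (ip_dist B) u0 \<rho>. \<bar>s u - s w\<bar> \<le> \<Lambda> * norm (u - w)"
    unfolding Let_def by blast
  define Q where "Q = {q. B q v = 0}"
  have subQ: "subspace Q" and dimQ: "dim Q = ?m"
    unfolding Q_def using orthogonal_complement[OF v] by auto
  interpret M: Metric_space Q "ip_dist B" by (rule Metric_space_ip_dist)
  define D where "D = M.mball u0 \<rho>"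
  note MW = MW[folded Q_def, folded D_def] and sL = sL[folded Q_def, folded D_def]
  have DQ: "u \<in> Q" if "u \<in> D" for u using that by (simp add: D_def)
  obtain b where b: "b \<subseteq> Q" "independent b" "Q \<subseteq> span b" "card b = ?m"
    using basis_exists[of Q] dimQ by metis
  have finb: "finite b" using b(4) n card.infinite by fastforce
  have spanb: "span b = Q" using b span_minimal[OF b(1) subQ] by blast
  obtain \<beta> where "bij_betw \<beta> {0..<?m} b" using ex_bij_betw_nat_finite[OF finb] b(4) by auto
  then have \<beta>: "bij_betw \<beta> {..<?m} b" by (simp add: atLeast0LessThan)
  have \<beta>b: "\<beta> i \<in> b" if "i < ?m" for i using \<beta> that bij_betwE by auto
  define rep where "rep = (\<lambda>u i. representation b u (\<beta> i))"
  have rep_diff: "rep (u - w) i = rep u i - rep w i" if "u \<in> Q" "w \<in> Q" for u w i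
    using that spanb representation_diff[OF b(2), of w u] by (simp add: rep_def)
  have rep_sum: "u = (\<Sum>i<?m. rep u i *\<^sub>R \<beta> i)" if "u \<in> Q" for u
    using sum_representation_eq[OF b(2) _ finb order_refl, of u] that spanb
      sum.reindex_bij_betw[OF \<beta>, of "\<lambda>c. representation b u c *\<^sub>R c"] by (simp add: rep_def)
  have rep_of_sum: "rep (\<Sum>i<?m. z i *\<^sub>R \<beta> i) j = z j" if j: "j < ?m" for z j
  proof -
    have inb: "\<beta> i \<in> span b" if "i < ?m" for i using \<beta>b[OF that] by (rule span_base)
    have "representation b (\<Sum>i<?m. z i *\<^sub>R \<beta> i) =
        (\<lambda>c. \<Sum>i<?m. representation b (z i *\<^sub>R \<beta> i) c)"
      by (rule representation_sum[OF b(2)]) (use inb span_scale in auto)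
    then have "rep (\<Sum>i<?m. z i *\<^sub>R \<beta> i) j = (\<Sum>i<?m. representation b (z i *\<^sub>R \<beta> i) (\<beta> j))"
      by (simp add: rep_def)
    also have "\<dots> = (\<Sum>i<?m. if i = j then z i else 0)"
    proof (rule sum.cong[OF refl])
      fix i assume i: "i \<in> {..<?m}"
      have "\<beta> i = \<beta> j \<longleftrightarrow> i = j"
        using i j inj_on_eq_iff[OF bij_betw_imp_inj_on[OF \<beta>], of i j] by auto
      then show "representation b (z i *\<^sub>R \<beta> i) (\<beta> j) = (if i = j then z i else 0)"
        using i representation_scale[OF b(2) inb] representation_basis[OF b(2) \<beta>b] by auto
    qed
    also have "\<dots> = z j" using j by simp
    finally show ?thesis .
  qed
  obtain C where C: "C > 0" "\<And>u i. u \<in> Q \<Longrightarrow> i < ?m \<Longrightarrow> \<bar>rep u i\<bar> \<le> C * norm u"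
    using representation_bound[OF finb b(2)] \<beta>b spanb unfolding rep_def by blast
  define N where "N = (\<Sum>i<?m. norm (\<beta> i))"
  have N: "N \<ge> 0" by (simp add: N_def sum_nonneg)
  define \<pi> where "\<pi> = (\<lambda>x. x - (B x v / B v v) *\<^sub>R v)"
  have Bv: "B v v > 0" using B_pos[OF v] .
  have \<pi>_graph: "\<pi> (u + t *\<^sub>R (- v)) = u" if "u \<in> Q" for u t
    using that Bv by (simp add: \<pi>_def Q_def B_simps)
  have "linear \<pi>" unfolding \<pi>_def
    by (rule linearI) (simp_all add: B_simps add_divide_distrib algebra_simps)
  then have lin\<pi>: "bounded_linear \<pi>" by (rule linear_imp_bounded_linear)
  obtain P where P: "P \<ge> 0" "\<And>x. norm (\<pi> x) \<le> norm x * P"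
    using bounded_linear.nonneg_bounded[OF lin\<pi>] by blast
  define \<phi> where "\<phi> = (\<lambda>x i. if i < ?m then rep (\<pi> x) i else 0)"
  define L where "L = 1 + ?m * C * P + (1 + \<Lambda> * norm v) * N"
  have mCP: "0 \<le> ?m * C * P" and lN: "0 \<le> (1 + \<Lambda> * norm v) * N"
    using C P \<Lambda> N by auto
  have bilip: "dist x y / L \<le> L2_set (\<lambda>i. \<phi> x i - \<phi> y i) {..<?m} \<and>
      L2_set (\<lambda>i. \<phi> x i - \<phi> y i) {..<?m} \<le> L * dist x y"
    if "x \<in> ?M \<inter> W" "y \<in> ?M \<inter> W" for x y
  proof -
    obtain u where u: "u \<in> D" "x = u + s u *\<^sub>R (- v)" using \<open>x \<in> ?M \<inter> W\<close> MW by blast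
    obtain w where w: "w \<in> D" "y = w + s w *\<^sub>R (- v)" using \<open>y \<in> ?M \<inter> W\<close> MW by blast
    note Qu = DQ[OF u(1)] and Qw = DQ[OF w(1)]
    have \<pi>u: "\<pi> x = u" "\<pi> y = w" using \<pi>_graph Qu Qw u w by auto
    have Quw: "u - w \<in> Q" using subQ Qu Qw by (rule subspace_diff)
    have \<phi>: "\<phi> x i - \<phi> y i = rep (u - w) i" if "i < ?m" for i
      using that rep_diff[OF Qu Qw] \<pi>u by (simp add: \<phi>_def)
    have L2: "L2_set (\<lambda>i. \<phi> x i - \<phi> y i) {..<?m} = L2_set (rep (u - w)) {..<?m}"
      by (rule L2_set_cong) (auto simp: \<phi>)
    have "L2_set (rep (u - w)) {..<?m} \<le> (\<Sum>i<?m. \<bar>rep (u - w) i\<bar>)"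
      by (rule L2_set_le_sum_abs)
    also have "\<dots> \<le> (\<Sum>i<?m. C * (norm (x - y) * P))"
    proof (rule sum_mono)
      fix i assume "i \<in> {..<?m}"
      then have "\<bar>rep (u - w) i\<bar> \<le> C * norm (u - w)" using C(2)[OF Quw] by simp
      also have "\<dots> \<le> C * (norm (x - y) * P)"
      proof -
        have "u - w = \<pi> (x - y)"
          using \<pi>u linear_diff[OF bounded_linear.linear[OF lin\<pi>]] by simp
        then show ?thesis using C(1) P(2)[of "x - y"] by (intro mult_left_mono) auto
      qed
      finally show "\<bar>rep (u - w) i\<bar> \<le> C * (norm (x - y) * P)" .
    qed
    also have "\<dots> = (?m * C * P) * dist x y" by (simp add: dist_norm)
    also have "\<dots> \<le> L * dist x y" using lN by (intro mult_right_mono) (auto simp: L_def)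
    finally have upper: "L2_set (rep (u - w)) {..<?m} \<le> L * dist x y" .
    have "norm (u - w) = norm (\<Sum>i<?m. rep (u - w) i *\<^sub>R \<beta> i)" using arg_cong[OF rep_sum[OF Quw], of norm] .
    also have "\<dots> \<le> (\<Sum>i<?m. \<bar>rep (u - w) i\<bar> * norm (\<beta> i))"
      by (rule order_trans[OF norm_sum]) simp
    also have "\<dots> \<le> (\<Sum>i<?m. L2_set (rep (u - w)) {..<?m} * norm (\<beta> i))"
    proof (intro sum_mono mult_right_mono)
      fix i assume i: "i \<in> {..<?m}"
      have "\<bar>rep (u - w) i\<bar> \<le> L2_set (\<lambda>i. \<bar>rep (u - w) i\<bar>) {..<?m}"
        by (rule member_le_L2_set) (use i in auto)
      then show "\<bar>rep (u - w) i\<bar> \<le> L2_set (rep (u - w)) {..<?m}" by (simp add: L2_set_def)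
    qed simp
    finally have nu: "norm (u - w) \<le> L2_set (rep (u - w)) {..<?m} * N"
      by (simp add: N_def sum_distrib_left)
    have "x - y = (u - w) - (s u - s w) *\<^sub>R v" using u w by (simp add: algebra_simps)
    then have "dist x y \<le> norm (u - w) + \<bar>s u - s w\<bar> * norm v"
      using norm_triangle_ineq4[of "u - w" "(s u - s w) *\<^sub>R v"] by (simp add: dist_norm)
    also have "\<dots> \<le> norm (u - w) + (\<Lambda> * norm (u - w)) * norm v"
      using sL u(1) w(1) by (intro add_left_mono mult_right_mono) auto
    also have "\<dots> = (1 + \<Lambda> * norm v) * norm (u - w)" by (simp add: algebra_simps)
    also have "\<dots> \<le> (1 + \<Lambda> * norm v) * (L2_set (rep (u - w)) {..<?m} * N)"
      using \<Lambda> by (intro mult_left_mono nu) auto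
    also have "\<dots> = ((1 + \<Lambda> * norm v) * N) * L2_set (rep (u - w)) {..<?m}" by simp
    also have "\<dots> \<le> L * L2_set (rep (u - w)) {..<?m}"
      using mCP by (intro mult_right_mono) (auto simp: L_def)
    finally have "dist x y / L \<le> L2_set (rep (u - w)) {..<?m}"
      using mCP lN by (simp add: L_def field_simps)
    then show ?thesis using upper L2 by simp
  qed
  have image: "\<phi> ` (?M \<inter> W) = {z. \<forall>i\<ge>?m. z i = 0} \<inter>
      (\<lambda>z. \<Sum>i<?m. z i *\<^sub>R \<beta> i) -` {y. ip_norm B (u0 - y) < \<rho>}"
  proof (intro equalityI subsetI)
    fix z assume "z \<in> \<phi> ` (?M \<inter> W)"
    then obtain x where x: "x \<in> ?M \<inter> W" "z = \<phi> x" by blast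
    then obtain u where u: "u \<in> D" "x = u + s u *\<^sub>R (- v)" using MW by blast
    then have "\<pi> x = u" using \<pi>_graph DQ by auto
    then have "(\<Sum>i<?m. z i *\<^sub>R \<beta> i) = u"
      using rep_sum[OF DQ[OF u(1)]] x(2) by (simp add: \<phi>_def)
    then show "z \<in> {z. \<forall>i\<ge>?m. z i = 0} \<inter> (\<lambda>z. \<Sum>i<?m. z i *\<^sub>R \<beta> i) -` {y. ip_norm B (u0 - y) < \<rho>}"
      using u(1) x(2) by (simp add: \<phi>_def D_def ip_dist_def)
  next
    fix z assume z: "z \<in> {z. \<forall>i\<ge>?m. z i = 0} \<inter> (\<lambda>z. \<Sum>i<?m. z i *\<^sub>R \<beta> i) -` {y. ip_norm B (u0 - y) < \<rho>}"
    define u where "u = (\<Sum>i<?m. z i *\<^sub>R \<beta> i)"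
    have "u \<in> span b" unfolding u_def by (intro span_sum span_scale span_base \<beta>b) simp
    then have uQ: "u \<in> Q" using spanb by simp
    have "u0 \<in> Q"
    proof -
      have "x0 \<in> ?M \<inter> W" using r W by simp
      then obtain u where "u \<in> D" using MW by blast
      then show ?thesis by (simp add: D_def)
    qed
    then have uD: "u \<in> D" using z uQ by (simp add: D_def ip_dist_def u_def)
    let ?x = "u + s u *\<^sub>R (- v)"
    have "?x \<in> ?M \<inter> W" unfolding MW using uD by blast
    moreover have "\<phi> ?x = z"
    proof
      fix i
      have "\<phi> ?x i = (if i < ?m then rep u i else 0)" unfolding \<phi>_def \<pi>_graph[OF uQ] ..
      then show "\<phi> ?x i = z i" using z rep_of_sum[of i z] by (auto simp: u_def not_less)
    qed
    ultimately show "z \<in> \<phi> ` (?M \<inter> W)" by blast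
  qed
  have Euclidean: "Euclidean_space ?m = top_of_set {z. \<forall>i\<ge>?m. z i = 0}"
    by (simp add: Euclidean_space_def euclidean_product_topology)
  have "openin (Euclidean_space ?m) (\<phi> ` (?M \<inter> W))"
    unfolding image Euclidean
  proof (rule continuous_openin_preimage_gen)
    show "continuous_on {z. \<forall>i\<ge>?m. z i = 0} (\<lambda>z. \<Sum>i<?m. z i *\<^sub>R \<beta> i)"
      by (intro continuous_intros continuous_on_subset[OF continuous_on_product_coordinates]) auto
    show "open {y. ip_norm B (u0 - y) < \<rho>}"
      by (intro open_Collect_less continuous_on_compose2[OF continuous_ip_norm[of UNIV]] continuous_intros) auto
  qed
  then show "\<exists>U (g :: 'a \<Rightarrow> nat \<Rightarrow> real) L. openin (top_of_set ?M) U \<and> x0 \<in> U \<and>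
      openin (Euclidean_space ?m) (g ` U) \<and> 0 < L \<and>
      (\<forall>x\<in>U. \<forall>y\<in>U. dist x y / L \<le> L2_set (\<lambda>i. g x i - g y i) {..<?m} \<and>
         L2_set (\<lambda>i. g x i - g y i) {..<?m} \<le> L * dist x y)"
    using bilip W r mCP lN
    by (intro exI[of _ "?M \<inter> W"] exI[of _ \<phi>] exI[of _ L]) (auto simp: openin_open L_def)
qed

section \<open>Reach of superlevel sets\<close>

lemma ip_nearest_exists:
  assumes "closed A" "A \<noteq> {}"
  shows "\<exists>a\<in>A. \<forall>b\<in>A. ip_dist B q a \<le> ip_dist B q b"
proof -
  obtain m where m: "m > 0" "\<And>x. m * norm x \<le> ip_norm B x" using ip_norm_lower by blast
  obtain a0 where a0: "a0 \<in> A" using assms(2) by blast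
  let ?d = "ip_dist B q"
  let ?S = "A \<inter> {a. ?d a \<le> ?d a0}"
  have contd: "continuous_on S ?d" for S
    unfolding ip_dist_def by (intro continuous_on_compose2[OF continuous_ip_norm[of UNIV]] continuous_intros) auto
  have "closed ?S"
    by (intro closed_Int assms(1) closed_Collect_le contd continuous_intros)
  moreover have "bounded ?S"
  proof (rule boundedI)
    fix a assume "a \<in> ?S"
    then have "m * norm (q - a) \<le> ?d a0" using m(2)[of "q - a"] by (simp add: ip_dist_def)
    then have "norm (q - a) \<le> ?d a0 / m" using m(1) by (simp add: field_simps)
    then show "norm a \<le> norm q + ?d a0 / m" using norm_triangle_ineq4[of q "q - a"] by simp
  qed
  ultimately have cpt: "compact ?S" by (rule closed_bounded_compact)
  have "?S \<noteq> {}" using a0 by auto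
  from continuous_attains_inf[OF cpt this contd]
  obtain a where a: "a \<in> ?S" "\<forall>b\<in>?S. ?d a \<le> ?d b" by blast
  have "?d a \<le> ?d b" if "b \<in> A" for b
    using a that by (cases "?d b \<le> ?d a0") auto
  then show ?thesis using a(1) by blast
qed

text \<open>
  The condition on \<open>q\<close> in the definition of the reach.
\<close>

definition unique_projection :: "'a set \<Rightarrow> 'a \<Rightarrow> bool" where
  "unique_projection A q \<longleftrightarrow> (\<exists>!a. a \<in> A \<and> (\<forall>b\<in>A. ip_dist B q a \<le> ip_dist B q b))"

lemma unique_projection_self:
  assumes "q \<in> A"
  shows "unique_projection A q"
  unfolding unique_projection_def
proof (rule ex1I[of _ q])
  show "q \<in> A \<and> (\<forall>b\<in>A. ip_dist B q q \<le> ip_dist B q b)"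
    using assms ip_norm_nonneg ip_norm_zero_iff[of 0] by (simp add: ip_dist_def)
  fix a assume "a \<in> A \<and> (\<forall>b\<in>A. ip_dist B q a \<le> ip_dist B q b)"
  then have "ip_dist B q a \<le> ip_dist B q q" using assms by blast
  then show "a = q"
    using ip_norm_nonneg[of "q - a"] ip_norm_zero_iff[of "q - a"] ip_norm_zero_iff[of 0] by (simp add: ip_dist_def)
qed

text \<open>
  By the parallelogram law the square of the left-hand side is \<open>R\<^sup>2 - |x - y|^2 / 4\<close>.
\<close>

lemma ip_midpoint:
  assumes "ip_norm B x = R" "ip_norm B y = R" "R > 0"
  shows "ip_norm B ((1/2) *\<^sub>R (x + y)) \<le> R - (ip_norm B (x - y))\<^sup>2 / (8 * R)"
proof -
  let ?d = "ip_norm B (x - y)"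
  have d: "?d \<le> 2 * R"
    using ip_norm_triangle[of x "- y"] ip_norm_scale[of "-1" y] assms by simp
  have "(ip_norm B ((1/2) *\<^sub>R (x + y)))\<^sup>2 = R\<^sup>2 - ?d\<^sup>2 / 4"
  proof -
    have "B x x = R\<^sup>2" "B y y = R\<^sup>2" using assms(1,2) ip_norm_square by metis+
    then show ?thesis unfolding ip_norm_square by (simp add: B_simps B_commute[of y x] field_simps)
  qed
  also have "\<dots> \<le> (R - ?d\<^sup>2 / (8 * R))\<^sup>2"
  proof -
    have "(R - ?d\<^sup>2 / (8 * R))\<^sup>2 = R\<^sup>2 - 2 * R * (?d\<^sup>2 / (8 * R)) + (?d\<^sup>2 / (8 * R))\<^sup>2"
      by (simp add: power2_diff)
    also have "2 * R * (?d\<^sup>2 / (8 * R)) = ?d\<^sup>2 / 4" using assms(3) by simp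
    finally show ?thesis by simp
  qed
  finally show ?thesis
  proof (rule power2_le_imp_le)
    have "?d\<^sup>2 \<le> (2 * R)\<^sup>2" by (intro power_mono d ip_norm_nonneg)
    also have "\<dots> \<le> R * (8 * R)" by (simp add: power2_eq_square)
    finally show "0 \<le> R - ?d\<^sup>2 / (8 * R)" using assms(3) by (simp add: pos_divide_le_eq)
  qed
qed

text \<open>
  Two nearest points \<open>a\<close> and \<open>b\<close> of \<open>q\<close> at distance \<open>R\<close> have a midpoint \<open>z\<close> with \<open>f z \<ge> r - c * |a - b|^2 / 4\<close>, by the upper bounds at
  \<open>z\<close> evaluated at \<open>a\<close> and \<open>b\<close>.  Moving \<open>z\<close> along \<open>v\<close> by \<open>t = k * |a - b|^2\<close> restores the level \<open>r\<close>.  Up to the constants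
  relating the two norms, the distance lost is at most \<open>t * |v|\<close>, and the gain at the midpoint is \<open>|a - b|^2 / (8 * R)\<close>, so \<open>R\<close> cannot be below
  the threshold \<open>\<epsilon>0\<close>.
\<close>

lemma unique_projection_near_boundary:
  assumes asc: "uniform_ascent f p v \<eta> \<delta> c"
    and lip: "\<And>x y. \<bar>f x - f y\<bar> \<le> norm (x - y)" and r: "f p = r"
  shows "\<exists>\<epsilon>>0. \<forall>q. ip_dist B p q < \<epsilon> \<longrightarrow> unique_projection {x. r \<le> f x} q"
proof -
  let ?A = "{x. r \<le> f x}"
  have \<eta>: "\<eta> > 0" and \<delta>: "\<delta> > 0" and c: "c > 0" using asc by (auto simp: uniform_ascent_def)
  have slope: "\<exists>p :: 'a \<Rightarrow>\<^sub>L real. \<eta> \<le> p v \<and> (\<forall>u. f u \<le> f x + p (u - x) + c * (norm (u - x))\<^sup>2)"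
    if "dist p x < \<delta>" for x using asc that by (auto simp: uniform_ascent_def)
  have ascent: "f x + \<eta> * t \<le> f (x + t *\<^sub>R v)"
    if "dist p x < \<delta>" "dist p (x + t *\<^sub>R v) < \<delta>" "0 \<le> t" for x t
    using asc that by (auto simp: uniform_ascent_def)
  have v: "v \<noteq> 0" using slope[of p] \<delta> \<eta> by (auto simp: blinfun.zero_right)
  obtain m where m: "m > 0" "\<And>x. m * norm x \<le> ip_norm B x" using ip_norm_lower by blast
  \<comment> \<open>At rate \<open>\<eta>\<close>, a rise of \<open>c * d\<^sup>2 / 4\<close> takes the time \<open>k * d\<^sup>2\<close>.\<close>
  define k where "k = c / (4 * \<eta>)"
  have k: "k > 0" using c \<eta> by (simp add: k_def)
  have iv: "ip_norm B v > 0" using v ip_norm_nonneg[of v] ip_norm_zero_iff[of v] by linarith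
  have contf: "continuous_on UNIV f"
    by (rule lipschitz_on_continuous_on[of 1], rule lipschitz_onI) (use lip in \<open>auto simp: dist_real_def dist_norm\<close>)
  have clA: "closed ?A" by (intro closed_Collect_le continuous_intros contf)
  have neA: "?A \<noteq> {}" using r by auto
  have lim: "((\<lambda>\<epsilon>. 2 * \<epsilon> / m + k * (4 * \<epsilon> / m)\<^sup>2 * norm v) \<longlongrightarrow> 2 * 0 / m + k * (4 * 0 / m)\<^sup>2 * norm v) (at_right 0)"
    by (intro tendsto_intros) (use m in auto)
  have ev1: "\<forall>\<^sub>F \<epsilon> in at_right 0. 2 * \<epsilon> / m + k * (4 * \<epsilon> / m)\<^sup>2 * norm v < \<delta>"
    by (rule order_tendstoD(2)[OF lim]) (use \<delta> in simp)
  define \<epsilon>0 where "\<epsilon>0 = m\<^sup>2 / (8 * k * ip_norm B v)"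
  have "\<epsilon>0 > 0" using m k iv by (simp add: \<epsilon>0_def)
  then have ev2: "\<forall>\<^sub>F \<epsilon> in at_right 0. 0 < \<epsilon> \<and> \<epsilon> < \<epsilon>0"
    by (auto simp: eventually_at_right_field)
  obtain \<epsilon> where \<epsilon>: "0 < \<epsilon>" "\<epsilon> < \<epsilon>0" "2 * \<epsilon> / m + k * (4 * \<epsilon> / m)\<^sup>2 * norm v < \<delta>"
    using eventually_happens[OF eventually_conj[OF ev1 ev2]] by auto
  have "unique_projection ?A q" if q: "ip_dist B p q < \<epsilon>" for q
  proof -
    obtain a where a: "a \<in> ?A" "\<forall>b\<in>?A. ip_dist B q a \<le> ip_dist B q b"
      using ip_nearest_exists[OF clA neA] by blast
    have "b = a" if b: "b \<in> ?A" "\<forall>x\<in>?A. ip_dist B q b \<le> ip_dist B q x" for b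
    proof (rule ccontr)
      assume ne: "b \<noteq> a"
      define R where "R = ip_dist B q a"
      have bR: "ip_dist B q b = R" using a b by (auto simp: R_def intro: antisym)
      have R\<epsilon>: "R < \<epsilon>" using a(2) r q ip_dist_commute[of p q] by (fastforce simp: R_def)
      have R0: "R > 0"
      proof (rule ccontr)
        assume "\<not> R > 0"
        then have "ip_norm B (q - a) = 0" "ip_norm B (q - b) = 0"
          using ip_norm_nonneg[of "q - a"] bR by (auto simp: R_def ip_dist_def)
        then show False using ne ip_norm_zero_iff by simp
      qed
      have close: "norm (p - y) \<le> 2 * \<epsilon> / m" if "ip_dist B q y \<le> R" for y
      proof -
        have "m * norm (p - y) \<le> ip_dist B p y" using m(2) by (simp add: ip_dist_def)
        also have "\<dots> \<le> 2 * \<epsilon>" using ip_dist_triangle[of p y q] q that R\<epsilon> by linarith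
        finally show ?thesis using m(1) by (simp add: field_simps)
      qed
      define d where "d = norm (a - b)"
      have dle: "d \<le> 4 * \<epsilon> / m"
        using close[of a] close[of b] bR norm_triangle_ineq4[of "p - b" "p - a"] by (simp add: d_def R_def)
      have dip: "m * d \<le> ip_norm B (a - b)" using m(2) by (simp add: d_def)
      define z where "z = (1/2) *\<^sub>R (a + b)"
      have "q - z = (1/2) *\<^sub>R ((q - a) + (q - b))"
      proof -
        have "q - z = (1/2) *\<^sub>R (q + q) - (1/2) *\<^sub>R (a + b)" by (simp add: z_def flip: scaleR_2)
        then show ?thesis by (simp add: algebra_simps)
      qed
      then have qz: "ip_dist B q z \<le> R - (ip_norm B (a - b))\<^sup>2 / (8 * R)"
        using ip_midpoint[of "q - a" R "q - b"] R0 bR ip_norm_minus_commute[of a b]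
        by (simp add: ip_dist_def R_def)
      have zR: "ip_dist B q z \<le> R"
        using qz R0 by (smt (verit, best) divide_nonneg_pos zero_le_power2)
      have zn: "norm (p - z) \<le> 2 * \<epsilon> / m" by (rule close[OF zR])
      define t where "t = k * d\<^sup>2"
      have t0: "t \<ge> 0" using k by (simp add: t_def)
      have d0: "d \<ge> 0" by (simp add: d_def)
      have tle: "t * norm v \<le> k * (4 * \<epsilon> / m)\<^sup>2 * norm v"
        unfolding t_def using k dle d0 by (intro mult_right_mono mult_left_mono power_mono) auto
      have tv0: "k * (4 * \<epsilon> / m)\<^sup>2 * norm v \<ge> 0" using k by simp
      have near1: "dist p z < \<delta>" using zn \<epsilon>(3) tv0 by (simp add: dist_norm)
      have near2: "dist p (z + t *\<^sub>R v) < \<delta>"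
      proof -
        have "dist p (z + t *\<^sub>R v) \<le> norm (p - z) + t * norm v"
          using norm_triangle_ineq4[of "p - z" "t *\<^sub>R v"] t0 by (simp add: dist_norm algebra_simps)
        then show ?thesis using zn tle \<epsilon>(3) by linarith
      qed
      have fz: "r - c * d\<^sup>2 / 4 \<le> f z"
      proof -
        obtain l :: "'a \<Rightarrow>\<^sub>L real" where l: "\<And>u. f u \<le> f z + l (u - z) + c * (norm (u - z))\<^sup>2"
          using slope[OF near1] by blast
        have az: "a - z = (1/2) *\<^sub>R (a - b)" and bz: "b - z = - ((1/2) *\<^sub>R (a - b))"
        proof -
          have half: "(1/2) *\<^sub>R x + (1/2) *\<^sub>R x = x" for x :: 'a by (simp flip: scaleR_add_left)
          show "a - z = (1/2) *\<^sub>R (a - b)" "b - z = - ((1/2) *\<^sub>R (a - b))"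
            using half[of a] half[of b] by (simp_all add: z_def algebra_simps)
        qed
        have sq: "c * (norm ((1/2) *\<^sub>R (a - b)))\<^sup>2 = c * d\<^sup>2 / 4"
          by (simp add: d_def power_mult_distrib power_divide)
        have "r \<le> f z + l ((1/2) *\<^sub>R (a - b)) + c * d\<^sup>2 / 4"
          using l[of a] a(1) unfolding az sq by simp
        moreover have "r \<le> f z - l ((1/2) *\<^sub>R (a - b)) + c * d\<^sup>2 / 4"
          using l[of b] b(1) unfolding bz norm_minus_cancel sq blinfun.minus_right by simp
        ultimately show ?thesis by linarith
      qed
      have "\<eta> * t = c * d\<^sup>2 / 4" using \<eta> by (simp add: t_def k_def)
      then have "z + t *\<^sub>R v \<in> ?A" using ascent[OF near1 near2 t0] fz by simp
      then have "R \<le> ip_dist B q (z + t *\<^sub>R v)" using a(2) by (simp add: R_def)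
      also have "\<dots> \<le> ip_dist B q z + t * ip_norm B v"
        using ip_norm_triangle[of "q - z" "- t *\<^sub>R v"] ip_norm_scale[of "- t" v] t0
        by (simp add: ip_dist_def algebra_simps)
      finally have "(ip_norm B (a - b))\<^sup>2 / (8 * R) \<le> t * ip_norm B v" using qz by linarith
      then have "(ip_norm B (a - b))\<^sup>2 \<le> 8 * R * (k * d\<^sup>2) * ip_norm B v"
        using R0 by (simp add: t_def field_simps)
      moreover have "(m * d)\<^sup>2 \<le> (ip_norm B (a - b))\<^sup>2" using dip m d0 by (intro power_mono) auto
      ultimately have "m\<^sup>2 * d\<^sup>2 \<le> (8 * R * k * ip_norm B v) * d\<^sup>2"
        by (simp add: power_mult_distrib mult_ac)
      moreover have "d\<^sup>2 > 0" using ne by (simp add: d_def)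
      ultimately have "m\<^sup>2 \<le> 8 * R * k * ip_norm B v" by simp
      then have "\<epsilon>0 \<le> R" using k iv by (simp add: \<epsilon>0_def field_simps)
      then show False using R\<epsilon> \<epsilon>(2) by simp
    qed
    then show ?thesis unfolding unique_projection_def using a by blast
  qed
  then show ?thesis using \<epsilon>(1) by blast
qed

lemma reach_lower_bound:
  assumes "0 < \<epsilon>" "\<And>q. ip_dist B p q < \<epsilon> \<Longrightarrow> unique_projection A q"
  shows "ennreal \<epsilon> \<le> reach (ip_dist B) A p"
  unfolding reach_def using assms unfolding unique_projection_def by (intro Sup_upper) blast

lemma superlevel_locally_positive_reach:
  assumes asc: "\<And>x. f x = r \<Longrightarrow> \<exists>v \<eta> \<delta> c. uniform_ascent f x v \<eta> \<delta> c"
    and lip: "\<And>x y. \<bar>f x - f y\<bar> \<le> norm (x - y)"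
  shows "locally_positive_reach (ip_dist B) {x. r \<le> f x}"
  unfolding locally_positive_reach_def
proof
  fix p assume p: "p \<in> {x. r \<le> f x}"
  have "\<exists>\<epsilon>>0. \<forall>q. ip_dist B p q < \<epsilon> \<longrightarrow> unique_projection {x. r \<le> f x} q"
  proof (cases "f p = r")
    case True
    obtain v \<eta> \<delta> c where "uniform_ascent f p v \<eta> \<delta> c" using asc[OF True] by blast
    then show ?thesis by (rule unique_projection_near_boundary[OF _ lip True])
  next
    case False
    then have fp: "f p - r > 0" using p by simp
    obtain m where m: "m > 0" "\<And>x. m * norm x \<le> ip_norm B x" using ip_norm_lower by blast
    have "unique_projection {x. r \<le> f x} q" if "ip_dist B p q < m * (f p - r)" for q
    proof (rule unique_projection_self)
      have "m * norm (p - q) < m * (f p - r)" using that m(2)[of "p - q"] by (simp add: ip_dist_def)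
      then show "q \<in> {x. r \<le> f x}" using m(1) lip[of p q] by simp
    qed
    then show ?thesis using m(1) fp by (intro exI[of _ "m * (f p - r)"]) auto
  qed
  then obtain \<epsilon> where "\<epsilon> > 0" "\<And>q. ip_dist B p q < \<epsilon> \<Longrightarrow> unique_projection {x. r \<le> f x} q" by blast
  then show "0 < reach (ip_dist B) {x. r \<le> f x} p"
    using reach_lower_bound by (metis ennreal_less_zero_iff order_less_le_trans)
qed

text \<open>
  If the projection failed to be unique at points \<open>q\<close> arbitrarily close to the set, the segments from
  the set to \<open>q\<close> would cross the level set at points arbitrarily close to \<open>q\<close>.  By compactness these
  accumulate at a point of the level set, near which projections are unique.
\<close>

lemma superlevel_positive_reach:
  assumes asc: "\<And>x. f x = r \<Longrightarrow> \<exists>v \<eta> \<delta> c. uniform_ascent f x v \<eta> \<delta> c"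
    and lip: "\<And>x y. \<bar>f x - f y\<bar> \<le> norm (x - y)"
    and cpt: "compact {x. f x = r}"
  shows "positive_reach (ip_dist B) {x. r \<le> f x}"
proof -
  let ?A = "{x. r \<le> f x}"
  have contf: "continuous_on S f" for S
    by (rule lipschitz_on_continuous_on[of 1], rule lipschitz_onI) (use lip in \<open>auto simp: dist_real_def dist_norm\<close>)
  have "\<exists>k::nat. \<forall>p\<in>?A. \<forall>q. ip_dist B p q < 1 / real (Suc k) \<longrightarrow> unique_projection ?A q"
  proof (rule ccontr)
    assume "\<not> ?thesis"
    then have "\<forall>k. \<exists>p q. p \<in> ?A \<and> ip_dist B p q < 1 / real (Suc k) \<and> \<not> unique_projection ?A q" by blast
    then obtain p q where pq: "\<And>k. r \<le> f (p k)" "\<And>k. ip_dist B (p k) (q k) < 1 / real (Suc k)"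
      "\<And>k. \<not> unique_projection ?A (q k)" by (metis mem_Collect_eq)
    have "\<exists>y. f y = r \<and> ip_dist B y (q k) \<le> ip_dist B (p k) (q k)" for k
    proof -
      let ?g = "\<lambda>t. p k + t *\<^sub>R (q k - p k)"
      have "q k \<notin> ?A"
      proof
        assume "q k \<in> ?A"
        from unique_projection_self[OF this] pq(3) show False by blast
      qed
      then have "f (q k) < r" by simp
      then have "\<exists>t. 0 \<le> t \<and> t \<le> 1 \<and> f (?g t) = r"
        using pq(1)[of k] by (intro IVT2'[of "\<lambda>t. f (?g t)"])
          (auto intro!: continuous_on_compose2[OF contf[of UNIV]] continuous_intros)
      then obtain t where t: "0 \<le> t" "t \<le> 1" "f (?g t) = r" by blast
      have "?g t - q k = (1 - t) *\<^sub>R (p k - q k)" by (simp add: algebra_simps)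
      then have "ip_dist B (?g t) (q k) = (1 - t) * ip_dist B (p k) (q k)"
        using t by (simp add: ip_dist_def ip_norm_scale)
      also have "\<dots> \<le> ip_dist B (p k) (q k)"
        using t ip_norm_nonneg by (intro mult_left_le_one_le) (auto simp: ip_dist_def)
      finally show ?thesis using t(3) by blast
    qed
    then obtain y where y: "\<And>k. f (y k) = r" "\<And>k. ip_dist B (y k) (q k) \<le> ip_dist B (p k) (q k)" by metis
    obtain l s where l: "f l = r" and s: "strict_mono (s :: nat \<Rightarrow> nat)" "(y \<circ> s) \<longlonglongrightarrow> l"
      using cpt y(1) unfolding compact_eq_seq_compact_metric seq_compact_def by (metis (mono_tags, lifting) mem_Collect_eq)
    obtain v \<eta> \<delta> c where "uniform_ascent f l v \<eta> \<delta> c" using asc[OF l] by blast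
    then obtain \<epsilon> where \<epsilon>: "\<epsilon> > 0" "\<And>q. ip_dist B l q < \<epsilon> \<Longrightarrow> unique_projection ?A q"
      using unique_projection_near_boundary[OF _ lip l] by blast
    obtain b where b: "b > 0" "\<And>x. ip_norm B x \<le> b * norm x" using ip_norm_upper by blast
    have "(\<lambda>k. 1 / real (Suc k)) \<longlonglongrightarrow> 0" by (intro LIMSEQ_Suc lim_1_over_n)
    then have "((\<lambda>k. 1 / real (Suc k)) \<circ> s) \<longlonglongrightarrow> 0" using LIMSEQ_subseq_LIMSEQ s(1) by blast
    then have "(\<lambda>k. b * norm (l - (y \<circ> s) k) + 1 / real (Suc (s k))) \<longlonglongrightarrow> b * norm (l - l) + 0"
      unfolding o_def by (intro tendsto_intros s(2)[unfolded o_def])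
    then have "\<forall>\<^sub>F k in sequentially. b * norm (l - (y \<circ> s) k) + 1 / real (Suc (s k)) < \<epsilon>"
      by (rule order_tendstoD) (use \<epsilon> in simp)
    then obtain k where k: "b * norm (l - y (s k)) + 1 / real (Suc (s k)) < \<epsilon>"
      using eventually_happens trivial_limit_sequentially by fastforce
    have "ip_dist B l (q (s k)) \<le> ip_dist B l (y (s k)) + ip_dist B (y (s k)) (q (s k))"
      by (rule ip_dist_triangle)
    also have "\<dots> < \<epsilon>"
      using k b(2)[of "l - y (s k)"] y(2)[of "s k"] pq(2)[of "s k"] by (simp add: ip_dist_def)
    finally show False using \<epsilon>(2) pq(3) by blast
  qed
  then obtain k :: nat where k: "\<And>p q. p \<in> ?A \<Longrightarrow> ip_dist B p q < 1 / real (Suc k) \<Longrightarrow> unique_projection ?A q"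
    by blast
  have "ennreal (1 / real (Suc k)) \<le> (INF p\<in>?A. reach (ip_dist B) ?A p)"
    by (intro INF_greatest reach_lower_bound k) auto
  moreover have "0 < ennreal (1 / real (Suc k))" by simp
  ultimately show ?thesis unfolding positive_reach_def by (rule order_less_le_trans[rotated])
qed

end

section \<open>Regular and critical levels of the distance function\<close>

theorem theorem4p2:
  fixes n :: nat and F :: "'a::real_normed_vector set"
  assumes "n \<in> {2, 3}"
    and "dim (UNIV :: 'a set) = n"
    and "norm_deriv_lipschitz_on_sphere TYPE('a)"
    and "F \<noteq> {}" and "closed F"
  shows "\<exists>N :: real set. N \<subseteq> {0<..} \<and>
    hausdorff_measure ((real n - 1) / 2) N = 0 \<and>
    (\<forall>r \<in> {0<..} - N.
      (dist_sphere r F = {} \<or> lipschitz_manifold (n - 1) (dist_sphere r F)) \<and>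
      (\<forall>B. inner_product_on_space B \<longrightarrow>
        (dist_sphere r F = {} \<or> semiconcave_surface (n - 1) B (dist_sphere r F)) \<and>
        locally_positive_reach (ip_dist B) (dist_ge r F)) \<and>
      (compact F \<longrightarrow>
        (\<forall>B. inner_product_on_space B \<longrightarrow> positive_reach (ip_dist B) (dist_ge r F)))) \<and>
    (compact F \<longrightarrow> closedin (top_of_set {0<..}) N)"
proof -
  have n: "2 \<le> n" using assms(1) by auto
  then have "n > 0" by simp
  then obtain e :: "nat \<Rightarrow> 'a" and \<kappa> where "bounded_coordinates n e \<kappa>"
    using bounded_coordinates_exist[OF assms(2)] by blast
  then interpret bounded_coordinates n e \<kappa> .
  obtain G :: "'a \<Rightarrow> 'a \<Rightarrow>\<^sub>L real" and K where "smooth_norm G K"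
    using smooth_norm_exists[OF assms(3)] by blast
  then interpret smooth_norm G K .
  interpret distance_function n e \<kappa> G K F
    by unfold_locales (use assms n in auto)
  have regular: "\<exists>v \<eta> \<delta> c. uniform_ascent f x v \<eta> \<delta> c" if "r \<in> {0<..} - f ` crit" "f x = r" for r x
  proof (rule uniform_ascent_at_regular_point)
    show "x \<notin> F" "x \<notin> crit" using that by auto
  qed
  have N: "f ` crit \<subseteq> {0<..}" using f_pos by (auto simp: crit_def)
  have ip: "finite_dim_inner_product n e \<kappa> B" if "inner_product_on_space B" for B
    using that by (intro finite_dim_inner_product.intro bounded_coordinates_axioms inner_product_form.intro)
  have "dist_sphere r F = {} \<or> lipschitz_manifold (n - 1) (dist_sphere r F)" if r: "r \<in> {0<..} - f ` crit" for r
    unfolding dist_sphere_def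
    using finite_dim_inner_product.level_set_lipschitz_manifold[OF ip[OF inner_product_exists] regular[OF r] f_lipschitz n]
    by blast
  moreover have "(dist_sphere r F = {} \<or> semiconcave_surface (n - 1) B (dist_sphere r F)) \<and>
      locally_positive_reach (ip_dist B) (dist_ge r F)"
    if r: "r \<in> {0<..} - f ` crit" and B: "inner_product_on_space B" for r B
    unfolding dist_sphere_def dist_ge_def
    using finite_dim_inner_product.level_set_semiconcave_surface[OF ip[OF B] regular[OF r] f_lipschitz _ \<open>n > 0\<close>]
      finite_dim_inner_product.superlevel_locally_positive_reach[OF ip[OF B] regular[OF r] f_lipschitz]
    by blast
  moreover have "positive_reach (ip_dist B) (dist_ge r F)"
    if r: "r \<in> {0<..} - f ` crit" and cpt: "compact F" and B: "inner_product_on_space B" for r B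
  proof -
    obtain R where R: "\<And>y. y \<in> F \<Longrightarrow> norm y \<le> R"
      using compact_imp_bounded[OF cpt] by (auto simp: bounded_iff)
    have "compact {x. f x = r}"
    proof (rule closed_bounded_compact)
      show "closed {x. f x = r}" by (intro closed_Collect_eq continuous_intros)
      show "bounded {x. f x = r}"
      proof (rule boundedI)
        fix x assume x: "x \<in> {x. f x = r}"
        obtain y where y: "y \<in> nearest F x" using nearest_nonempty by blast
        then have "norm (x - y) = r" "norm y \<le> R" using x R by (auto simp: nearest_def dist_norm)
        then show "norm x \<le> R + r" using norm_triangle_ineq[of y "x - y"] by simp
      qed
    qed
    from finite_dim_inner_product.superlevel_positive_reach[OF ip[OF B] regular[OF r] f_lipschitz this]
    show ?thesis unfolding dist_ge_def by blast
  qed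
  ultimately show ?thesis
    using N crit_values_null crit_values_closed by (intro exI[of _ "f ` crit"]) blast
qed

end
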